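(* Let $r$ and $s$ be integers with $r\geq s+2\geq 2$, and let $\mu_{r,s}=R_{r-s+1,1}\boxtimes R_{1,\frac12}^{\boxtimes s}$. Define $$w_{r,s}^{\ast}=\frac{1-s+\sqrt{(1-s)^2+4(r+1)(r-s)}}{2(r-s)}>1,$$ $$x_{r,s}^{\ast}=\frac{r+1}{s+1}\,\frac{(w_{r,s}^{\ast})^r}{(w_{r,s}^{\ast}+1)^{s-1}\left(w_{r,s}^{\ast}-\frac{s-1}{s+1}\right)}>0.$$ Then the measure $\mu_{r,s}$ is supported on the interval $[0,x_{r,s}^{\ast}]$ and has a strictly positive density on the interval $(0,x_{r,s}^{\ast})$ given by $$\frac{d\mu_{r,s}}{dx}(x)=\frac{1}{2\pi^2x}\,\mathrm{Re}\int_{\gamma_{2\pi/(r+1)}}\log\left(1-x\frac{(t-1)(t+1)^s}{t^{r+1}}\right)dt .$$ Moreover, the density behaves like $x^{-r/(r+1)}$ as $x\to 0+$ and it vanishes like a square root as $x\to x_{r,s}^{\ast}-$, i.e. the limits $$\lim_{x\to0+}x^{r/(r+1)}\frac{d\mu_{r,s}}{dx}(x)\qquad\text{and}\qquad \lim_{x\to x_{r,s}^{\ast}-}\frac{1}{\sqrt{x_{r,s}^{\ast}-x}}\,\frac{d\mu_{r,s}}{dx}(x)$$ exist and are positive (finite) numbers. Hence, of these two types of boundary behavior, only the one at the origin depends on the number $r$ of matrices in the underlying product (the exponent at the right endpoint is always $1/2$).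
   Context: Raney distributions: for real parameters $\alpha\geq 1$ and $0<\beta\leq\alpha$, $R_{\alpha,\beta}$ is the compactly supported probability measure on $[0,\infty)$ with moments $$R_{\alpha,\beta}(k)=\frac{\beta}{k\alpha+\beta}\binom{k\alpha+\beta}{k},\qquad k=0,1,2,\ldots$$ In particular $R_{1,\frac12}$ is the arcsine distribution on $[0,1]$ with density $\frac{1}{\pi\sqrt{x(1-x)}}$. The symbol $\boxtimes$ denotes free multiplicative convolution, and $R_{1,\frac12}^{\boxtimes s}$ is the $s$-fold free multiplicative convolution power (for $s=0$ it is the point mass $\delta_1$, so $\mu_{r,0}=R_{r+1,1}$). The measure $\mu_{r,s}$ is the limiting distribution of the rescaled squared singular values (eigenvalues of $\frac{1}{n^{r-s}}Y_{r,s}^{\ast}Y_{r,s}$) of products $Y_{r,s}=G_r\cdots G_{s+1}T_s\cdots T_1$ of $r-s$ complex Ginibre matrices $G_j$ and $s$ truncated Haar unitary matrices $T_j$. Path and branch: for an angle $\alpha$, $\gamma_\alpha$ is the concatenation $\gamma_\alpha^{(1)}\oplus\gamma_\alpha^{(2)}$ of two semi-infinite rays, where $\gamma_\alpha^{(1)}$ is the path $t\mapsto e^{i\alpha}/t$, $t>0$ (running from infinity to the origin along the ray of argument $\alpha$), and $\gamma_\alpha^{(2)}$ is the positive real axis (running from the origin to $+\infty$). On each ray the branch of the logarithm is the analytic continuation along the ray of the principal branch, starting at the point at infinity on that ray (where the argument of the logarithm tends to $1$). *)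

theory Defs
  imports
    "HOL-Probability.Probability"
    "HOL-Library.Poly_Mapping"
    "HOL-Computational_Algebra.Polynomial"
begin

section \<open>Free multiplicative convolution\<close>

text \<open>
  The free monoid, written additively because the convolution product of
  \<^theory>\<open>HOL-Library.Poly_Mapping\<close> is based on addition of the keys. The type
  \<open>'i word \<Rightarrow>\<^sub>0 complex\<close> is then the unital algebra of polynomials with complex coefficients
  in noncommuting indeterminates indexed by \<open>'i\<close>.
\<close>

datatype 'i word = Word (letters: "'i list")

instantiation word :: (type) monoid_add
begin

definition zero_word :: "'a word" where
  "zero_word = Word []"

definition plus_word :: "'a word \<Rightarrow> 'a word \<Rightarrow> 'a word" where
  "plus_word u v = Word (letters u @ letters v)"

instance
  by standard (simp_all add: zero_word_def plus_word_def)

end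

type_synonym 'i nc_poly = "'i word \<Rightarrow>\<^sub>0 complex"

definition nc_const :: "complex \<Rightarrow> 'i nc_poly" where
  "nc_const c = Poly_Mapping.single 0 c"

definition nc_var :: "'i \<Rightarrow> 'i nc_poly" where
  "nc_var i = Poly_Mapping.single (Word [i]) 1"

definition nc_eval :: "complex poly \<Rightarrow> 'i nc_poly \<Rightarrow> 'i nc_poly" where
  "nc_eval p a = (\<Sum>k\<le>Polynomial.degree p. nc_const (coeff p k) * a ^ k)"

definition nc_expectation :: "('i nc_poly \<Rightarrow> complex) \<Rightarrow> bool" where
  "nc_expectation \<phi> \<longleftrightarrow>
     (\<forall>a b. \<phi> (a + b) = \<phi> a + \<phi> b) \<and> (\<forall>c a. \<phi> (nc_const c * a) = c * \<phi> a) \<and> \<phi> 1 = 1"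

text \<open>
  Free independence of the unital subalgebras generated by the elements \<open>a i\<close>: the expectation
  of an alternating product of centred elements vanishes. The subalgebra generated by \<open>a i\<close>
  consists of the polynomials in \<open>a i\<close>.
\<close>

definition freely_independent :: "('i nc_poly \<Rightarrow> complex) \<Rightarrow> ('j \<Rightarrow> 'i nc_poly) \<Rightarrow> bool" where
  "freely_independent \<phi> a \<longleftrightarrow>
     (\<forall>ps :: ('j \<times> complex poly) list.
        ps \<noteq> [] \<longrightarrow> distinct_adj (map fst ps) \<longrightarrow>
        (\<forall>(j, p) \<in> set ps. \<phi> (nc_eval p (a j)) = 0) \<longrightarrow>
        \<phi> (prod_list (map (\<lambda>(j, p). nc_eval p (a j)) ps)) = 0)"

definition compact_prob_on_halfline :: "real measure \<Rightarrow> bool" where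
  "compact_prob_on_halfline \<mu> \<longleftrightarrow>
     prob_space \<mu> \<and> sets \<mu> = sets borel \<and> (\<exists>M. AE x in \<mu>. 0 \<le> x \<and> x \<le> M)"

definition has_law :: "('i nc_poly \<Rightarrow> complex) \<Rightarrow> 'i nc_poly \<Rightarrow> real measure \<Rightarrow> bool" where
  "has_law \<phi> a \<mu> \<longleftrightarrow> (\<forall>k. \<phi> (a ^ k) = complex_of_real (\<integral>x. x ^ k \<partial>\<mu>))"

text \<open>
  \<open>is_free_mult_conv \<mu> \<nu> \<rho>\<close> says that \<open>\<rho>\<close> is the free multiplicative convolution of \<open>\<mu>\<close> and \<open>\<nu>\<close>:
  it is the distribution of the product of two freely independent variables with distributions
  \<open>\<mu>\<close> and \<open>\<nu>\<close>. There is no loss of generality in taking the variables to be the two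
  indeterminates of the free algebra, since any noncommutative probability space containing such
  a pair can be pulled back to it along evaluation. For positive operators \<open>a\<close>, \<open>b\<close> the measure
  is usually introduced as the law of \<open>\<surd>a b \<surd>a\<close>; its moments are those of \<open>a b\<close>, because the
  joint distribution of two free variables is tracial. Compact support makes
  \<open>\<rho>\<close> unique. Its existence is the classical theorem behind the operation and is not encoded here,
  which is why the operation is a relation.
\<close>

definition is_free_mult_conv :: "real measure \<Rightarrow> real measure \<Rightarrow> real measure \<Rightarrow> bool" where
  "is_free_mult_conv \<mu> \<nu> \<rho> \<longleftrightarrow>
     compact_prob_on_halfline \<mu> \<and> compact_prob_on_halfline \<nu> \<and> compact_prob_on_halfline \<rho> \<and>
     (\<exists>\<phi> :: bool nc_poly \<Rightarrow> complex.
        nc_expectation \<phi> \<and> freely_independent \<phi> nc_var \<and>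
        has_law \<phi> (nc_var False) \<mu> \<and> has_law \<phi> (nc_var True) \<nu> \<and>
        has_law \<phi> (nc_var False * nc_var True) \<rho>)"

primrec is_free_mult_power :: "real measure \<Rightarrow> nat \<Rightarrow> real measure \<Rightarrow> bool" where
  "is_free_mult_power \<mu> 0 \<rho> \<longleftrightarrow> \<rho> = return borel 1"
| "is_free_mult_power \<mu> (Suc n) \<rho> \<longleftrightarrow>
     (\<exists>\<sigma>. is_free_mult_power \<mu> n \<sigma> \<and> is_free_mult_conv \<sigma> \<mu> \<rho>)"


section \<open>Raney distributions\<close>

definition is_raney :: "real \<Rightarrow> real \<Rightarrow> real measure \<Rightarrow> bool" where
  "is_raney \<alpha> \<beta> \<mu> \<longleftrightarrow>
     1 \<le> \<alpha> \<and> 0 < \<beta> \<and> \<beta> \<le> \<alpha> \<and> compact_prob_on_halfline \<mu> \<and>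
     (\<forall>k::nat. (\<integral>x. x ^ k \<partial>\<mu>) = \<beta> / (real k * \<alpha> + \<beta>) * ((real k * \<alpha> + \<beta>) gchoose k))"


section \<open>Integration along the path\<close>

definition gamma_in :: "real \<Rightarrow> real \<Rightarrow> complex" where
  "gamma_in \<alpha> t = cis \<alpha> / complex_of_real t"

definition gamma_out :: "real \<Rightarrow> complex" where
  "gamma_out t = complex_of_real t"

definition gamma_integrable :: "real \<Rightarrow> (complex \<Rightarrow> complex) \<Rightarrow> bool" where
  "gamma_integrable \<alpha> f \<longleftrightarrow>
     set_integrable lborel {0<..} (\<lambda>t. f (gamma_in \<alpha> t) * vector_derivative (gamma_in \<alpha>) (at t)) \<and>
     set_integrable lborel {0<..} (\<lambda>t. f (gamma_out t) * vector_derivative gamma_out (at t))"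

definition gamma_integral :: "real \<Rightarrow> (complex \<Rightarrow> complex) \<Rightarrow> complex" where
  "gamma_integral \<alpha> f =
     (LINT t:{0<..}|lborel. f (gamma_in \<alpha> t) * vector_derivative (gamma_in \<alpha>) (at t)) +
     (LINT t:{0<..}|lborel. f (gamma_out t) * vector_derivative gamma_out (at t))"

text \<open>
  The value at \<open>t\<close> of the logarithm of \<open>g\<close>, continued along the ray from the origin through \<open>t\<close>,
  starting with the principal branch near the point at infinity of that ray. The part of the
  ray beyond \<open>t\<close> is parametrized as \<open>u t\<close> with \<open>u \<ge> 1\<close>.
\<close>

definition log_along_ray :: "(complex \<Rightarrow> complex) \<Rightarrow> complex \<Rightarrow> complex" where
  "log_along_ray g t =
     (THE z. \<exists>L :: real \<Rightarrow> complex.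
        continuous_on {1..} L \<and>
        (\<forall>u\<ge>1. exp (L u) = g (complex_of_real u * t)) \<and>
        (\<forall>\<^sub>F u in at_top. L u = Ln (g (complex_of_real u * t))) \<and>
        z = L 1)"


section \<open>The endpoint and the density\<close>

definition w_star :: "nat \<Rightarrow> nat \<Rightarrow> real" where
  "w_star r s =
     (1 - real s + sqrt ((1 - real s)\<^sup>2 + 4 * (real r + 1) * (real r - real s)))
       / (2 * (real r - real s))"

definition x_star :: "nat \<Rightarrow> nat \<Rightarrow> real" where
  "x_star r s =
     (real r + 1) / (real s + 1) *
     (w_star r s ^ r /
       ((w_star r s + 1) powi (int s - 1) * (w_star r s - (real s - 1) / (real s + 1))))"

definition path_angle :: "nat \<Rightarrow> real" where
  "path_angle r = 2 * pi / (real r + 1)"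

definition log_integrand :: "nat \<Rightarrow> nat \<Rightarrow> real \<Rightarrow> complex \<Rightarrow> complex" where
  "log_integrand r s x =
     log_along_ray (\<lambda>t. 1 - complex_of_real x * ((t - 1) * (t + 1) ^ s / t ^ (r + 1)))"

definition mu_density :: "nat \<Rightarrow> nat \<Rightarrow> real \<Rightarrow> real" where
  "mu_density r s x =
     1 / (2 * pi\<^sup>2 * x) * Re (gamma_integral (path_angle r) (log_integrand r s x))"

end

theory Submission
  imports Defs "HOL-Complex_Analysis.Complex_Analysis" "HOL-Real_Asymp.Real_Asymp"
    "HOL-Computational_Algebra.Fundamental_Theorem_Algebra"
begin

unbundle no vec_syntax

text \<open>
  Write \<open>z(w) = w\<^sup>r\<^sup>+\<^sup>1 / ((w - 1) (w + 1)\<^sup>s)\<close>. Multiplicativity of the S-transform shows that the moment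
  series of \<open>\<mu>\<close> inverts \<open>1 / z\<close> near \<open>w = 1\<close>, so by Lagrange inversion the \<open>k\<close>-th moment is \<open>1 / k\<close>
  times the residue of \<open>z\<^sup>k\<close> at \<open>1\<close>.

  For \<open>0 < x < x_star\<close> the argument of the logarithm is \<open>1 - x / z(t) = \<Prod>\<^sub>j (1 - w\<^sub>j / t)\<close>, where the
  \<open>w\<^sub>j\<close> are the \<open>r + 1\<close> solutions of \<open>z(w) = x\<close>, and it avoids \<open>(-\<infinity>, 0]\<close> on both rays. Hence its
  logarithm is the sum of the \<open>Ln (1 - w\<^sub>j / t)\<close>, each of which has an elementary antiderivative. The
  behaviour at the origin shows that exactly one root \<open>W(x)\<close> lies in the sector
  \<open>0 < arg w < 2 \<pi> / (r + 1)\<close>, and the integral over the path is \<open>- 2 \<pi> \<i> W(x)\<close>. So the formula for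
  the density reads \<open>Im W(x) / (\<pi> x)\<close>, and positivity and the boundary behaviour follow from local
  coordinates of \<open>z\<close> at \<open>0\<close> and at its critical point \<open>w_star\<close>.

  Finally, \<open>k x\<^sup>k\<^sup>-\<^sup>1 W(x)\<close> is the derivative of \<open>x\<^sup>k W(x) - Q(W(x))\<close> for a primitive \<open>Q\<close> of \<open>z\<^sup>k\<close> in the
  upper half-plane, and the jump of \<open>Im Q\<close> between \<open>0\<close> and \<open>w_star\<close> is \<open>\<pi>\<close> times the same residue. Thus
  \<open>\<mu>\<close> and the measure with this density have the same moments, and they coincide since both have
  bounded support.
\<close>

section \<open>Lagrange inversion\<close>

text \<open>The angle 2 pi / (r + 1) serves twice. It makes \<open>t ^ (r + 1)\<close> positive on
  both rays, and the r + 1 shifts \<i> \<alpha> of the rotated logarithms add up to exactly one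
  turn, which is what counts the roots in the sector. The hypothesis r >= s + 2 removes the term of
  degree r from the polynomial t^(r+1) - x (t - 1) (t + 1)^s, so its roots sum to zero. This cancels
  the 1/u tails of the logarithms, which are not integrable one by one, and the contribution of \<i>
  \<alpha> to the integral. On the positive axis the cut is avoided because \<open>x_star\<close> is
  the minimum of z on (1, infinity). On the slanted ray this needs a genuine cotangent inequality,
  whose extreme case is r = s + 2. Free convolution enters only through moments, so that side is
  formal algebra over power series. The residue formula says nothing for k = 0; the total mass is
  obtained separately from a branch of log z.\<close>

lemma fps_Lagrange_inversion:
  fixes g p :: "'a::field_char_0 fps"
  assumes g0: "g $ 0 \<noteq> 0" and p: "p oo (fps_X / g) = fps_X" and n: "n > 0"
  shows "of_nat n * p $ n = (g ^ n) $ (n - 1)"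
proof -
  define h where "h = inverse g"
  have hg: "h * g = 1" using g0 by (simp add: h_def inverse_mult_eq_1)
  define cc where "cc = fps_X * h"
  have cc: "fps_X / g = cc" using g0 by (simp add: cc_def h_def fps_divide_unit)
  have cc0: "cc $ 0 = 0" by (simp add: cc_def)
  have dg: "fps_deriv h = - fps_deriv g * h\<^sup>2"
    using g0 by (simp add: h_def fps_inverse_deriv)
  define q where "q = fps_deriv p"
  have q1: "(q oo cc) * fps_deriv cc = 1"
    using arg_cong[OF p[unfolded cc], of fps_deriv] cc0 by (simp add: q_def fps_compose_deriv)
  \<comment> \<open>Only the coefficients of \<open>q\<close> below \<open>n\<close> matter: after
    substitution the tail is divisible by \<open>cc ^ n\<close>, hence by
    \<open>fps_X ^ n\<close>.\<close>
  define q' where "q' = fps_shift n q"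
  have qs: "q = (\<Sum>k<n. fps_const (q $ k) * fps_X ^ k) + fps_X ^ n * q'"
    by (rule fps_ext) (simp add: q'_def fps_sum_nth fps_X_power_mult_nth if_distrib [of "\<lambda>x. _ * x"] fps_X_power_nth cong: if_cong)
  have qc: "q oo cc = (\<Sum>k<n. fps_const (q $ k) * cc ^ k) + cc ^ n * (q' oo cc)"
    by (subst qs) (simp add: fps_compose_add_distrib fps_compose_sum_distrib fps_compose_mult_distrib[OF cc0]
      fps_compose_power[OF cc0, symmetric] cc0)
  \<comment> \<open>Since \<open>g\<close> is \<open>fps_X / cc\<close>, this is the residue of
    \<open>cc ^ (k - n)\<close> times the derivative of \<open>cc\<close>. It is the residue of a
    derivative unless \<open>k = n - 1\<close>. Powers of \<open>g\<close> are used to stay within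
    power series.\<close>
  have coef: "(cc ^ k * fps_deriv cc * g ^ n) $ (n - 1) = (if k = n - 1 then 1 else 0)" if k: "k < n" for k
  proof -
    define m where "m = n - 1 - k"
    have nm: "n = k + Suc m" using k by (simp add: m_def)
    have hk: "h ^ k * g ^ n = g ^ Suc m"
      by (simp only: nm power_add mult.assoc[symmetric] power_mult_distrib[symmetric] hg power_one mult_1)
    have "cc ^ k * fps_deriv cc * g ^ n = fps_X ^ k * (h ^ k * g ^ n) * (h + fps_X * fps_deriv h)"
      by (simp add: cc_def power_mult_distrib algebra_simps)
    also have "\<dots> = fps_X ^ k * (g ^ m * (h * g) - fps_X * (g ^ m * fps_deriv g * (h * (h * g))))"
      unfolding hk dg by (simp add: power2_eq_square algebra_simps)
    also have "\<dots> = fps_X ^ k * (g ^ m - fps_X * (g ^ m * h * fps_deriv g))"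
      unfolding hg by (simp add: algebra_simps)
    finally have e: "(cc ^ k * fps_deriv cc * g ^ n) $ (n - 1) = (g ^ m - fps_X * (g ^ m * h * fps_deriv g)) $ m"
      by (simp add: fps_X_power_mult_nth nm)
    show ?thesis
    proof (cases m)
      case 0 then show ?thesis unfolding e using nm by (simp)
    next
      case (Suc l)
      have gl: "g ^ m * h = g ^ l" using hg Suc by (simp add: mult_ac)
      have d: "fps_deriv (g ^ m) = fps_const (of_nat m) * (g ^ m * h * fps_deriv g)"
        unfolding gl fps_deriv_power by (simp only: Suc diff_Suc_1 mult_ac)
      have "of_nat m * (fps_X * (g ^ m * h * fps_deriv g)) $ m = (fps_X * fps_deriv (g ^ m)) $ m"
        unfolding d by (simp add: Suc del: of_nat_Suc power_Suc)
      also have "\<dots> = of_nat m * (g ^ m) $ m" by (simp add: Suc del: power_Suc of_nat_Suc)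
      finally have "(fps_X * (g ^ m * h * fps_deriv g)) $ m = (g ^ m) $ m"
        using Suc by (simp del: of_nat_Suc)
      then show ?thesis unfolding e using nm Suc by simp
    qed
  qed
  have "(g ^ n) $ (n - 1) = ((q oo cc) * fps_deriv cc * g ^ n) $ (n - 1)" by (simp add: q1)
  also have "(q oo cc) * fps_deriv cc * g ^ n = (\<Sum>k<n. fps_const (q $ k) * (cc ^ k * fps_deriv cc * g ^ n))
      + fps_X ^ n * (h ^ n * (q' oo cc) * fps_deriv cc * g ^ n)"
  proof -
    have "cc ^ n = fps_X ^ n * h ^ n" by (simp add: cc_def power_mult_distrib)
    then show ?thesis unfolding qc by (simp add: distrib_right sum_distrib_right mult.assoc)
  qed
  also have "\<dots> $ (n - 1) = (\<Sum>k<n. q $ k * (cc ^ k * fps_deriv cc * g ^ n) $ (n - 1))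
      + (fps_X ^ n * (h ^ n * (q' oo cc) * fps_deriv cc * g ^ n)) $ (n - 1)"
    by (simp only: fps_add_nth fps_sum_nth fps_mult_left_const_nth)
  also have "\<dots> = (\<Sum>k<n. q $ k * (cc ^ k * fps_deriv cc * g ^ n) $ (n - 1))"
    using n by (simp add: fps_X_power_mult_nth)
  also have "\<dots> = (\<Sum>k<n. if k = n - 1 then q $ k else 0)"
    by (intro sum.cong refl) (auto simp: coef simp del: One_nat_def)
  also have "\<dots> = q $ (n - 1)" using n by simp
  finally show ?thesis using n by (simp add: q_def)
qed

section \<open>The S-transform of a product of free variables\<close>

lemma nc_const_add: "nc_const (a + b) = nc_const a + nc_const b"
  by (simp add: nc_const_def single_add)

lemma nc_const_mult: "nc_const (a * b) = nc_const a * nc_const b"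
  by (simp add: nc_const_def mult_single)

lemma nc_const_0 [simp]: "nc_const 0 = 0" and nc_const_1 [simp]: "nc_const 1 = 1"
  by (simp_all add: nc_const_def)

lemma nc_const_sum: "nc_const (sum f A) = (\<Sum>x\<in>A. nc_const (f x))"
  by (induction A rule: infinite_finite_induct) (simp_all add: nc_const_add)

lemma nc_const_commute: "p * nc_const c = nc_const c * p"
proof (induction p rule: Poly_Mapping.update_induct)
  case (update p k v)
  have "Poly_Mapping.update k v p = p + Poly_Mapping.single k v"
    using update by (intro poly_mapping_eqI)
      (auto simp: lookup_update lookup_add lookup_single in_keys_iff when_def)
  moreover have "Poly_Mapping.single k v * nc_const c = nc_const c * Poly_Mapping.single k v"
    by (simp add: nc_const_def mult_single mult.commute)
  ultimately show ?case using update by (simp add: algebra_simps)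
qed simp

text \<open>The computations take place in power series over the free algebra. The image of this map
  is central, so \<open>fps_X\<close> and the S-transforms act there as scalars that can be moved
  past the variables.\<close>

definition fps_emb :: "complex fps \<Rightarrow> 'i nc_poly fps" where
  "fps_emb f = Abs_fps (\<lambda>n. nc_const (f $ n))"

lemma fps_emb_nth [simp]: "fps_emb f $ n = nc_const (f $ n)"
  by (simp add: fps_emb_def)

lemma fps_emb_add: "fps_emb (f + g) = fps_emb f + fps_emb g"
  by (simp add: fps_eq_iff nc_const_add)

lemma fps_emb_mult: "fps_emb (f * g) = fps_emb f * fps_emb g"
  by (simp add: fps_eq_iff fps_mult_nth nc_const_sum nc_const_mult)

lemma fps_emb_1 [simp]: "fps_emb 1 = 1"
  by (rule fps_ext) simp

lemma fps_emb_X: "fps_emb fps_X = fps_X"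
  by (rule fps_ext) (simp add: fps_X_def)

lemma fps_emb_commute: "F * fps_emb f = fps_emb f * F"
proof (rule fps_ext)
  fix n
  have "(F * fps_emb f) $ n = (\<Sum>i=0..n. fps_emb f $ (n - i) * F $ i)"
    by (simp add: fps_mult_nth nc_const_commute)
  also have "\<dots> = (fps_emb f * F) $ n"
    unfolding fps_mult_nth by (rule sum.reindex_bij_witness[of _ "\<lambda>i. n - i" "\<lambda>i. n - i"]) auto
  finally show "(F * fps_emb f) $ n = (fps_emb f * F) $ n" .
qed

lemma fps_emb_left_commute: "F * (fps_emb f * G) = fps_emb f * (F * G)"
  by (metis fps_emb_commute mult.assoc)

text \<open>This is \<open>f\<close> times the inverse of \<open>1 - s x\<close>, that is, the sum
  of all \<open>f * s ^ k * x ^ k\<close>. If \<open>s\<close> has no constant term, the coefficient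
  of index \<open>n\<close> involves only the powers up to \<open>n\<close>, so a finite sum
  suffices.\<close>

definition nc_geometric :: "complex fps \<Rightarrow> complex fps \<Rightarrow> 'i nc_poly \<Rightarrow> 'i nc_poly fps" where
  "nc_geometric f s x = Abs_fps (\<lambda>n. \<Sum>k\<le>n. nc_const ((f * s ^ k) $ n) * x ^ k)"

lemma fps_mult_power_nth_eq_0:
  fixes f s :: "complex fps"
  assumes "s $ 0 = 0" "n < k"
  shows "(f * s ^ k) $ n = 0"
proof -
  have "(s ^ k) $ m = 0" if "m < k" for m
    using startsby_zero_power_prefix[OF assms(1)] that by blast
  then show ?thesis using assms(2) by (auto simp: fps_mult_nth intro!: sum.neutral)
qed

text \<open>A cutoff independent of \<open>n\<close> gives all lower coefficients the same range of
  summation, so that sums can be interchanged in a product.\<close>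

lemma nc_geometric_nth:
  assumes "s $ 0 = 0" "n \<le> N"
  shows "nc_geometric f s x $ n = (\<Sum>k\<le>N. nc_const ((f * s ^ k) $ n) * x ^ k)"
  unfolding nc_geometric_def fps_nth_Abs_fps
  by (rule sum.mono_neutral_left) (use assms in \<open>auto simp: fps_mult_power_nth_eq_0\<close>)

lemma fps_emb_mult_nc_geometric:
  assumes s: "s $ 0 = 0"
  shows "fps_emb g * nc_geometric f s x = nc_geometric (g * f) s x"
proof (rule fps_ext)
  fix n
  have "(fps_emb g * nc_geometric f s x) $ n =
      (\<Sum>i=0..n. \<Sum>k\<le>n. nc_const (g $ i * (f * s ^ k) $ (n - i)) * x ^ k)"
    by (simp add: fps_mult_nth[of "fps_emb g"] nc_geometric_nth[OF s, of _ n] sum_distrib_left nc_const_mult mult.assoc)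
  also have "\<dots> = (\<Sum>k\<le>n. nc_const ((g * (f * s ^ k)) $ n) * x ^ k)"
    by (subst sum.swap) (simp add: fps_mult_nth[of g] nc_const_sum sum_distrib_right)
  also have "\<dots> = nc_geometric (g * f) s x $ n"
    by (simp add: nc_geometric_def mult.assoc)
  finally show "(fps_emb g * nc_geometric f s x) $ n = nc_geometric (g * f) s x $ n" .
qed

text \<open>The algebra is noncommutative, so invertibility of \<open>1 - s x\<close> from the left
  and from the right are separate facts. Both hold because \<open>x\<close> commutes with its own
  powers.\<close>

lemma nc_geometric_unfold:
  assumes s: "s $ 0 = 0"
  shows "nc_geometric 1 s x = 1 + fps_emb s * (nc_geometric 1 s x * fps_const x)"
    and "nc_geometric 1 s x = 1 + fps_emb s * (fps_const x * nc_geometric 1 s x)"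
proof -
  have xl: "x * (nc_const c * y) = nc_const c * (x * y)" for c y
    by (metis nc_const_commute mult.assoc)
  have "fps_const x * nc_geometric 1 s x = nc_geometric 1 s x * fps_const x"
    by (rule fps_ext) (simp add: nc_geometric_def sum_distrib_left sum_distrib_right
        power_commutes mult.assoc xl)
  moreover show "nc_geometric 1 s x = 1 + fps_emb s * (nc_geometric 1 s x * fps_const x)"
  proof (rule fps_ext)
    fix n
    have "(1 + fps_emb s * (nc_geometric 1 s x * fps_const x)) $ n = 1 $ n + (nc_geometric s s x * fps_const x) $ n"
      by (simp add: mult.assoc[symmetric] fps_emb_mult_nc_geometric[OF s])
    also have "\<dots> = 1 $ n + (\<Sum>k\<le>n. nc_const (((1 * s ^ Suc k)) $ n) * x ^ Suc k)"
      by (simp add: nc_geometric_def sum_distrib_right mult.assoc power_commutes)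
    also have "\<dots> = (\<Sum>k\<le>Suc n. nc_const ((1 * s ^ k) $ n) * x ^ k)"
      by (subst sum.atMost_Suc_shift) (auto simp: fps_one_nth)
    also have "\<dots> = nc_geometric 1 s x $ n"
      using s by (subst nc_geometric_nth[of s n "Suc n"]) auto
    finally show "nc_geometric 1 s x $ n = (1 + fps_emb s * (nc_geometric 1 s x * fps_const x)) $ n" by simp
  qed
  ultimately show "nc_geometric 1 s x = 1 + fps_emb s * (fps_const x * nc_geometric 1 s x)" by simp
qed

section \<open>Coefficientwise expectation and the moment series\<close>

definition fps_expectation :: "('i nc_poly \<Rightarrow> complex) \<Rightarrow> 'i nc_poly fps \<Rightarrow> complex fps" where
  "fps_expectation \<phi> F = Abs_fps (\<lambda>n. \<phi> (F $ n))"

lemma fps_expectation_nth [simp]: "fps_expectation \<phi> F $ n = \<phi> (F $ n)"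
  by (simp add: fps_expectation_def)

lemma nc_expectation_0: "nc_expectation \<phi> \<Longrightarrow> \<phi> 0 = 0"
  unfolding nc_expectation_def by (metis add_cancel_right_right)

lemma nc_expectation_sum:
  "nc_expectation \<phi> \<Longrightarrow> \<phi> (sum f A) = (\<Sum>x\<in>A. \<phi> (f x))"
  by (induction A rule: infinite_finite_induct) (auto simp: nc_expectation_0, simp_all add: nc_expectation_def)

lemma fps_expectation_add:
  "nc_expectation \<phi> \<Longrightarrow> fps_expectation \<phi> (F + G) = fps_expectation \<phi> F + fps_expectation \<phi> G"
  by (simp add: fps_eq_iff nc_expectation_def)

lemma fps_expectation_1: "nc_expectation \<phi> \<Longrightarrow> fps_expectation \<phi> 1 = 1"
  by (rule fps_ext) (auto simp: nc_expectation_0, simp add: nc_expectation_def)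

lemma fps_expectation_emb:
  "nc_expectation \<phi> \<Longrightarrow> fps_expectation \<phi> (fps_emb f * F) = f * fps_expectation \<phi> F"
  by (rule fps_ext) (simp add: fps_mult_nth nc_expectation_sum, simp add: nc_expectation_def)

lemma fps_expectation_nc_geometric:
  assumes "nc_expectation \<phi>" "s $ 0 = 0"
  shows "fps_expectation \<phi> (nc_geometric 1 s x) = Abs_fps (\<lambda>k. \<phi> (x ^ k)) oo s"
proof (rule fps_ext)
  fix n
  have "fps_expectation \<phi> (nc_geometric 1 s x) $ n = (\<Sum>k\<le>n. (s ^ k) $ n * \<phi> (x ^ k))"
    using assms(1) by (simp add: nc_geometric_def nc_expectation_sum) (simp add: nc_expectation_def)
  then show "fps_expectation \<phi> (nc_geometric 1 s x) $ n = (Abs_fps (\<lambda>k. \<phi> (x ^ k)) oo s) $ n"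
    by (simp add: fps_compose_nth atMost_atLeast0 mult.commute)
qed

definition centred :: "('i nc_poly \<Rightarrow> complex) \<Rightarrow> 'i nc_poly \<Rightarrow> 'i nc_poly set" where
  "centred \<phi> a = {y. \<phi> y = 0 \<and> (\<exists>p. y = nc_eval p a)}"

text \<open>\<open>nc_eval\<close> sums up to the degree of its polynomial. Sums with another cutoff
  are brought to that form, which \<open>centred\<close> demands.\<close>

lemma nc_eval_ex: "\<exists>p. (\<Sum>k\<le>n. nc_const (c k) * a ^ k) = nc_eval p a"
proof -
  define p where "p = (\<Sum>k\<le>n. monom (c k) k)"
  have cp: "coeff p k = (if k \<le> n then c k else 0)" for k
    by (auto simp: p_def coeff_sum if_distrib cong: if_cong)
  have "degree p \<le> n" by (rule degree_le) (simp add: cp)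
  then have "nc_eval p a = (\<Sum>k\<le>n. nc_const (coeff p k) * a ^ k)"
    unfolding nc_eval_def by (intro sum.mono_neutral_left) (auto simp: coeff_eq_0)
  then show ?thesis by (intro exI[of _ p]) (simp add: cp)
qed

fun alternating_word :: "bool \<Rightarrow> nat \<Rightarrow> bool list" where
  "alternating_word j 0 = []"
| "alternating_word j (Suc n) = j # alternating_word (\<not> j) n"

lemma alternating_word_eq_Nil_iff [simp]: "alternating_word j n = [] \<longleftrightarrow> n = 0"
  by (cases n) auto

lemma distinct_adj_alternating_word: "distinct_adj (alternating_word j n)"
proof (induction n arbitrary: j)
  case (Suc n) then show ?case using Suc[of "\<not> j"] by (cases n) auto
qed simp

text \<open>Freeness speaks about products of single polynomials. A coefficient of a product of
  series is a finite sum of products of coefficients, and each of these is an alternating product of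
  centred elements.\<close>

lemma expectation_alternating:
  fixes F :: "'j \<Rightarrow> 'i nc_poly fps"
  assumes \<phi>: "nc_expectation \<phi>" and fr: "freely_independent \<phi> a"
    and F: "\<And>j n. F j $ n \<in> centred \<phi> (a j)"
    and "js \<noteq> []" "distinct_adj js"
  shows "\<phi> (prod_list (map F js) $ n) = 0"
proof -
  \<comment> \<open>The induction replaces the series by single coefficients from left to right;
    \<open>ps\<close> holds those already chosen, as polynomials.\<close>
  have *: "\<phi> (prod_list (map (\<lambda>(j, p). nc_eval p (a j)) ps) * prod_list (map F js) $ n) = 0"
    if "distinct_adj (map fst ps @ js)" "map fst ps @ js \<noteq> []"
      "\<forall>(j, p) \<in> set ps. \<phi> (nc_eval p (a j)) = 0" for ps :: "('j \<times> complex poly) list" and n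
    using that
  proof (induction js arbitrary: ps n)
    case Nil
    then have "\<phi> (prod_list (map (\<lambda>(j, p). nc_eval p (a j)) ps)) = 0"
      using fr unfolding freely_independent_def by auto
    then show ?case using \<phi> by (auto simp: fps_one_nth nc_expectation_0)
  next
    case (Cons j js)
    have "\<phi> (prod_list (map (\<lambda>(j, p). nc_eval p (a j)) ps) * (F j $ i * prod_list (map F js) $ (n - i))) = 0" for i
    proof -
      obtain p where p: "F j $ i = nc_eval p (a j)" "\<phi> (F j $ i) = 0"
        using F[of j i] by (auto simp: centred_def)
      show ?thesis using Cons.IH[of "ps @ [(j, p)]" "n - i"] Cons.prems p by (simp add: mult.assoc)
    qed
    then show ?case
      using \<phi> by (simp add: fps_mult_nth sum_distrib_left nc_expectation_sum)
  qed
  show ?thesis using *[of "[]" n] assms by simp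
qed

text \<open>
  Here \<open>U\<close> is \<open>(1 - X \<sigma> a)\<^sup>-\<^sup>1\<close>. The hypothesis says that its expectation is \<open>1 + X\<close>, so it is
  \<open>(1 + X) (1 + X A)\<close> with \<open>A\<close> centred.
\<close>

lemma centred_resolvent:
  fixes a :: "'i nc_poly" and u \<sigma> :: "complex fps"
  assumes \<phi>: "nc_expectation \<phi>" and u: "u * (1 + fps_X) = 1"
    and M: "Abs_fps (\<lambda>k. \<phi> (a ^ k)) oo (fps_X * \<sigma>) = 1 + fps_X"
  obtains A U :: "'i nc_poly fps" where "\<forall>n. A $ n \<in> centred \<phi> a"
    "U = fps_emb (1 + fps_X) * (1 + fps_emb fps_X * A)"
    "U * (1 - fps_emb (fps_X * \<sigma>) * fps_const a) = 1"
    "(1 - fps_emb (fps_X * \<sigma>) * fps_const a) * U = 1"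
    "fps_emb \<sigma> * (U * fps_const a) = 1 + fps_emb (1 + fps_X) * A"
    "fps_emb \<sigma> * (fps_const a * U) = 1 + fps_emb (1 + fps_X) * A"
proof -
  define s where "s = fps_X * \<sigma>"
  have s0: "s $ 0 = 0" by (simp add: s_def)
  define U where "U = nc_geometric 1 s a"
  \<comment> \<open>\<open>U\<close> has expectation \<open>1 + fps_X\<close> and \<open>u\<close>
    is the inverse of that, so \<open>fps_emb u * U\<close> has expectation 1 and constant term 1.
    Subtracting 1 and dividing by \<open>fps_X\<close> leaves centred coefficients.\<close>
  define A where "A = fps_shift 1 (fps_emb u * U - 1)"
  have u0: "u $ 0 = 1" using arg_cong[OF u, of "\<lambda>f. f $ 0"] by simp
  have uU: "fps_emb u * U = nc_geometric u s a" by (simp add: U_def fps_emb_mult_nc_geometric s0)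
  have XA: "fps_emb fps_X * A = fps_emb u * U - 1"
    unfolding fps_emb_X A_def uU by (rule fps_ext) (auto simp: nc_geometric_def u0)
  have unf: "U = 1 + fps_emb s * (U * fps_const a)" "U = 1 + fps_emb s * (fps_const a * U)"
    unfolding U_def using nc_geometric_unfold[OF s0] by blast+
  have EU: "fps_expectation \<phi> U = 1 + fps_X"
    unfolding U_def fps_expectation_nc_geometric[OF \<phi> s0] using M by (simp add: s_def)
  have "fps_expectation \<phi> (fps_emb fps_X * A) + 1 = fps_expectation \<phi> (fps_emb u * U)"
    unfolding XA fps_expectation_1[OF \<phi>, symmetric] fps_expectation_add[OF \<phi>, symmetric] by simp
  then have "fps_expectation \<phi> A = 0" by (simp add: fps_expectation_emb[OF \<phi>] EU u)
  then have "\<phi> (A $ n) = 0" for n by (metis fps_expectation_nth fps_zero_nth)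
  moreover have "\<exists>p. A $ n = nc_eval p a" for n
    using nc_eval_ex[of "\<lambda>k. (u * s ^ k) $ Suc n" a "Suc n"] by (simp add: A_def uU nc_geometric_def)
  ultimately have c: "\<forall>n. A $ n \<in> centred \<phi> a" by (simp add: centred_def)
  have pu: "fps_emb (1 + fps_X) * (fps_emb u * F) = F" for F :: "'i nc_poly fps"
  proof -
    have "(1 + fps_X) * u = 1" using u by (simp add: mult.commute)
    then show ?thesis by (simp add: mult.assoc[symmetric] flip: fps_emb_mult)
  qed
  have U: "U = fps_emb (1 + fps_X) * (1 + fps_emb fps_X * A)"
  proof -
    have "1 + fps_emb fps_X * A = fps_emb u * U" using XA by simp
    then show ?thesis by (simp only: pu)
  qed
  have inv: "U * (1 - fps_emb s * fps_const a) = 1" "(1 - fps_emb s * fps_const a) * U = 1"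
  proof -
    have "U * (1 - fps_emb s * fps_const a) = U - fps_emb s * (U * fps_const a)"
      by (simp add: right_diff_distrib fps_emb_left_commute[of U])
    also have "\<dots> = 1" unfolding diff_eq_eq by (rule unf(1))
    finally show "U * (1 - fps_emb s * fps_const a) = 1" .
    have "(1 - fps_emb s * fps_const a) * U = U - fps_emb s * (fps_const a * U)"
      by (simp add: left_diff_distrib mult.assoc)
    also have "\<dots> = 1" unfolding diff_eq_eq by (rule unf(2))
    finally show "(1 - fps_emb s * fps_const a) * U = 1" .
  qed
  \<comment> \<open>The two remaining identities are proved after multiplication by
    \<open>fps_X\<close>, where both sides become \<open>U - 1\<close>; then \<open>fps_X\<close> is
    cancelled.\<close>
  have "fps_emb fps_X * (1 + fps_emb (1 + fps_X) * A) = U - 1"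
  proof -
    have "fps_emb fps_X * (1 + fps_emb (1 + fps_X) * A) = fps_emb fps_X + fps_emb (1 + fps_X) * (fps_emb fps_X * A)"
      by (simp add: distrib_left fps_emb_left_commute[of "fps_emb fps_X" "1 + fps_X" A])
    also have "\<dots> = fps_emb fps_X + (U - fps_emb (1 + fps_X))"
      unfolding XA by (simp only: right_diff_distrib pu mult_1_right)
    also have "\<dots> = U - 1" by (simp add: fps_emb_add)
    finally show ?thesis .
  qed
  note e1 = this
  have e2: "fps_emb fps_X * (fps_emb \<sigma> * (U * fps_const a)) = U - 1"
      "fps_emb fps_X * (fps_emb \<sigma> * (fps_const a * U)) = U - 1"
  proof -
    have "U - 1 = fps_emb s * (U * fps_const a)" "U - 1 = fps_emb s * (fps_const a * U)"
      by (metis unf(1) add_diff_cancel_left', metis unf(2) add_diff_cancel_left')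
    then show "fps_emb fps_X * (fps_emb \<sigma> * (U * fps_const a)) = U - 1"
      "fps_emb fps_X * (fps_emb \<sigma> * (fps_const a * U)) = U - 1"
      by (simp_all only: s_def fps_emb_mult mult.assoc)
  qed
  have cancel: "F = G" if "fps_emb fps_X * F = fps_emb fps_X * G" for F G :: "'i nc_poly fps"
  proof (rule fps_ext)
    fix n show "F $ n = G $ n" using arg_cong[OF that, of "\<lambda>f. f $ Suc n"] by (simp add: fps_emb_X)
  qed
  have "fps_emb \<sigma> * (U * fps_const a) = 1 + fps_emb (1 + fps_X) * A"
    "fps_emb \<sigma> * (fps_const a * U) = 1 + fps_emb (1 + fps_X) * A"
    by (rule cancel, simp only: e1 e2)+
  then show thesis by (rule that[OF c U inv[unfolded s_def]])
qed

text \<open>\<open>T'\<close> is the inverse of \<open>1 - q A B\<close>, a sum over words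
  ABAB...AB. One more B in front or one more A behind keeps such a word alternating, so every term
  except the empty word has expectation zero.\<close>

lemma expectation_free_resolvent:
  fixes A B T' :: "'i nc_poly fps"
  assumes \<phi>: "nc_expectation \<phi>" and fr: "freely_independent \<phi> a"
    and A: "\<And>n. A $ n \<in> centred \<phi> (a False)" and B: "\<And>n. B $ n \<in> centred \<phi> (a True)"
    and T': "T' = 1 + fps_emb q * (A * B * T')" and q0: "q $ 0 = 0"
  shows "fps_expectation \<phi> ((1 + fps_emb f * B) * T' * (1 + fps_emb f * A)) = 1"
proof -
  define F where "F j = (if j then B else A)" for j
  define P where "P j n = prod_list (map F (alternating_word j n))" for j n
  have PS: "P j (Suc n) = F j * P (\<not> j) n" for j n by (simp add: P_def)
  have P0: "P j 0 = 1" for j by (simp add: P_def)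
  have EP: "fps_expectation \<phi> (P j n) = 0" if "n > 0" for j n
  proof (rule fps_ext)
    fix k
    have "F j $ n \<in> centred \<phi> (a j)" for j n by (simp add: F_def A B)
    then have "\<phi> (prod_list (map F (alternating_word j n)) $ k) = 0"
      using that by (intro expectation_alternating[OF \<phi> fr] distinct_adj_alternating_word) auto
    then show "fps_expectation \<phi> (P j n) $ k = 0 $ k" by (simp add: P_def)
  qed
  have Pow: "(A * B) ^ n = P False (2 * n)" for n
    by (induction n) (simp_all add: PS P0 F_def mult.assoc)
  have PA: "P False (2 * n) * A = P False (Suc (2 * n))" for n
    by (induction n) (simp_all add: PS P0 F_def mult.assoc)
  \<comment> \<open>The expansion stops at \<open>N\<close> with a remainder divisible by
    \<open>q ^ N\<close>, which does not reach the coefficients below \<open>N\<close>. This takes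
    the place of convergence.\<close>
  have exp: "T' = (\<Sum>n<N. fps_emb (q ^ n) * (A * B) ^ n) + fps_emb (q ^ N) * ((A * B) ^ N * T')" for N
  proof (induction N)
    case (Suc N)
    have "fps_emb (q ^ N) * ((A * B) ^ N * T') =
        fps_emb (q ^ N) * ((A * B) ^ N * (1 + fps_emb q * (A * B * T')))" by (simp only: T'[symmetric])
    also have "\<dots> = fps_emb (q ^ N) * (A * B) ^ N + fps_emb (q ^ Suc N) * ((A * B) ^ Suc N * T')"
      by (simp only: distrib_left mult_1_right fps_emb_left_commute[of "(A * B) ^ N"] fps_emb_mult
        power_Suc2 mult.assoc)
    finally show ?case using Suc by (simp add: algebra_simps)
  qed simp
  define G where "G H = fps_expectation \<phi> ((1 + fps_emb f * B) * H * (1 + fps_emb f * A))" for H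
  have G_add: "G (H + K) = G H + G K" for H K
    by (simp add: G_def distrib_left distrib_right fps_expectation_add[OF \<phi>])
  have G_emb: "G (fps_emb g * H) = g * G H" for g H
    by (simp only: G_def fps_expectation_emb[OF \<phi>, symmetric] fps_emb_left_commute[of "1 + fps_emb f * B"] mult.assoc)
  have G_sum: "G (\<Sum>n<N. K n) = (\<Sum>n<N. G (K n))" for K and N :: nat
  proof (induction N)
    case 0 then show ?case using G_emb[of 0 0] by simp
  qed (simp add: G_add)
  have GP: "G ((A * B) ^ n) = (if n = 0 then 1 else 0)" for n
  proof -
    define Q where "Q = P False (2 * n)"
    have "B * Q = P True (2 * n + 1)" "Q * A = P False (Suc (2 * n))" "B * (Q * A) = P True (2 * n + 2)"
      using PA[of n] by (simp_all add: Q_def PS F_def)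
    moreover have "(1 + fps_emb f * B) * Q * (1 + fps_emb f * A) =
        Q + fps_emb f * (B * Q) + fps_emb f * (Q * A) + fps_emb f * (fps_emb f * (B * (Q * A)))"
      by (simp add: algebra_simps fps_emb_left_commute[of Q] fps_emb_left_commute[of B])
    ultimately have "(1 + fps_emb f * B) * (A * B) ^ n * (1 + fps_emb f * A) =
        P False (2 * n) + fps_emb f * P True (2 * n + 1) + fps_emb f * P False (Suc (2 * n))
        + fps_emb f * (fps_emb f * P True (2 * n + 2))"
      by (simp only: Pow Q_def)
    then show ?thesis unfolding G_def
      by (simp only: fps_expectation_add[OF \<phi>] fps_expectation_emb[OF \<phi>])
         (auto simp: EP P0 fps_expectation_1[OF \<phi>])
  qed
  show ?thesis
  proof (rule fps_ext)
    fix m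
    have "G T' = (\<Sum>n<Suc m. q ^ n * G ((A * B) ^ n)) + q ^ Suc m * G ((A * B) ^ Suc m * T')"
      by (subst exp[of "Suc m"]) (simp only: G_add G_sum G_emb)
    also have "(\<Sum>n<Suc m. q ^ n * G ((A * B) ^ n)) = (\<Sum>n<Suc m. if n = 0 then 1 else 0)"
      by (intro sum.cong) (auto simp: GP)
    also have "\<dots> = 1" by simp
    finally have "G T' $ m = 1 $ m + (G ((A * B) ^ Suc m * T') * q ^ Suc m) $ m" by (simp add: mult.commute)
    also have "(G ((A * B) ^ Suc m * T') * q ^ Suc m) $ m = 0" by (rule fps_mult_power_nth_eq_0) (auto simp: q0)
    finally show "fps_expectation \<phi> ((1 + fps_emb f * B) * T' * (1 + fps_emb f * A)) $ m = 1 $ m" by (simp add: G_def)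
  qed
qed

text \<open>The constant term 1 is included, so this is 1 + psi for the usual moment series psi. The
  S-transform \<open>S\<close> occurs only through the equation
  \<open>moment_fps \<mu> oo (fps_X * (S / (1 + fps_X))) = 1 + fps_X\<close>, which says that
  \<open>fps_X * S / (1 + fps_X)\<close> is the compositional inverse of psi.\<close>

definition moment_fps :: "real measure \<Rightarrow> complex fps" where
  "moment_fps \<mu> = Abs_fps (\<lambda>k. complex_of_real (\<integral>x. x ^ k \<partial>\<mu>))"

text \<open>The first product is going to be \<open>U * V\<close>, the second one the part that
  contains both variables. The terms linear in \<open>A\<close> and in \<open>B\<close> cancel, and
  only the alternating word \<open>A * B\<close> survives.\<close>

lemma central_identity:
  fixes x A B :: "'a::ring_1"
  assumes "A * x = x * A" "B * x = x * B"
  shows "(1 + x) * (1 + x * A) * ((1 + x) * (1 + x * B)) - x * (1 + x) * ((1 + (1 + x) * A) * (1 + (1 + x) * B))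
    = (1 + x) * (1 - (1 + x) * x * (A * B))"
proof -
  have "A * (x * y) = x * (A * y)" "B * (x * y) = x * (B * y)" for y
    using assms by (metis mult.assoc)+
  then show ?thesis using assms by (simp add: algebra_simps)
qed

text \<open>
  With \<open>U\<close>, \<open>V\<close> the resolvents of the two variables, \<open>U (1 - \<kappa> a b) V = (1 + X) (1 - (1 + X) X A B)\<close> for
  \<open>\<kappa> = X S\<^sub>1 S\<^sub>2 / (1 + X)\<close>. Inverting this writes the resolvent of the product through alternating
  products of centred elements, whose expectations vanish.
\<close>

theorem moment_fps_free_mult_conv:
  assumes conv: "is_free_mult_conv \<mu> \<nu> \<rho>"
    and \<mu>: "moment_fps \<mu> oo (fps_X * (S1 / (1 + fps_X))) = 1 + fps_X"
    and \<nu>: "moment_fps \<nu> oo (fps_X * (S2 / (1 + fps_X))) = 1 + fps_X"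
  shows "moment_fps \<rho> oo (fps_X * (S1 * S2 / (1 + fps_X))) = 1 + fps_X"
proof -
  obtain \<phi> :: "bool nc_poly \<Rightarrow> complex" where \<phi>: "nc_expectation \<phi>" and fr: "freely_independent \<phi> nc_var"
    and laws: "has_law \<phi> (nc_var False) \<mu>" "has_law \<phi> (nc_var True) \<nu>"
      "has_law \<phi> (nc_var False * nc_var True) \<rho>"
    using conv unfolding is_free_mult_conv_def by blast
  define u :: "complex fps" where "u = inverse (1 + fps_X)"
  define p :: "complex fps" where "p = 1 + fps_X"
  have u: "u * (1 + fps_X) = 1" unfolding u_def by (rule inverse_mult_eq_1) simp
  have pu: "p * u = 1" using u by (simp add: p_def mult.commute)
  have dv: "f / (1 + fps_X) = f * u" for f :: "complex fps" by (simp add: u_def fps_divide_unit)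
  define s t where "s = S1 * u" and "t = S2 * u"
  have mom: "Abs_fps (\<lambda>k. \<phi> (nc_var False ^ k)) = moment_fps \<mu>"
    "Abs_fps (\<lambda>k. \<phi> (nc_var True ^ k)) = moment_fps \<nu>"
    "Abs_fps (\<lambda>k. \<phi> ((nc_var False * nc_var True) ^ k)) = moment_fps \<rho>"
    using laws by (simp_all add: has_law_def moment_fps_def)
  have "Abs_fps (\<lambda>k. \<phi> (nc_var False ^ k)) oo (fps_X * s) = 1 + fps_X"
    using \<mu> by (simp only: mom dv s_def)
  then obtain A U where A': "\<forall>n. A $ n \<in> centred \<phi> (nc_var False)"
    "U = fps_emb (1 + fps_X) * (1 + fps_emb fps_X * A)"
    "U * (1 - fps_emb (fps_X * s) * fps_const (nc_var False)) = 1"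
    "(1 - fps_emb (fps_X * s) * fps_const (nc_var False)) * U = 1"
    "fps_emb s * (U * fps_const (nc_var False)) = 1 + fps_emb (1 + fps_X) * A"
    "fps_emb s * (fps_const (nc_var False) * U) = 1 + fps_emb (1 + fps_X) * A"
    using centred_resolvent[OF \<phi> u] by blast
  note A = A'[folded p_def]
  have "Abs_fps (\<lambda>k. \<phi> (nc_var True ^ k)) oo (fps_X * t) = 1 + fps_X"
    using \<nu> by (simp only: mom dv t_def)
  then obtain B V where B': "\<forall>n. B $ n \<in> centred \<phi> (nc_var True)"
    "V = fps_emb (1 + fps_X) * (1 + fps_emb fps_X * B)"
    "V * (1 - fps_emb (fps_X * t) * fps_const (nc_var True)) = 1"
    "(1 - fps_emb (fps_X * t) * fps_const (nc_var True)) * V = 1"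
    "fps_emb t * (V * fps_const (nc_var True)) = 1 + fps_emb (1 + fps_X) * B"
    "fps_emb t * (fps_const (nc_var True) * V) = 1 + fps_emb (1 + fps_X) * B"
    using centred_resolvent[OF \<phi> u] by blast
  note B = B'[folded p_def]
  \<comment> \<open>\<open>s\<close> and \<open>t\<close> each contain a factor
    \<open>1 / (1 + fps_X)\<close>. The factor \<open>p\<close> removes one of the two, so that
    \<open>\<kappa>\<close> is the argument belonging to the S-transform
    \<open>S1 * S2\<close>.\<close>
  define \<kappa> where "\<kappa> = fps_X * (s * t * p)"
  define ab where "ab = fps_const (nc_var False * nc_var True)"
  define q where "q = p * fps_X"
  define T where "T = 1 - fps_emb q * (A * B)"
  define T' where "T' = fps_right_inverse T 1"
  have T0: "T $ 0 = 1" by (simp add: T_def q_def)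
  have T': "T * T' = 1" unfolding T'_def by (rule fps_right_inverse) (simp add: T0)
  then have "T' - fps_emb q * (A * B * T') = 1" by (simp add: T_def left_diff_distrib mult.assoc)
  then have T'_unfold: "T' = 1 + fps_emb q * (A * B * T')" unfolding diff_eq_eq .
  have UV: "U * (1 - fps_emb \<kappa> * ab) * V = fps_emb p * T"
  proof -
    have ek: "fps_emb \<kappa> = fps_emb (fps_X * p) * (fps_emb s * fps_emb t)"
      by (simp add: \<kappa>_def mult_ac flip: fps_emb_mult)
    have "U * (1 - fps_emb \<kappa> * ab) * V = U * V - fps_emb (fps_X * p) *
        (fps_emb s * (fps_emb t * ((U * fps_const (nc_var False)) * (fps_const (nc_var True) * V))))"
      unfolding ek ab_def fps_const_mult[symmetric]
      by (simp only: right_diff_distrib left_diff_distrib mult.assoc fps_emb_left_commute[of U] mult_1_right)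
    also have "\<dots> = U * V - fps_emb (fps_X * p) *
        ((fps_emb s * (U * fps_const (nc_var False))) * (fps_emb t * (fps_const (nc_var True) * V)))"
      by (simp only: mult.assoc fps_emb_left_commute[of U] fps_emb_left_commute[of "fps_const (nc_var False)"])
    also have "\<dots> = fps_emb p * T"
      unfolding A(5) B(6)
      unfolding A(2) B(2) T_def q_def p_def fps_emb_mult fps_emb_add fps_emb_1
      by (rule central_identity) (rule fps_emb_commute)+
    finally show ?thesis .
  qed
  \<comment> \<open>By \<open>UV\<close>, \<open>1 - \<kappa> ab\<close> should be
    \<open>U^-1 p T V^-1\<close>; this is the inverse of that expression.\<close>
  define Z where "Z = V * (T' * U * fps_emb u)"
  have RZ: "(1 - fps_emb \<kappa> * ab) * Z = 1"
  proof -
    define L where "L = 1 - fps_emb (fps_X * s) * fps_const (nc_var False)"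
    have "(1 - fps_emb \<kappa> * ab) * Z = L * (U * (1 - fps_emb \<kappa> * ab) * V) * (T' * U * fps_emb u)"
      using A(4) by (simp only: Z_def L_def mult.assoc[symmetric] mult_1)
    also have "\<dots> = L * (fps_emb p * ((T * T') * (U * fps_emb u)))"
      unfolding UV by (simp only: mult.assoc)
    also have "\<dots> = L * (U * (fps_emb p * fps_emb u))"
      unfolding T' by (simp only: mult_1 fps_emb_left_commute[of U])
    also have "\<dots> = 1" using A(4) pu by (simp add: L_def flip: fps_emb_mult)
    finally show ?thesis .
  qed
  have \<kappa>0: "\<kappa> $ 0 = 0" by (simp add: \<kappa>_def)
  define R where "R = nc_geometric 1 \<kappa> (nc_var False * nc_var True)"
  have RL: "R * (1 - fps_emb \<kappa> * ab) = 1"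
  proof -
    have "R * (1 - fps_emb \<kappa> * ab) = R - fps_emb \<kappa> * (R * ab)"
      by (simp add: right_diff_distrib fps_emb_left_commute[of R])
    also have "\<dots> = 1" unfolding diff_eq_eq R_def ab_def by (rule nc_geometric_unfold(1)[OF \<kappa>0])
    finally show ?thesis .
  qed
  \<comment> \<open>A left inverse and a right inverse coincide, which identifies the geometric
    series \<open>R\<close> with \<open>Z\<close>.\<close>
  have "R = R * ((1 - fps_emb \<kappa> * ab) * Z)" by (simp only: RZ mult_1_right)
  also have "\<dots> = Z" by (simp only: mult.assoc[symmetric] RL mult_1)
  also have "Z = fps_emb p * ((1 + fps_emb fps_X * B) * T' * (1 + fps_emb fps_X * A))"
  proof -
    have "U * fps_emb u = fps_emb (u * p) * (1 + fps_emb fps_X * A)"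
      unfolding A(2) fps_emb_commute[of _ u] fps_emb_mult by (simp only: mult.assoc)
    then have "U * fps_emb u = 1 + fps_emb fps_X * A" using pu by (simp add: mult.commute)
    then show ?thesis by (simp only: Z_def B(2) mult.assoc)
  qed
  finally have "R = fps_emb p * ((1 + fps_emb fps_X * B) * T' * (1 + fps_emb fps_X * A))" .
  moreover have "fps_expectation \<phi> ((1 + fps_emb fps_X * B) * T' * (1 + fps_emb fps_X * A)) = 1"
    by (rule expectation_free_resolvent[OF \<phi> fr A(1)[rule_format] B(1)[rule_format] T'_unfold]) (simp add: q_def)
  ultimately have "fps_expectation \<phi> R = p"
    by (simp only: fps_expectation_emb[OF \<phi>] mult_1_right)
  moreover have "\<kappa> = fps_X * (S1 * S2 / (1 + fps_X))"
    using pu by (simp add: \<kappa>_def dv s_def t_def mult_ac)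
  ultimately show ?thesis
    unfolding R_def fps_expectation_nc_geometric[OF \<phi> \<kappa>0] mom p_def by metis
qed

section \<open>The moments of Raney distributions and their convolutions\<close>

text \<open>The formula determines every coefficient of \<open>p\<close>, and the true compositional
  inverse of \<open>fps_X / g\<close> satisfies it by the direct statement. In this direction an
  inverse is read off from known moments.\<close>

lemma fps_Lagrange_inversion_converse:
  fixes g p :: "'a::field_char_0 fps"
  assumes g0: "g $ 0 \<noteq> 0" and p0: "p $ 0 = 0"
    and p: "\<And>n. n > 0 \<Longrightarrow> of_nat n * p $ n = (g ^ n) $ (n - 1)"
  shows "p oo (fps_X / g) = fps_X"
proof -
  define c where "c = fps_X / g"
  have c: "c = fps_X * inverse g" using g0 by (simp add: c_def fps_divide_unit)
  have c01: "c $ 0 = 0" "c $ 1 \<noteq> 0" using g0 by (simp_all add: c)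
  have inv: "fps_inv c oo c = fps_X" using c01 by (rule fps_inv)
  then have i0: "fps_inv c $ 0 = 0" by (metis fps_compose_nth_0 fps_X_nth zero_neq_one)
  have "p $ n = fps_inv c $ n" for n
  proof (cases "n = 0")
    case False
    then have "of_nat n * p $ n = of_nat n * fps_inv c $ n"
      using fps_Lagrange_inversion[OF g0 inv[unfolded c_def]] p unfolding c_def by simp
    then show ?thesis using False by simp
  qed (simp add: p0 i0)
  then have "p = fps_inv c" by (rule fps_ext)
  then show ?thesis using inv by (simp add: c_def)
qed

lemma fps_one_plus_X_power_nth: "((1 + fps_X :: 'a::field_char_0 fps) ^ n) $ k = of_nat (n choose k)"
  by (simp add: fps_binomial_of_nat[symmetric] binomial_gbinomial)

lemma fps_divide_one_plus_X: "(f::complex fps) / (1 + fps_X) = f * inverse (1 + fps_X)"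
  by (simp add: fps_divide_unit)

lemma one_plus_X_inverse: "inverse (1 + fps_X) * (1 + fps_X) = (1::complex fps)"
  by (rule inverse_mult_eq_1) simp

text \<open>All moments are 1, so the series is 1 / (1 - X). The S-transform 1 starts the induction
  over convolution powers.\<close>

lemma moment_fps_return: "moment_fps (return borel 1) oo (fps_X * (1 / (1 + fps_X))) = 1 + fps_X"
proof -
  define u :: "complex fps" where "u = inverse (1 + fps_X)"
  have u: "u * (1 + fps_X) = 1" unfolding u_def by (rule one_plus_X_inverse)
  have c0: "(fps_X * u) $ 0 = 0" by simp
  have "moment_fps (return borel 1) = Abs_fps (\<lambda>n. 1)"
    unfolding moment_fps_def by (intro arg_cong[of _ _ Abs_fps] ext) (simp add: integral_return)
  then have "moment_fps (return borel 1) * (1 - fps_X) = 1"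
    using inverse_mult_eq_1[of "Abs_fps (\<lambda>n. 1::complex)"] unfolding fps_inverse_gp' by (simp add: mult.commute)
  then have "(moment_fps (return borel 1) oo (fps_X * u)) * (1 - fps_X * u) = 1"
    by (metis c0 fps_compose_1 fps_compose_mult_distrib fps_compose_sub_distrib fps_X_fps_compose_startby0)
  moreover have "1 - fps_X * u = u" using u by (simp add: algebra_simps)
  ultimately have "(moment_fps (return borel 1) oo (fps_X * u)) * (u * (1 + fps_X)) = 1 + fps_X"
    by (simp add: mult.assoc[symmetric])
  then show ?thesis unfolding u by (simp add: fps_divide_one_plus_X u_def)
qed

text \<open>The n-th moment times n is the binomial coefficient of n (m + 1) over n - 1, which is
  what Lagrange inversion yields for \<open>g = (1 + X)^(m + 1)\<close>. Hence the S-transform is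
  \<open>(1 + X)^(-m)\<close>.\<close>

lemma moment_fps_raney:
  assumes R: "is_raney (real m + 1) 1 R"
  shows "moment_fps R oo (fps_X * (inverse (1 + fps_X) ^ m / (1 + fps_X))) = 1 + fps_X"
proof -
  define g :: "complex fps" where "g = (1 + fps_X) ^ Suc m"
  have g0: "g $ 0 \<noteq> 0" by (simp add: g_def)
  have mom: "(\<integral>x. x ^ k \<partial>R) = 1 / real (k * Suc m + 1) * real ((k * Suc m + 1) choose k)" for k
  proof -
    have "(\<integral>x. x ^ k \<partial>R) = 1 / (real k * (real m + 1) + 1) * ((real k * (real m + 1) + 1) gchoose k)"
      using R by (auto simp: is_raney_def)
    also have "real k * (real m + 1) + 1 = real (k * Suc m + 1)" by (simp add: algebra_simps)
    finally show ?thesis by (simp only: binomial_gbinomial)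
  qed
  have "(moment_fps R - 1) oo (fps_X / g) = fps_X"
  proof (rule fps_Lagrange_inversion_converse[OF g0])
    show "(moment_fps R - 1) $ 0 = 0" using mom[of 0] by (simp add: moment_fps_def)
    fix n :: nat assume "n > 0"
    then obtain k where n: "n = Suc k" by (cases n) auto
    have "Suc k * (Suc (n * Suc m) choose Suc k) = Suc (n * Suc m) * (n * Suc m choose k)"
      by (rule Suc_times_binomial)
    then have "real n * real ((n * Suc m + 1) choose n) = real (n * Suc m + 1) * real (n * Suc m choose k)"
      unfolding n by (metis Suc_eq_plus1 of_nat_mult)
    then have "real n * (\<integral>x. x ^ n \<partial>R) = real (n * Suc m choose k)"
      unfolding mom by (simp add: field_simps del: of_nat_Suc of_nat_add of_nat_mult)
    then have "complex_of_real (real n * (\<integral>x. x ^ n \<partial>R)) = of_nat (n * Suc m choose k)" by simp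
    moreover have "(g ^ n) $ (n - 1) = of_nat (n * Suc m choose k)"
      unfolding g_def power_mult[symmetric] fps_one_plus_X_power_nth by (simp add: n mult.commute)
    ultimately show "of_nat n * (moment_fps R - 1) $ n = (g ^ n) $ (n - 1)"
      using \<open>n > 0\<close> by (simp add: moment_fps_def fps_one_nth)
  qed
  moreover have "fps_X / g = fps_X * (inverse (1 + fps_X) ^ m / (1 + fps_X))"
    using g0 by (simp add: fps_divide_unit g_def fps_inverse_power fps_inverse_mult mult.commute)
  ultimately show ?thesis by (simp add: fps_compose_sub_distrib algebra_simps)
qed

text \<open>The moment series is \<open>(1 - X)^(-1/2)\<close>. For
  \<open>c = X (X + 2) / (1 + X)^2\<close> one has \<open>1 - c = (1 + X)^(-2)\<close>, so the
  composite squares to \<open>(1 + X)^2\<close>, and its constant term decides the sign.\<close>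

lemma moment_fps_arcsine:
  assumes A: "is_raney 1 (1 / 2) A"
  shows "moment_fps A oo (fps_X * ((fps_X + 2) * inverse (1 + fps_X) / (1 + fps_X))) = 1 + fps_X"
proof -
  define u :: "complex fps" where "u = inverse (1 + fps_X)"
  define c where "c = fps_X * ((fps_X + 2) * u * u)"
  have u: "u * (1 + fps_X) = 1" unfolding u_def by (rule one_plus_X_inverse)
  have c0: "c $ 0 = 0" by (simp add: c_def)
  define B :: "complex fps" where "B = fps_binomial (- 1 / 2)"
  have mom: "(\<integral>x. x ^ k \<partial>A) = (-1) ^ k * ((- 1 / 2) gchoose k)" for k
  proof -
    have "(\<integral>x. x ^ k \<partial>A) = (1 / 2) / (real k + 1 / 2) * ((real k + 1 / 2) gchoose k)"
      using A by (auto simp: is_raney_def)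
    also have "\<dots> = pochhammer (1 / 2) k / fact k"
    proof -
      have "((real k + 1 / 2) gchoose k) = pochhammer (3 / 2) k / fact k"
        by (simp add: gbinomial_pochhammer' algebra_simps)
      moreover have "(1 / 2) * pochhammer (3 / 2) k = pochhammer (1 / 2) k * (real k + 1 / 2)"
        using pochhammer_rec[of "1/2::real" k] pochhammer_Suc[of "1/2::real" k] by (simp add: algebra_simps)
      ultimately show ?thesis by (simp add: field_simps)
    qed
    also have "\<dots> = (-1) ^ k * ((- 1 / 2) gchoose k)"
      by (simp add: gbinomial_pochhammer flip: power_add mult.assoc)
    finally show ?thesis .
  qed
  have gen: "complex_of_real (a gchoose k) = complex_of_real a gchoose k" for a k
    by (simp add: gbinomial_prod_rev)
  have cx: "complex_of_real (- (1 / 2) gchoose k) = - (1 / 2) gchoose k" for k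
    using gen[of "- (1 / 2)" k] by simp
  have mA: "moment_fps A = B oo (- fps_X)"
    by (rule fps_ext) (simp add: moment_fps_def mom B_def fps_compose_uminus' cx)
  have "moment_fps A * moment_fps A * (1 - fps_X) = 1"
  proof -
    have "B * B = fps_binomial (- 1)"
      unfolding B_def fps_binomial_add_mult[symmetric] by simp
    then have "B * B * (1 + fps_X) = 1" by (simp add: fps_binomial_minus_one inverse_mult_eq_1)
    then have "(B * B * (1 + fps_X)) oo (- fps_X) = 1" by simp
    then show ?thesis unfolding mA by (simp add: fps_compose_mult_distrib fps_compose_add_distrib)
  qed
  then have "(moment_fps A * moment_fps A * (1 - fps_X)) oo c = 1" by simp
  then have 1: "(moment_fps A oo c) * (moment_fps A oo c) * (1 - c) = 1"
    using c0 by (simp add: fps_compose_mult_distrib fps_compose_sub_distrib)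
  have c1: "1 - c = u * u"
  proof -
    have "1 - c = (u * (1 + fps_X)) * (u * (1 + fps_X)) - c" by (simp add: u)
    then show ?thesis by (simp add: c_def algebra_simps)
  qed
  define M where "M = moment_fps A oo c"
  have "(M - (1 + fps_X)) * (M + (1 + fps_X)) = M * M * (u * (1 + fps_X)) * (u * (1 + fps_X)) - (1 + fps_X) * (1 + fps_X)"
    unfolding u by (simp add: algebra_simps)
  also have "\<dots> = (M * M * (1 - c) - 1) * ((1 + fps_X) * (1 + fps_X))"
    unfolding c1 by (simp add: algebra_simps)
  also have "\<dots> = 0" using 1 by (simp add: M_def)
  finally have "M = 1 + fps_X \<or> M + (1 + fps_X) = 0" by simp
  moreover have "(M + (1 + fps_X)) $ 0 \<noteq> 0 $ 0" using mom[of 0] by (simp add: M_def moment_fps_def)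
  then have "M + (1 + fps_X) \<noteq> 0" by metis
  ultimately have "M = 1 + fps_X" by auto
  then show ?thesis by (simp add: M_def c_def fps_divide_one_plus_X u_def mult.assoc)
qed

lemma moment_fps_free_mult_power:
  assumes A: "moment_fps A oo (fps_X * (S / (1 + fps_X))) = 1 + fps_X"
    and P: "is_free_mult_power A n P"
  shows "moment_fps P oo (fps_X * (S ^ n / (1 + fps_X))) = 1 + fps_X"
  using P
proof (induction n arbitrary: P)
  case 0 then show ?case using moment_fps_return by simp
next
  case (Suc n)
  then obtain \<sigma> where "is_free_mult_power A n \<sigma>" "is_free_mult_conv \<sigma> A P" by auto
  then show ?case using moment_fps_free_mult_conv[OF _ Suc.IH A] by (simp add: mult.commute)
qed

text \<open>The S-transforms multiply to \<open>S = (X + 2)^s / (1 + X)^r\<close>, so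
  \<open>X S / (1 + X)\<close> is 1 / z at w = 1 + X. The base of the k-th power on the right is (w
  - 1) z, hence the coefficient of index \<open>k - 1\<close> is the residue of z^k at 1.\<close>

lemma moments_raney_arcsine_power:
  assumes "s \<le> r" "is_raney (real r - real s + 1) 1 R" "is_raney 1 (1 / 2) A"
    "is_free_mult_power A s P" "is_free_mult_conv R P \<mu>" and k: "k > 0"
  shows "of_nat k * complex_of_real (\<integral>x. x ^ k \<partial>\<mu>) =
    (((1 + fps_X) ^ (r + 1) * inverse (2 + fps_X) ^ s) ^ k) $ (k - 1)"
proof -
  have R: "is_raney (real (r - s) + 1) 1 R" using assms(1,2) by (simp add: of_nat_diff)
  define u :: "complex fps" where "u = inverse (1 + fps_X)"
  define g :: "complex fps" where "g = (1 + fps_X) ^ (r + 1) * inverse (2 + fps_X) ^ s"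
  have g0: "g $ 0 \<noteq> 0" by (simp add: g_def)
  have "moment_fps \<mu> oo (fps_X * (u ^ (r - s) * ((fps_X + 2) * u) ^ s / (1 + fps_X))) = 1 + fps_X"
    unfolding u_def using moment_fps_free_mult_conv[OF assms(5) moment_fps_raney[OF R]
      moment_fps_free_mult_power[OF moment_fps_arcsine[OF assms(3)] assms(4)]] .
  moreover have "fps_X * (u ^ (r - s) * ((fps_X + 2) * u) ^ s / (1 + fps_X)) = fps_X / g"
  proof -
    have "inverse (inverse (2 + fps_X)) = (2 + fps_X :: complex fps)" by (rule fps_inverse_idempotent) simp
    then have "fps_X / g = fps_X * (u ^ (r + 1) * (2 + fps_X) ^ s)"
      using g0 by (simp add: fps_divide_unit g_def u_def fps_inverse_mult fps_inverse_power)
    also have "u ^ (r + 1) = u ^ (r - s) * u ^ s * u" using assms(1) by (simp flip: power_add)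
    finally show ?thesis
      unfolding fps_divide_one_plus_X u_def power_mult_distrib by (simp only: mult_ac add.commute[of 2])
  qed
  ultimately have "moment_fps \<mu> oo (fps_X / g) = 1 + fps_X" by simp
  then have "(moment_fps \<mu> - 1) oo (fps_X / g) = fps_X" by (simp add: fps_compose_sub_distrib)
  from fps_Lagrange_inversion[OF g0 this k] show ?thesis
    using k by (simp add: moment_fps_def g_def fps_one_nth)
qed

section \<open>An estimate of arguments\<close>

lemma cot_antimono:
  fixes x y :: real
  assumes "0 < x" "x \<le> y" "y < pi"
  shows "cot y \<le> cot x"
proof -
  have "sin x > 0" "sin y > 0" using assms by (auto intro: sin_gt_zero)
  moreover have "sin (y - x) \<ge> 0" using assms by (intro sin_ge_zero) auto
  ultimately show ?thesis by (simp add: cot_def sin_diff field_simps)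
qed

lemma convex_on_cot: "convex_on {0<..<pi/2} (cot :: real \<Rightarrow> real)"
proof (rule convex_on_realI)
  show "connected {0<..<pi/2}" by simp
  fix x :: real assume x: "x \<in> {0<..<pi/2}"
  then have "sin x > 0" by (intro sin_gt_zero) auto
  then show "(cot has_real_derivative - inverse ((sin x)\<^sup>2)) (at x)" by (intro DERIV_cot) auto
next
  fix x y :: real assume xy: "x \<in> {0<..<pi/2}" "y \<in> {0<..<pi/2}" "x \<le> y"
  then have "sin x > 0" by (intro sin_gt_zero) auto
  moreover have "sin x \<le> sin y" using xy by (intro sin_monotone_2pi_le) auto
  ultimately show "- inverse ((sin x)\<^sup>2) \<le> - inverse ((sin y)\<^sup>2)"
    by (simp add: le_imp_inverse_le power_mono)
qed

lemma cot_half: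
  assumes "0 < x" "x < pi"
  shows "cot (x / 2) = cot x + 1 / sin (x::real)"
proof -
  define h where "h = x / 2"
  have "sin h > 0" "cos h > 0" using assms by (auto simp: h_def intro!: sin_gt_zero cos_gt_zero)
  have x: "x = 2 * h" by (simp add: h_def)
  have "cot x + 1 / sin x = (cos (2 * h) + 1) / sin (2 * h)"
    unfolding x by (simp add: cot_def add_divide_distrib)
  also have "\<dots> = (2 * (cos h * cos h)) / (2 * (sin h * cos h))"
    unfolding cos_double_cos sin_double by (simp add: power2_eq_square mult_ac)
  also have "\<dots> = cot h" using \<open>cos h > 0\<close> by (simp add: cot_def)
  finally show ?thesis by (simp add: h_def)
qed

text \<open>\<open>\<phi>\<close> is the path angle in the extreme case r = s + 2. Convexity of cot
  bounds \<open>cot \<theta>\<close> by how far \<open>\<delta>\<close> has moved from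
  \<open>3 * \<phi>\<close>, its value at \<open>\<theta> = \<phi>\<close>, towards pi. Then
  \<open>cot \<delta>\<close> is estimated on three ranges.\<close>

lemma cot_add_less:
  fixes \<theta> \<delta> \<phi> s :: real
  assumes s: "s > 3" and \<phi>: "(s + 3) * \<phi> = 2 * pi" and \<theta>: "0 < \<theta>" "\<theta> < \<phi>"
    and \<delta>: "s * \<theta> + \<delta> = 2 * pi" "0 < \<delta>" "\<delta> < pi"
  shows "cot \<theta> + cot \<delta> < 2 * cot \<phi>"
proof -
  have \<phi>0: "\<phi> > 0" using \<theta> by linarith
  have "6 * \<phi> < (s + 3) * \<phi>" using s \<phi>0 by (intro mult_strict_right_mono) auto
  then have \<phi>3: "3 * \<phi> < pi" using \<phi> by linarith
  have "s * \<theta> < s * \<phi>" using s \<theta> by simp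
  then have \<delta>3: "3 * \<phi> < \<delta>" using \<phi> \<delta> by (simp add: algebra_simps)
  \<comment> \<open>The relative position of \<open>\<delta>\<close> between
    \<open>3 * \<phi>\<close> and pi. The same \<open>l\<close> keeps \<open>\<theta>\<close> at or
    above \<open>(1 - l) * \<phi> + l * (\<phi> / 2)\<close>, so that convexity between
    \<open>\<phi> / 2\<close> and \<open>\<phi>\<close> applies.\<close>
  define l where "l = (\<delta> - 3 * \<phi>) / (pi - 3 * \<phi>)"
  have l01: "0 < l" "l < 1" using \<phi>3 \<delta>3 \<delta> by (auto simp: l_def)
  have lpi: "l * (pi - 3 * \<phi>) = \<delta> - 3 * \<phi>" using \<phi>3 by (simp add: l_def)
  have sin\<phi>: "sin \<phi> > 0" using \<phi>0 \<phi>3 by (intro sin_gt_zero) auto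
  have \<theta>l: "\<phi> * (1 - l / 2) \<le> \<theta>"
  proof -
    have "s * (\<phi> * (1 - l / 2)) = (2 * pi - 3 * \<phi>) * (1 - l / 2)"
    proof -
      have "s * \<phi> = 2 * pi - 3 * \<phi>" using \<phi> by (simp add: algebra_simps)
      then show ?thesis by (metis mult.assoc)
    qed
    also have "\<dots> = 2 * pi - 3 * \<phi> - l * (pi - 3 * \<phi>) - l * 3 * \<phi> / 2" by (simp add: algebra_simps)
    also have "\<dots> = s * \<theta> - l * 3 * \<phi> / 2" unfolding lpi using \<delta> by simp
    also have "\<dots> \<le> s * \<theta>" using l01 \<phi>0 by simp
    finally show ?thesis using s by simp
  qed
  have "cot \<theta> \<le> cot (\<phi> * (1 - l / 2))"
    using \<theta>l l01 \<phi>0 \<theta> \<phi>3 by (intro cot_antimono) (auto intro: mult_pos_pos)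
  also have "\<phi> * (1 - l / 2) = (1 - l) *\<^sub>R \<phi> + l *\<^sub>R (\<phi> / 2)" by (simp add: algebra_simps)
  also have "cot \<dots> \<le> (1 - l) * cot \<phi> + l * cot (\<phi> / 2)"
    using l01 \<phi>0 \<phi>3 pi_gt_zero by (intro convex_onD[OF convex_on_cot]) auto
  also have "\<dots> = cot \<phi> + l / sin \<phi>"
    using cot_half[of \<phi>] \<phi>0 \<phi>3 by (simp add: algebra_simps)
  finally have c\<theta>: "cot \<theta> \<le> cot \<phi> + l / sin \<phi>" .
  have sin\<delta>: "sin \<delta> > 0" using \<delta> by (intro sin_gt_zero) auto
  \<comment> \<open>For \<open>\<delta>\<close> at least \<open>pi / 2 + \<phi> / 2\<close>,
    \<open>cot \<delta>\<close> is at most \<open>- tan (\<phi> / 2)\<close>, and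
    \<open>sin \<phi> * tan (\<phi> / 2) = 1 - cos \<phi>\<close>, so \<open>l < 1\<close> suffices.
    Below that bound \<open>l < 1 / 2\<close>; it then matters only whether \<open>\<delta>\<close>
    is acute.\<close>
  have main: "l + sin \<phi> * cot \<delta> < cos \<phi>"
  proof (cases "\<delta> \<ge> pi / 2 + \<phi> / 2")
    case True
    have "cot \<delta> \<le> cot (pi / 2 + \<phi> / 2)" using True \<phi>0 \<delta> pi_gt_zero by (intro cot_antimono) linarith+
    also have "\<dots> = - (sin (\<phi> / 2) / cos (\<phi> / 2))" by (simp add: cot_def sin_add cos_add)
    finally have "sin \<phi> * cot \<delta> \<le> sin \<phi> * - (sin (\<phi> / 2) / cos (\<phi> / 2))"
      using sin\<phi> by (intro mult_left_mono) auto
    also have "\<dots> = cos \<phi> - 1"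
    proof -
      define h where "h = \<phi> / 2"
      have "cos h > 0" using \<phi>0 \<phi>3 by (auto simp: h_def intro!: cos_gt_zero)
      moreover have "\<phi> = 2 * h" by (simp add: h_def)
      ultimately show ?thesis by (simp add: cos_double_sin sin_double power2_eq_square)
    qed
    finally show ?thesis using l01 by linarith
  next
    case False
    have l: "1 - l > 1 / 2"
    proof -
      have "(1 - l) * (pi - 3 * \<phi>) = pi - \<delta>" using lpi by (simp add: algebra_simps)
      also have "\<dots> > 1 / 2 * (pi - 3 * \<phi>)" using False \<phi>0 by simp
      finally show ?thesis using \<phi>3 by (simp add: mult_less_cancel_right)
    qed
    show ?thesis
    proof (cases "\<delta> \<ge> pi / 2")
      case True
      have "cos \<delta> \<le> 0" using True \<delta> cos_monotone_0_pi_le[of "pi/2" \<delta>] by simp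
      then have "sin \<phi> * cot \<delta> \<le> 0" using sin\<phi> sin\<delta> by (simp add: cot_def mult_nonneg_nonpos divide_nonpos_pos)
      moreover have "cos \<phi> > cos (pi / 3)" using \<phi>0 \<phi>3 by (intro cos_monotone_0_pi) auto
      ultimately show ?thesis using l by (simp add: cos_60)
    next
      case False
      have cos\<delta>: "cos \<delta> > 0" using False \<delta> by (intro cos_gt_zero) auto
      have "\<delta> * cos \<delta> \<le> sin \<delta>"
      proof -
        have "\<bar>\<delta>\<bar> \<le> \<bar>tan \<delta>\<bar>" using False \<delta> by (intro abs_tan_ge) auto
        then show ?thesis using cos\<delta> sin\<delta> \<delta> by (simp add: tan_def field_simps)
      qed
      then have c: "\<delta> * cot \<delta> \<le> 1" using sin\<delta> by (simp add: cot_def)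
      have "sin \<phi> \<le> \<delta> / 3" using sin_x_le_x[OF less_imp_le[OF \<phi>0]] \<delta>3 by linarith
      then have "sin \<phi> * cot \<delta> \<le> \<delta> / 3 * cot \<delta>"
        using cos\<delta> sin\<delta> by (intro mult_right_mono) (auto simp: cot_def)
      then have 1: "sin \<phi> * cot \<delta> \<le> 1 / 3" using c by simp
      have "cos \<phi> > cos (pi / 6)" using \<phi>0 False \<delta>3 by (intro cos_monotone_0_pi) auto
      then have "cos \<phi> > sqrt 3 / 2" by (simp add: cos_30)
      \<comment> \<open>Half of 17/10 exceeds 1/2 + 1/3, the bounds for \<open>l\<close> and for
        \<open>sin \<phi> * cot \<delta>\<close>.\<close>
      moreover have "sqrt 3 > 17 / 10" by (rule real_less_rsqrt) (simp add: power2_eq_square)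
      ultimately show ?thesis using 1 l by simp
    qed
  qed
  then have "(l + sin \<phi> * cot \<delta>) / sin \<phi> < cos \<phi> / sin \<phi>"
    using sin\<phi> by (rule divide_strict_right_mono)
  moreover have "cos \<phi> / sin \<phi> = cot \<phi>" by (simp add: cot_def)
  ultimately have "l / sin \<phi> + cot \<delta> < cot \<phi>" using sin\<phi> by (simp add: add_divide_distrib)
  then show ?thesis using c\<theta> by linarith
qed

text \<open>
  If the product were positive, the arguments \<open>a\<close> of \<open>t - 1\<close> and \<open>b\<close> of \<open>t + 1\<close> would satisfy
  \<open>a + s b = 2 \<pi>\<close>, while \<open>cot a + cot b = 2 cot \<alpha>\<close> always holds on the ray of argument \<open>\<alpha>\<close>.
\<close>

lemma ray_product_not_pos_real:
  fixes r s :: nat and u p :: real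
  assumes rs: "r \<ge> s + 2" and u: "u > 0" and p: "p > 0"
  defines "t \<equiv> complex_of_real u * cis (2 * pi / (real r + 1))"
  shows "(t - 1) * (t + 1) ^ s \<noteq> complex_of_real p"
proof
  assume eq: "(t - 1) * (t + 1) ^ s = complex_of_real p"
  define \<alpha> where "\<alpha> = 2 * pi / (real r + 1)"
  have r3: "real r + 1 \<ge> real s + 3" using rs by linarith
  have \<alpha>0: "\<alpha> > 0" by (simp add: \<alpha>_def add_pos_nonneg)
  have \<alpha>s: "(real s + 3) * \<alpha> \<le> 2 * pi"
  proof -
    have "(real s + 3) * \<alpha> \<le> (real r + 1) * \<alpha>" using r3 \<alpha>0 by (intro mult_right_mono) auto
    then show ?thesis by (simp add: \<alpha>_def)
  qed
  then have s\<alpha>: "real s * \<alpha> + 3 * \<alpha> \<le> 2 * pi" by (simp add: algebra_simps)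
  moreover have "real s * \<alpha> \<ge> 0" using \<alpha>0 by simp
  ultimately have \<alpha>pi: "\<alpha> < pi" using \<alpha>0 by linarith
  have sin\<alpha>: "sin \<alpha> > 0" using \<alpha>0 \<alpha>pi by (rule sin_gt_zero)
  have t: "Re t = u * cos \<alpha>" "Im t = u * sin \<alpha>" by (simp_all add: t_def \<alpha>_def)
  define a b where "a = Arg (t - 1)" and "b = Arg (t + 1)"
  define m n where "m = cmod (t - 1)" and "n = cmod (t + 1)"
  have im: "Im (t - 1) > 0" "Im (t + 1) > 0" using u sin\<alpha> by (simp_all add: t)
  have ab: "0 < a" "a < pi" "0 < b" "b < pi" unfolding a_def b_def using im Arg_lt_pi by blast+
  have mn: "m > 0" "n > 0" using im by (auto simp: m_def n_def complex_eq_iff)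
  have pol: "t - 1 = of_real m * cis a" "t + 1 = of_real n * cis b"
    using rcis_cmod_Arg[of "t - 1"] rcis_cmod_Arg[of "t + 1"] by (simp_all add: a_def b_def m_def n_def rcis_def)
  have coord: "m * cos a = u * cos \<alpha> - 1" "m * sin a = u * sin \<alpha>" "n * cos b = u * cos \<alpha> + 1" "n * sin b = u * sin \<alpha>"
    using arg_cong[OF pol(1), of Re] arg_cong[OF pol(1), of Im] arg_cong[OF pol(2), of Re] arg_cong[OF pol(2), of Im]
    by (simp_all add: t)
  \<comment> \<open>The sine rule in the triangle with vertices -1, 0 and t; it yields
    \<open>b < \<alpha>\<close>.\<close>
  have "n * sin (\<alpha> - b) = sin \<alpha> * (n * cos b) - cos \<alpha> * (n * sin b)" by (simp add: sin_diff algebra_simps)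
  also have "\<dots> = sin \<alpha>" unfolding coord by (simp add: algebra_simps)
  finally have "sin (\<alpha> - b) > 0" using sin\<alpha> mn by (metis zero_less_mult_pos)
  moreover have "sin (\<alpha> - b) = - sin (b - \<alpha>)" by (simp add: sin_diff)
  ultimately have b\<alpha>: "b < \<alpha>" using sin_ge_zero[of "b - \<alpha>"] ab \<alpha>0 by (cases "b < \<alpha>") auto
  have ca: "cot a = (m * cos a) / (m * sin a)" and cb: "cot b = (n * cos b) / (n * sin b)"
    using mn by (simp_all add: cot_def)
  have cA: "cot a = (u * cos \<alpha> - 1) / (u * sin \<alpha>)" and cB: "cot b = (u * cos \<alpha> + 1) / (u * sin \<alpha>)"
    unfolding ca cb unfolding coord by simp_all
  have "cot b + cot a = 2 * (u * cos \<alpha>) / (u * sin \<alpha>)"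
    unfolding cA cB by (simp flip: add_divide_distrib)
  then have cots: "cot b + cot a = 2 * cot \<alpha>" using u
  proof -
    have "cot \<alpha> = cos \<alpha> / sin \<alpha>" by (simp add: cot_def)
    with \<open>cot b + cot a = _\<close> u show ?thesis by simp
  qed
  have "of_real p = of_real (m * n ^ s) * cis (a + real s * b)"
    unfolding eq[symmetric] pol by (simp add: power_mult_distrib Complex.DeMoivre cis_mult[symmetric])
  then have "p = m * n ^ s * cos (a + real s * b)" "0 = m * n ^ s * sin (a + real s * b)"
    by (metis Re_complex_of_real cis.simps(1) Re_complex_of_real of_real_mult times_complex.simps(1) complex_Re_of_nat Im_complex_of_real mult_zero_left diff_zero,
        metis Im_complex_of_real cis.simps(2) times_complex.simps(2) Re_complex_of_real mult_zero_left add_0_right)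
  moreover have mns: "m * n ^ s > 0" using mn by simp
  ultimately have cs: "cos (a + real s * b) > 0" "sin (a + real s * b) = 0"
    using p by (metis zero_less_mult_pos, metis mult_eq_0_iff less_irrefl)
  then have "cos (a + real s * b) = 1"
    using sin_cos_squared_add[of "a + real s * b"] cs by (auto simp: power2_eq_1_iff)
  then obtain k :: int where k: "a + real s * b = of_int k * 2 * pi" by (auto simp: cos_one_2pi_int)
  have sb: "0 \<le> real s * b" "real s * b \<le> real s * \<alpha>" using ab b\<alpha> by (auto intro: mult_left_mono)
  have "of_int k * 2 * pi > 0" using k ab sb by linarith
  then have "k > 0" by (simp add: zero_less_mult_iff)
  \<comment> \<open>As \<open>a < pi\<close>, \<open>b < \<alpha>\<close> and
    \<open>s * \<alpha>\<close> is at most \<open>2 * pi - 3 * \<alpha>\<close>, the total argument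
    stays below 4 pi, which leaves exactly one turn.\<close>
  moreover have "of_int k * 2 * pi < 2 * 2 * pi" using k ab sb s\<alpha> \<alpha>0 by linarith
  then have "k < 2" by simp
  ultimately have "k = 1" by simp
  then have sum: "real s * b + a = 2 * pi" using k by simp
  \<comment> \<open>The value of \<open>\<alpha>\<close> for r = s + 2. Since cot decreases and
    \<open>\<alpha> \<le> \<phi>\<close>, a strict bound by \<open>2 * cot \<phi>\<close> already
    contradicts \<open>cots\<close>.\<close>
  define \<phi> where "\<phi> = 2 * pi / (real s + 3)"
  have \<phi>s: "(real s + 3) * \<phi> = 2 * pi" by (simp add: \<phi>_def)
  have \<alpha>\<phi>: "\<alpha> \<le> \<phi>" using \<alpha>s by (simp add: \<phi>_def field_simps)
  have "s > 0" using sum ab by (cases s) auto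
  then have "real s * b < real s * \<phi>" using b\<alpha> \<alpha>\<phi> by simp
  then have "pi < real s * \<phi>" using sum ab by linarith
  then have "pi * (real s + 3) < real s * (2 * pi)" by (simp add: \<phi>_def field_simps)
  then have s3: "real s > 3" by (simp add: algebra_simps)
  have "6 * \<phi> < (real s + 3) * \<phi>" using s3 \<alpha>\<phi> \<alpha>0 by (intro mult_strict_right_mono) auto
  then have "\<phi> < pi" using \<phi>s \<alpha>\<phi> \<alpha>0 by linarith
  then have "cot \<phi> \<le> cot \<alpha>" using \<alpha>0 \<alpha>\<phi> by (intro cot_antimono)
  moreover have "cot b + cot a < 2 * cot \<phi>"
    using cot_add_less[OF s3 \<phi>s _ _ sum] ab b\<alpha> \<alpha>\<phi> by simp
  ultimately show False using cots by linarith
qed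

section \<open>Logarithms along rays\<close>

text \<open>The values are integer multiples of 2 pi \<i>, a discrete set. This is how jumps between
  branches of the logarithm are excluded throughout.\<close>

lemma exp_eq_1_imp_constant_on:
  fixes D :: "real \<Rightarrow> complex"
  assumes "connected S" "continuous_on S D" "\<And>u. u \<in> S \<Longrightarrow> exp (D u) = 1"
  shows "D constant_on S"
proof (rule continuous_discrete_range_constant[OF assms(1,2)])
  fix x assume x: "x \<in> S"
  show "\<exists>e>0. \<forall>y. y \<in> S \<and> D y \<noteq> D x \<longrightarrow> e \<le> norm (D y - D x)"
  proof (intro exI[of _ "2 * pi"] conjI allI impI)
    fix y assume y: "y \<in> S \<and> D y \<noteq> D x"
    have "exp (D y - D x) = 1" using assms(3) x y by (simp add: exp_diff)
    then obtain n :: int where n: "Re (D y - D x) = 0" "Im (D y - D x) = of_int (2 * n) * pi"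
      unfolding exp_eq_1 by blast
    with y have "n \<noteq> 0" by (auto simp: complex_eq_iff)
    then have "1 \<le> \<bar>real_of_int n\<bar>" by linarith
    then have "2 * pi \<le> \<bar>of_int (2 * n) * pi\<bar>" by (simp add: abs_mult)
    then show "2 * pi \<le> norm (D y - D x)" using n(2) abs_Im_le_cmod[of "D y - D x"] by linarith
  qed simp
qed

lemma exp_eq_1_imp_zero:
  fixes D :: "real \<Rightarrow> complex"
  assumes "continuous_on {a<..} D" "\<And>u. u > a \<Longrightarrow> exp (D u) = 1" "(D \<longlongrightarrow> 0) at_top" "u > a"
  shows "D u = 0"
proof -
  obtain c where c: "\<And>u. u > a \<Longrightarrow> D u = c"
    using exp_eq_1_imp_constant_on[of "{a<..}" D] assms(1,2) by (auto simp: constant_on_def)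
  have "(D \<longlongrightarrow> c) at_top"
    by (rule tendsto_eventually) (use eventually_gt_at_top[of a] in eventually_elim, simp add: c)
  then have "c = 0" using assms(3) by (rule tendsto_unique[OF trivial_limit_at_top_linorder])
  then show ?thesis using c[OF assms(4)] by simp
qed

text \<open>If the function avoids the cut, the principal logarithm is itself the continuation. Any
  other admissible \<open>L\<close> differs from it by a constant, and the two agree far out, so the
  definite description denotes.\<close>

lemma log_along_ray_eq_Ln:
  assumes cont: "continuous_on {1..} (\<lambda>u. g (complex_of_real u * t))"
    and nz: "\<And>u. u \<ge> 1 \<Longrightarrow> g (complex_of_real u * t) \<notin> \<real>\<^sub>\<le>\<^sub>0"
  shows "log_along_ray g t = Ln (g t)"
  unfolding log_along_ray_def
proof (rule the_equality)
  have cL: "continuous_on {1..} (\<lambda>u. Ln (g (complex_of_real u * t)))"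
    using nz by (intro continuous_on_Ln' cont) auto
  have g0: "g (complex_of_real u * t) \<noteq> 0" if "u \<ge> 1" for u using nz[OF that] by auto
  show "\<exists>L. continuous_on {1..} L \<and> (\<forall>u\<ge>1. exp (L u) = g (complex_of_real u * t)) \<and>
      (\<forall>\<^sub>F u in at_top. L u = Ln (g (complex_of_real u * t))) \<and> Ln (g t) = L 1"
    by (rule exI[of _ "\<lambda>u. Ln (g (complex_of_real u * t))"]) (use cL g0 in auto)
  fix z assume "\<exists>L. continuous_on {1..} L \<and> (\<forall>u\<ge>1. exp (L u) = g (complex_of_real u * t)) \<and>
      (\<forall>\<^sub>F u in at_top. L u = Ln (g (complex_of_real u * t))) \<and> z = L 1"
  then obtain L where L: "continuous_on {1..} L" "\<And>u. u \<ge> 1 \<Longrightarrow> exp (L u) = g (complex_of_real u * t)"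
      "\<forall>\<^sub>F u in at_top. L u = Ln (g (complex_of_real u * t))" "z = L 1" by blast
  define D where "D u = L u - Ln (g (complex_of_real u * t))" for u
  have "D constant_on {1..}"
    by (rule exp_eq_1_imp_constant_on)
       (use L cL g0 in \<open>auto simp: D_def exp_diff intro!: continuous_intros\<close>)
  then obtain c where c: "\<And>u. u \<ge> 1 \<Longrightarrow> D u = c" by (auto simp: constant_on_def)
  have "\<forall>\<^sub>F u in at_top. D u = 0 \<and> u \<ge> (1::real)"
    using L(3) eventually_ge_at_top[of 1] by eventually_elim (simp add: D_def)
  then obtain u where "D u = 0" "u \<ge> 1" by (metis (mono_tags, lifting) eventually_happens' trivial_limit_at_top_linorder)
  then have "D 1 = 0" using c by simp
  then show "z = Ln (g t)" using L(4) by (simp add: D_def)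
qed

lemma one_minus_divide_not_nonpos:
  assumes "v \<notin> \<real>\<^sub>\<ge>\<^sub>0" "u > 0"
  shows "1 - v / complex_of_real u \<notin> \<real>\<^sub>\<le>\<^sub>0"
proof
  assume "1 - v / complex_of_real u \<in> \<real>\<^sub>\<le>\<^sub>0"
  then obtain y where y: "y \<le> 0" "1 - v / complex_of_real u = of_real y" by (auto elim!: nonpos_Reals_cases)
  then have "v = of_real (u * (1 - y))" using assms(2) by (simp add: field_simps)
  then show False using assms y by (auto simp: complex_nonneg_Reals_iff)
qed

lemma Ln_diff_of_real:
  assumes "v \<notin> \<real>\<^sub>\<ge>\<^sub>0" "u > 0"
  shows "Ln (complex_of_real u - v) = of_real (ln u) + Ln (1 - v / complex_of_real u)"
proof -
  have "1 - v / complex_of_real u \<noteq> 0" using one_minus_divide_not_nonpos[OF assms] by auto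
  moreover have "complex_of_real u - v = of_real u * (1 - v / complex_of_real u)"
    using assms(2) by (simp add: field_simps)
  ultimately show ?thesis
    using assms(2) Ln_times_of_real[of u "1 - v / complex_of_real u"] Ln_of_real[of u] by simp
qed

lemma tendsto_one_minus_divide_at_top: "((\<lambda>u. 1 - v / complex_of_real u) \<longlongrightarrow> 1) at_top"
proof -
  have "((\<lambda>u. v / complex_of_real u) \<longlongrightarrow> 0) at_top"
    by (rule tendsto_divide_0[OF tendsto_const]) (rule filterlim_of_real_at_infinity)
  from tendsto_diff[OF tendsto_const this, of 1] show ?thesis by simp
qed

text \<open>Both sides have the same exponential, are continuous because nothing meets the cut, and
  tend to 0 as u tends to infinity. So no multiple of 2 pi \<i> can appear.\<close>

lemma Ln_prod_along_ray:
  fixes v :: "nat \<Rightarrow> complex"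
  assumes v: "\<And>j. j < n \<Longrightarrow> v j \<notin> \<real>\<^sub>\<ge>\<^sub>0"
    and f: "\<And>u. u > 0 \<Longrightarrow> (\<Prod>j<n. 1 - v j / complex_of_real u) \<notin> \<real>\<^sub>\<le>\<^sub>0" and u: "u > 0"
  shows "Ln (\<Prod>j<n. 1 - v j / complex_of_real u) = (\<Sum>j<n. Ln (1 - v j / complex_of_real u))"
proof -
  define D where "D u = Ln (\<Prod>j<n. 1 - v j / complex_of_real u) - (\<Sum>j<n. Ln (1 - v j / complex_of_real u))" for u
  have "D u = 0"
  proof (rule exp_eq_1_imp_zero[OF _ _ _ u])
    show "continuous_on {0<..} D" unfolding D_def
      using f one_minus_divide_not_nonpos[OF v] by (intro continuous_intros) auto
    show "exp (D u) = 1" if u: "u > 0" for u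
    proof -
      have nz: "(\<Prod>j<n. 1 - v j / complex_of_real u) \<noteq> 0" using f[OF u] nonpos_Reals_zero_I by metis
      have e: "(\<Prod>j<n. exp (Ln (1 - v j / complex_of_real u))) = (\<Prod>j<n. 1 - v j / complex_of_real u)"
      proof (intro prod.cong refl exp_Ln)
        fix j assume "j \<in> {..<n}"
        then have "1 - v j / complex_of_real u \<notin> \<real>\<^sub>\<le>\<^sub>0"
          using u by (intro one_minus_divide_not_nonpos v) auto
        then show "1 - v j / complex_of_real u \<noteq> 0" using nonpos_Reals_zero_I by metis
      qed
      have "exp (D u) = exp (Ln (\<Prod>j<n. 1 - v j / complex_of_real u)) / (\<Prod>j<n. exp (Ln (1 - v j / complex_of_real u)))"
        by (simp only: D_def exp_diff exp_sum finite_lessThan)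
      then show ?thesis unfolding e exp_Ln[OF nz] using divide_self[OF nz] by (simp only:)
    qed
    have "(D \<longlongrightarrow> Ln (\<Prod>j<n. 1) - (\<Sum>j<n. Ln 1)) at_top"
      unfolding D_def by (intro tendsto_intros tendsto_one_minus_divide_at_top) auto
    then show "(D \<longlongrightarrow> 0) at_top" by simp
  qed
  then show ?thesis by (simp add: D_def)
qed

text \<open>The limit u -> 0 of the preceding identity, with each factor multiplied by u. The
  positive factors add \<open>n * ln u\<close> to both sides, and principal branches survive the
  limit because the product tends to the positive number \<open>x\<close>.\<close>

lemma sum_Ln_minus:
  fixes v :: "nat \<Rightarrow> complex"
  assumes v: "\<And>j. j < n \<Longrightarrow> v j \<notin> \<real>\<^sub>\<ge>\<^sub>0"
    and f: "\<And>u. u > 0 \<Longrightarrow> (\<Prod>j<n. 1 - v j / complex_of_real u) \<notin> \<real>\<^sub>\<le>\<^sub>0"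
    and x: "(\<Prod>j<n. - v j) = complex_of_real x" "x > 0"
  shows "(\<Sum>j<n. Ln (- v j)) = complex_of_real (ln x)"
proof -
  have mv: "- v j \<notin> \<real>\<^sub>\<le>\<^sub>0" if "j < n" for j
    using v[OF that] by (auto simp: complex_nonneg_Reals_iff complex_nonpos_Reals_iff)
  have u0: "((\<lambda>u. complex_of_real u - v j) \<longlongrightarrow> - v j) (at_right 0)" for j
    by (auto intro!: tendsto_eq_intros)
  have lim1: "((\<lambda>u. \<Sum>j<n. Ln (complex_of_real u - v j)) \<longlongrightarrow> (\<Sum>j<n. Ln (- v j))) (at_right 0)"
    by (intro tendsto_intros u0) (use mv in auto)
  have lim2: "((\<lambda>u. Ln (\<Prod>j<n. complex_of_real u - v j)) \<longlongrightarrow> Ln (\<Prod>j<n. - v j)) (at_right 0)"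
    by (intro tendsto_intros u0) (use x in \<open>auto simp: complex_nonpos_Reals_iff\<close>)
  have ev: "\<forall>\<^sub>F u in at_right 0. (\<Sum>j<n. Ln (complex_of_real u - v j)) = Ln (\<Prod>j<n. complex_of_real u - v j)"
    using eventually_at_right_less[of 0]
  proof eventually_elim
    fix u :: real assume u: "u > 0"
    have nz: "(\<Prod>j<n. 1 - v j / complex_of_real u) \<noteq> 0" using f[OF u] nonpos_Reals_zero_I by metis
    have "(\<Prod>j<n. complex_of_real u - v j) = (\<Prod>j<n. complex_of_real u * (1 - v j / complex_of_real u))"
      using u by (intro prod.cong) (auto simp: field_simps)
    also have "\<dots> = complex_of_real (u ^ n) * (\<Prod>j<n. 1 - v j / complex_of_real u)"
      by (simp add: prod.distrib)
    finally have eq: "(\<Prod>j<n. complex_of_real u - v j) = complex_of_real (u ^ n) * (\<Prod>j<n. 1 - v j / complex_of_real u)" .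
    have un: "u ^ n > 0" using u by simp
    have sum: "Ln (\<Prod>j<n. 1 - v j / complex_of_real u) = (\<Sum>j<n. Ln (1 - v j / complex_of_real u))"
      using v f u by (rule Ln_prod_along_ray)
    have "Ln (\<Prod>j<n. complex_of_real u - v j) = of_real (ln (u ^ n)) + (\<Sum>j<n. Ln (1 - v j / complex_of_real u))"
      unfolding eq Ln_times_of_real[OF un nz] sum using un by (simp only: Ln_of_real)
    also have "\<dots> = (\<Sum>j<n. of_real (ln u) + Ln (1 - v j / complex_of_real u))"
      using u by (simp add: sum.distrib ln_realpow)
    also have "\<dots> = (\<Sum>j<n. Ln (complex_of_real u - v j))"
      using u v by (intro sum.cong) (auto simp: Ln_diff_of_real)
    finally show "(\<Sum>j<n. Ln (complex_of_real u - v j)) = Ln (\<Prod>j<n. complex_of_real u - v j)" by simp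
  qed
  have "(\<Sum>j<n. Ln (- v j)) = Ln (\<Prod>j<n. - v j)"
    by (rule tendsto_unique[OF trivial_limit_at_right_real lim1]) (rule lim2[folded tendsto_cong[OF ev]])
  then show ?thesis using x by (simp add: Ln_of_real)
qed

text \<open>The two limits bound \<open>G\<close> by a multiple of
  \<open>1 / (sqrt u * (1 + u))\<close>, which has the primitive \<open>2 * arctan (sqrt u)\<close>.
  This bound is invariant under u -> 1/u combined with division by u^2, so both rays are covered at
  once.\<close>

lemma set_integrable_ray_dominated:
  fixes G :: "real \<Rightarrow> complex"
  assumes cont: "continuous_on {0<..} G"
    and G0: "((\<lambda>u. of_real (sqrt u) * G u) \<longlongrightarrow> 0) (at_right 0)"
    and Ginf: "((\<lambda>u. of_real (u * sqrt u) * G u) \<longlongrightarrow> 0) at_top"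
  shows "set_integrable lborel {0<..} G"
    and "set_integrable lborel {0<..} (\<lambda>u. G (1 / u) / of_real (u\<^sup>2))"
proof -
  have "\<forall>\<^sub>F u in at_right 0. norm (of_real (sqrt u) * G u) < 1"
    using order_tendstoD(2)[OF tendsto_norm[OF G0], of 1] by simp
  then obtain a where a: "a > 0" "\<And>u. 0 < u \<Longrightarrow> u < a \<Longrightarrow> sqrt u * norm (G u) < 1"
    unfolding eventually_at_right_field by (auto simp: norm_mult)
  have "\<forall>\<^sub>F u in at_top. norm (of_real (u * sqrt u) * G u) < 1"
    using order_tendstoD(2)[OF tendsto_norm[OF Ginf], of 1] by simp
  then obtain b0 where b0: "\<And>u. u \<ge> b0 \<Longrightarrow> norm (of_real (u * sqrt u) * G u) < 1"
    unfolding eventually_at_top_linorder by blast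
  define b where "b = max b0 1"
  have b: "u * sqrt u * norm (G u) < 1" if "u \<ge> b" for u
    using b0[of u] that by (simp add: b_def norm_mult)
  have "compact ((\<lambda>u. norm (G u)) ` {a..b})"
    using a(1) by (intro compact_continuous_image continuous_intros continuous_on_subset[OF cont]) auto
  then have "bounded ((\<lambda>u. norm (G u)) ` {a..b})" by (rule compact_imp_bounded)
  then obtain B where B: "B > 0" "\<And>u. a \<le> u \<Longrightarrow> u \<le> b \<Longrightarrow> norm (G u) \<le> B"
    unfolding bounded_pos by auto
  \<comment> \<open>The three summands serve \<open>u < a\<close>, \<open>u \<ge> b\<close> and the
    compact range between.\<close>
  define C where "C = (1 + a) + 2 + B * (sqrt b * (1 + b))"
  have C0: "C \<ge> 0" using a B by (simp add: C_def b_def)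
  have bound: "norm (G u) \<le> C / (sqrt u * (1 + u))" if u: "u > 0" for u
  proof -
    have b1: "b \<ge> 1" by (simp add: b_def)
    have pos: "B * (sqrt b * (1 + b)) \<ge> 0" using B b1 by simp
    have "norm (G u) * (sqrt u * (1 + u)) \<le> C"
    proof -
      consider "u < a" | "u \<ge> b" | "a \<le> u" "u \<le> b" by linarith
      then show ?thesis
      proof cases
        case 1
        have "norm (G u) * (sqrt u * (1 + u)) = (sqrt u * norm (G u)) * (1 + u)" by simp
        also have "\<dots> \<le> 1 * (1 + a)" using a(2)[OF u 1] 1 u by (intro mult_mono) auto
        finally show ?thesis using pos by (simp add: C_def)
      next
        case 2
        have "norm (G u) * (sqrt u * (1 + u)) \<le> norm (G u) * (sqrt u * (2 * u))"
          using 2 b1 u by (intro mult_left_mono) auto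
        also have "\<dots> = 2 * (u * sqrt u * norm (G u))" by simp
        also have "\<dots> \<le> 2" using b[OF 2] by simp
        finally show ?thesis using pos a by (simp add: C_def)
      next
        case 3
        have "norm (G u) * (sqrt u * (1 + u)) \<le> B * (sqrt b * (1 + b))"
          using 3 u b1 B by (intro mult_mono) auto
        then show ?thesis using a by (simp add: C_def)
      qed
    qed
    then show ?thesis using u by (subst pos_le_divide_eq) (auto intro!: mult_pos_pos)
  qed
  have int: "set_integrable lborel {0<..} (\<lambda>u. C / (sqrt u * (1 + u)))"
  proof -
    have "set_integrable lborel (einterval 0 \<infinity>) (\<lambda>u. 1 / (sqrt u * (1 + u)))"
    proof (rule interval_integral_FTC_nonneg(1))
      show "(0::ereal) < \<infinity>" by simp
      show "((\<lambda>u. 2 * arctan (sqrt u)) has_real_derivative 1 / (sqrt u * (1 + u))) (at u)"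
        if "0 < ereal u" "ereal u < \<infinity>" for u
      proof -
        have "((\<lambda>u. 2 * arctan (sqrt u)) has_real_derivative 2 * (inverse (1 + (sqrt u)\<^sup>2) * (inverse (sqrt u) / 2))) (at u)"
          using that by (auto intro!: derivative_eq_intros)
        then show ?thesis using that by (simp add: inverse_eq_divide mult.commute)
      qed
      show "isCont (\<lambda>u. 1 / (sqrt u * (1 + u))) u" if "0 < ereal u" "ereal u < \<infinity>" for u
        using that by (intro continuous_intros) auto
      show "AE u in lborel. 0 < ereal u \<longrightarrow> ereal u < \<infinity> \<longrightarrow> 0 \<le> 1 / (sqrt u * (1 + u))" by simp
      show "(((\<lambda>u. 2 * arctan (sqrt u)) \<circ> real_of_ereal) \<longlongrightarrow> 0) (at_right 0)"
        unfolding zero_ereal_def ereal_tendsto_simps by (auto intro!: tendsto_eq_intros)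
      show "(((\<lambda>u. 2 * arctan (sqrt u)) \<circ> real_of_ereal) \<longlongrightarrow> pi) (at_left \<infinity>)"
        unfolding ereal_tendsto_simps by real_asymp
    qed
    moreover have "einterval 0 \<infinity> = {0<..}" by (auto simp: einterval_def)
    ultimately have "set_integrable lborel {0<..} (\<lambda>u. C * (1 / (sqrt u * (1 + u))))"
      by (intro set_integrable_mult_right) auto
    then show ?thesis by simp
  qed
  show "set_integrable lborel {0<..} G"
  proof (rule set_integrable_bound[OF int])
    show "set_borel_measurable lborel {0<..} G"
      using borel_measurable_continuous_on_indicator[OF _ cont] by (simp add: set_borel_measurable_def)
    show "AE u in lborel. u \<in> {0<..} \<longrightarrow> norm (G u) \<le> norm (C / (sqrt u * (1 + u)))"
      using bound C0 by auto
  qed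
  show "set_integrable lborel {0<..} (\<lambda>u. G (1 / u) / of_real (u\<^sup>2))"
  proof (rule set_integrable_bound[OF int])
    have "continuous_on {0<..} (\<lambda>u. G (1 / u) / of_real (u\<^sup>2))"
      by (intro continuous_intros continuous_on_compose2[OF cont]) auto
    then have "(\<lambda>u. indicator {0<..} u *\<^sub>R (G (1 / u) / of_real (u\<^sup>2))) \<in> borel_measurable borel"
      by (intro borel_measurable_continuous_on_indicator) auto
    then show "set_borel_measurable lborel {0<..} (\<lambda>u. G (1 / u) / of_real (u\<^sup>2))"
      by (simp add: set_borel_measurable_def del: of_real_power)
    show "AE u in lborel. u \<in> {0<..} \<longrightarrow> norm (G (1 / u) / of_real (u\<^sup>2)) \<le> norm (C / (sqrt u * (1 + u)))"
    proof (intro AE_I2 impI)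
      fix u :: real assume "u \<in> {0<..}"
      then have u: "u > 0" by simp
      have "norm (G (1 / u) / of_real (u\<^sup>2)) = norm (G (1 / u)) / u\<^sup>2" by (simp add: norm_divide norm_power)
      also have "\<dots> \<le> C / (sqrt (1 / u) * (1 + 1 / u)) / u\<^sup>2"
        using bound[of "1 / u"] u by (intro divide_right_mono) auto
      also have "\<dots> = C / (sqrt u * (1 + u))"
      proof -
        have "sqrt (1 / u) * (1 + 1 / u) * u\<^sup>2 = sqrt u * (1 + u)"
        proof -
          define h where "h = sqrt u"
          have "h > 0" "u = h\<^sup>2" "sqrt (1 / u) = 1 / h" using u by (auto simp: h_def real_sqrt_divide)
          then show ?thesis by (simp add: field_simps power2_eq_square)
        qed
        then show ?thesis by simp
      qed
      finally show "norm (G (1 / u) / of_real (u\<^sup>2)) \<le> norm (C / (sqrt u * (1 + u)))" using C0 u by simp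
    qed
  qed
qed

text \<open>
  The roots sum to zero, so the terms \<open>v j / u\<close> in the derivatives of the antiderivatives
  \<open>(u - v j) Ln (1 - v j / u)\<close> cancel.
\<close>

lemma ray_integrals:
  fixes v :: "nat \<Rightarrow> complex"
  assumes v: "\<And>j. j < n \<Longrightarrow> v j \<notin> \<real>\<^sub>\<ge>\<^sub>0" and v0: "(\<Sum>j<n. v j) = 0"
    and f: "\<And>u. u > 0 \<Longrightarrow> (\<Prod>j<n. 1 - v j / complex_of_real u) \<notin> \<real>\<^sub>\<le>\<^sub>0"
  defines "G \<equiv> \<lambda>u. Ln (\<Prod>j<n. 1 - v j / complex_of_real u)"
  shows "set_integrable lborel {0<..} G"
    and "set_integrable lborel {0<..} (\<lambda>u. G (1 / u) / of_real (u\<^sup>2))"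
    and "(LINT u:{0<..}|lborel. G u) = (\<Sum>j<n. v j * Ln (- v j))"
    and "(LINT u:{0<..}|lborel. G (1 / u) / of_real (u\<^sup>2)) = (\<Sum>j<n. v j * Ln (- v j))"
proof -
  have Gsum: "G u = (\<Sum>j<n. Ln (1 - v j / complex_of_real u))" if "u > 0" for u
    unfolding G_def using v f that by (rule Ln_prod_along_ray)
  have nonpos: "1 - v j / complex_of_real u \<notin> \<real>\<^sub>\<le>\<^sub>0" if "j < n" "u > 0" for j u
    using one_minus_divide_not_nonpos v that by blast
  have mv: "- v j \<notin> \<real>\<^sub>\<le>\<^sub>0" if "j < n" for j
    using v[OF that] by (auto simp: complex_nonneg_Reals_iff complex_nonpos_Reals_iff)
  have contG: "continuous_on {0<..} G"
    unfolding G_def using f by (intro continuous_intros) auto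
  have pos0: "\<forall>\<^sub>F u in at_right (0::real). u > 0" by (rule eventually_at_right_less)
  have Ln0: "((\<lambda>u. Ln (complex_of_real u - v j)) \<longlongrightarrow> Ln (- v j)) (at_right 0)" if "j < n" for j
    using mv[OF that] by (intro tendsto_Ln) (auto intro!: tendsto_eq_intros)
  have Ln_eq: "Ln (1 - v j / complex_of_real u) = Ln (complex_of_real u - v j) - of_real (ln u)"
    if "j < n" "u > 0" for j u
    using Ln_diff_of_real[OF v[OF that(1)] that(2)] by simp
  have G0: "((\<lambda>u. of_real (sqrt u) * G u) \<longlongrightarrow> 0) (at_right 0)"
  proof -
    have a: "((\<lambda>u. complex_of_real (sqrt u)) \<longlongrightarrow> 0) (at_right 0)"
      by (auto intro!: tendsto_eq_intros)
    have "((\<lambda>u. sqrt u * ln u) \<longlongrightarrow> 0) (at_right 0)" by real_asymp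
    then have b: "((\<lambda>u. complex_of_real (sqrt u * ln u)) \<longlongrightarrow> 0) (at_right 0)"
      using tendsto_of_real by fastforce
    have "((\<lambda>u. \<Sum>j<n. of_real (sqrt u) * Ln (complex_of_real u - v j) - of_real (sqrt u * ln u))
        \<longlongrightarrow> (\<Sum>j<n. 0 * Ln (- v j) - 0)) (at_right 0)"
      by (intro tendsto_intros a b Ln0) auto
    moreover have "\<forall>\<^sub>F u in at_right 0. (\<Sum>j<n. of_real (sqrt u) * Ln (complex_of_real u - v j) - of_real (sqrt u * ln u))
        = of_real (sqrt u) * G u"
      using pos0
    proof eventually_elim
      case (elim u)
      then show ?case by (auto simp: Gsum Ln_eq sum_distrib_left algebra_simps intro!: sum.cong)
    qed
    ultimately show ?thesis by (simp add: tendsto_cong)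
  qed
  \<comment> \<open>Without its linear term the logarithm is O(1/u^2). The linear terms drop out of
    \<open>G\<close> because the \<open>v j\<close> sum to zero.\<close>
  have remainder: "((\<lambda>u. of_real (u * sqrt u) * (Ln (1 - a / complex_of_real u) + a / complex_of_real u)) \<longlongrightarrow> 0) at_top" for a
  proof (rule Lim_null_comparison)
    show "((\<lambda>u. 2 * (norm a)\<^sup>2 * (1 / sqrt u)) \<longlongrightarrow> 0) at_top" by real_asymp
    show "\<forall>\<^sub>F u in at_top. norm (of_real (u * sqrt u) * (Ln (1 - a / complex_of_real u) + a / complex_of_real u))
        \<le> 2 * (norm a)\<^sup>2 * (1 / sqrt u)"
      using eventually_gt_at_top[of "max 0 (2 * norm a)"]
    proof eventually_elim
      case (elim u)
      then have "2 * norm a < u" by simp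
      then have u: "u > 0" "2 * norm a < u" using norm_ge_zero[of a] by linarith+
      define z where "z = - a / complex_of_real u"
      have z: "norm z = norm a / u" using u by (simp add: z_def norm_divide)
      have z2: "norm z \<le> 1 / 2" using u by (simp add: z field_simps)
      have "norm (Ln (1 + z) - z) \<le> norm z ^ 2 / (1 - norm z)"
        using z2 by (intro Ln_approx_linear) auto
      also have "\<dots> \<le> norm z ^ 2 / (1 / 2)"
        using z2 by (intro divide_left_mono) auto
      finally have "norm (Ln (1 + z) - z) \<le> 2 * norm z ^ 2" by simp
      then have "u * sqrt u * norm (Ln (1 + z) - z) \<le> u * sqrt u * (2 * norm z ^ 2)"
        using u by (intro mult_left_mono) auto
      also have "\<dots> = 2 * (norm a)\<^sup>2 * (sqrt u / u)" using u by (simp add: z field_simps power2_eq_square)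
      also have "sqrt u / u = 1 / sqrt u" using u by (simp add: real_div_sqrt field_simps)
      finally show ?case using u by (simp add: norm_mult z_def)
    qed
  qed
  have Ginf: "((\<lambda>u. of_real (u * sqrt u) * G u) \<longlongrightarrow> 0) at_top"
  proof -
    have "((\<lambda>u. \<Sum>j<n. of_real (u * sqrt u) * (Ln (1 - v j / complex_of_real u) + v j / complex_of_real u)) \<longlongrightarrow> (\<Sum>j<n. 0)) at_top"
      by (intro tendsto_sum remainder)
    moreover have "\<forall>\<^sub>F u in at_top. (\<Sum>j<n. of_real (u * sqrt u) * (Ln (1 - v j / complex_of_real u) + v j / complex_of_real u))
        = of_real (u * sqrt u) * G u"
      using eventually_gt_at_top[of 0]
    proof eventually_elim
      case (elim u)
      then show ?case by (simp add: Gsum sum.distrib v0 flip: sum_distrib_left sum_divide_distrib)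
    qed
    ultimately show ?thesis by (simp add: tendsto_cong)
  qed
  show int: "set_integrable lborel {0<..} G" "set_integrable lborel {0<..} (\<lambda>u. G (1 / u) / of_real (u\<^sup>2))"
    using set_integrable_ray_dominated[OF contG G0 Ginf] by auto
  define F where "F u = (\<Sum>j<n. (complex_of_real u - v j) * Ln (1 - v j / complex_of_real u))" for u
  have dF: "(F has_vector_derivative G u) (at u)" if u: "u > 0" for u
  proof -
    have "((\<lambda>u. \<Sum>j<n. (u - v j) * Ln (1 - v j / u)) has_field_derivative
        (\<Sum>j<n. Ln (1 - v j / complex_of_real u) + v j / complex_of_real u)) (at (complex_of_real u))"
    proof (rule DERIV_sum)
      fix j assume j: "j \<in> {..<n}"
      have nz: "1 - v j / complex_of_real u \<notin> \<real>\<^sub>\<le>\<^sub>0" using nonpos j u by simp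
      then have "1 - v j / complex_of_real u \<noteq> 0" by (metis nonpos_Reals_zero_I)
      then have nz1: "complex_of_real u - v j \<noteq> 0" using u by (auto simp: field_simps)
      show "((\<lambda>u. (u - v j) * Ln (1 - v j / u)) has_field_derivative
        Ln (1 - v j / complex_of_real u) + v j / complex_of_real u) (at (complex_of_real u))"
        using nz u nz1 by (auto intro!: derivative_eq_intros) (simp add: field_simps power2_eq_square)
    qed
    also have "(\<Sum>j<n. Ln (1 - v j / complex_of_real u) + v j / complex_of_real u) = G u"
      using u by (simp add: Gsum sum.distrib v0 flip: sum_divide_distrib)
    finally show ?thesis unfolding F_def by (rule has_vector_derivative_real_field)
  qed
  have F0: "(F \<longlongrightarrow> - (\<Sum>j<n. v j * Ln (- v j))) (at_right 0)"
  proof -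
    have "((\<lambda>u::real. u * ln u) \<longlongrightarrow> 0) (at_right 0)" by real_asymp
    then have b: "((\<lambda>u. complex_of_real (u * ln u)) \<longlongrightarrow> 0) (at_right 0)"
      using tendsto_of_real by fastforce
    have "((\<lambda>u. \<Sum>j<n. (complex_of_real u - v j) * Ln (complex_of_real u - v j) - of_real (u * ln u))
        \<longlongrightarrow> (\<Sum>j<n. (0 - v j) * Ln (- v j) - 0)) (at_right 0)"
      by (intro tendsto_intros b Ln0) (auto intro!: tendsto_eq_intros)
    moreover have "\<forall>\<^sub>F u in at_right 0. (\<Sum>j<n. (complex_of_real u - v j) * Ln (complex_of_real u - v j) - of_real (u * ln u)) = F u"
      using pos0
    proof eventually_elim
      case (elim u)
      then have "F u = (\<Sum>j<n. (complex_of_real u - v j) * Ln (complex_of_real u - v j) - of_real (u * ln u) + v j * of_real (ln u))"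
        unfolding F_def by (intro sum.cong) (auto simp: Ln_eq algebra_simps)
      then show ?case by (simp add: sum.distrib v0 flip: sum_distrib_right)
    qed
    ultimately show ?thesis by (simp add: tendsto_cong sum_negf)
  qed
  \<comment> \<open>Each summand of \<open>F\<close> tends to \<open>- v j\<close>, and these limits
    sum to zero.\<close>
  have Finf: "(F \<longlongrightarrow> 0) at_top"
  proof -
    have "((\<lambda>u. (complex_of_real u - a) * Ln (1 - a / complex_of_real u)) \<longlongrightarrow> - a) at_top" for a
    proof -
      have s: "((\<lambda>u. complex_of_real (1 / sqrt u)) \<longlongrightarrow> 0) at_top"
      proof -
        have "((\<lambda>u::real. 1 / sqrt u) \<longlongrightarrow> 0) at_top" by real_asymp
        from tendsto_of_real[OF this, where ?'a = complex] show ?thesis by simp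
      qed
      have l: "((\<lambda>u. Ln (1 - a / complex_of_real u)) \<longlongrightarrow> Ln 1) at_top"
        by (intro tendsto_Ln tendsto_one_minus_divide_at_top) auto
      have "((\<lambda>u. complex_of_real (1 / sqrt u) * (of_real (u * sqrt u) * (Ln (1 - a / complex_of_real u) + a / complex_of_real u))
          - a - a * Ln (1 - a / complex_of_real u)) \<longlongrightarrow> 0 * 0 - a - a * Ln 1) at_top"
        by (intro tendsto_intros remainder s l)
      moreover have "\<forall>\<^sub>F u in at_top. complex_of_real (1 / sqrt u) * (of_real (u * sqrt u) * (Ln (1 - a / complex_of_real u) + a / complex_of_real u))
          - a - a * Ln (1 - a / complex_of_real u) = (complex_of_real u - a) * Ln (1 - a / complex_of_real u)"
        using eventually_gt_at_top[of 0]
      proof eventually_elim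
        fix u :: real assume u: "u > 0"
        define L where "L = Ln (1 - a / complex_of_real u)"
        have 1: "complex_of_real (1 / sqrt u) * of_real (u * sqrt u) = of_real u"
        proof -
          have "1 / sqrt u * (u * sqrt u) = u" using u by simp
          then show ?thesis by (metis of_real_mult)
        qed
        have "complex_of_real (1 / sqrt u) * (of_real (u * sqrt u) * (L + a / complex_of_real u)) - a - a * L
            = of_real u * (L + a / complex_of_real u) - a - a * L"
          by (simp only: mult.assoc[symmetric] 1)
        also have "\<dots> = (complex_of_real u - a) * L"
          using u by (simp add: distrib_left left_diff_distrib)
        finally show "complex_of_real (1 / sqrt u) * (of_real (u * sqrt u) * (Ln (1 - a / complex_of_real u) + a / complex_of_real u))
          - a - a * Ln (1 - a / complex_of_real u) = (complex_of_real u - a) * Ln (1 - a / complex_of_real u)"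
          unfolding L_def .
      qed
      ultimately show ?thesis by (simp add: tendsto_cong)
    qed
    then have "(F \<longlongrightarrow> (\<Sum>j<n. - v j)) at_top" unfolding F_def by (intro tendsto_sum)
    then show ?thesis by (simp add: sum_negf v0)
  qed
  have ei: "einterval 0 \<infinity> = {0<..}" by (auto simp: einterval_def)
  have "(LBINT u=0..\<infinity>. G u) = 0 - - (\<Sum>j<n. v j * Ln (- v j))"
  proof (rule interval_integral_FTC_integrable)
    show "(F has_vector_derivative G u) (at u)" if "0 < ereal u" "ereal u < \<infinity>" for u using dF that by simp
    show "isCont G u" if "0 < ereal u" "ereal u < \<infinity>" for u
      using contG that continuous_on_eq_continuous_at[of "{0<..}" G] by auto
    show "((F \<circ> real_of_ereal) \<longlongrightarrow> - (\<Sum>j<n. v j * Ln (- v j))) (at_right 0)"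
      unfolding zero_ereal_def ereal_tendsto_simps by (rule F0)
    show "((F \<circ> real_of_ereal) \<longlongrightarrow> 0) (at_left \<infinity>)" unfolding ereal_tendsto_simps by (rule Finf)
  qed (use int(1) ei in simp_all)
  then show "(LINT u:{0<..}|lborel. G u) = (\<Sum>j<n. v j * Ln (- v j))"
    by (simp add: interval_lebesgue_integral_def ei)
  have inv0: "filterlim (\<lambda>u::real. 1 / u) at_top (at_right 0)" "filterlim (\<lambda>u::real. 1 / u) (at_right 0) at_top"
    by real_asymp+
  \<comment> \<open>The map u -> 1/u exchanges the two ends, which the sign of the primitive
    \<open>- F (1 / u)\<close> compensates; hence the same value as before.\<close>
  have "(LBINT u=0..\<infinity>. G (1 / u) / of_real (u\<^sup>2)) = - (- (\<Sum>j<n. v j * Ln (- v j))) - - 0"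
  proof (rule interval_integral_FTC_integrable[where F = "\<lambda>u. - F (1 / u)"])
    show "((\<lambda>u. - F (1 / u)) has_vector_derivative G (1 / u) / of_real (u\<^sup>2)) (at u)"
      if "0 < ereal u" "ereal u < \<infinity>" for u
    proof -
      have u: "u > 0" using that by simp
      have d: "((\<lambda>u. 1 / u) has_vector_derivative - (1 / u\<^sup>2)) (at u)"
        using u by (auto intro!: derivative_eq_intros simp flip: has_real_derivative_iff_has_vector_derivative)
          (simp add: power2_eq_square)
      have "((F \<circ> (\<lambda>u. 1 / u)) has_vector_derivative (- (1 / u\<^sup>2)) *\<^sub>R G (1 / u)) (at u)"
        using u by (intro vector_diff_chain_at d dF) auto
      then have "((\<lambda>u. - F (1 / u)) has_vector_derivative - ((- (1 / u\<^sup>2)) *\<^sub>R G (1 / u))) (at u)"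
        by (intro has_vector_derivative_minus) (simp add: o_def)
      then show ?thesis by (simp add: scaleR_conv_of_real)
    qed
    show "isCont (\<lambda>u. G (1 / u) / of_real (u\<^sup>2)) u" if "0 < ereal u" "ereal u < \<infinity>" for u
    proof -
      have "continuous_on {0<..} (\<lambda>u. G (1 / u) / of_real (u\<^sup>2))"
        by (intro continuous_intros continuous_on_compose2[OF contG]) auto
      then show ?thesis using that continuous_on_eq_continuous_at[of "{0<..}" "\<lambda>u. G (1 / u) / of_real (u\<^sup>2)"] by auto
    qed
    show "(((\<lambda>u. - F (1 / u)) \<circ> real_of_ereal) \<longlongrightarrow> - 0) (at_right 0)"
      unfolding zero_ereal_def ereal_tendsto_simps
      by (intro tendsto_minus filterlim_compose[OF Finf] inv0)
    show "(((\<lambda>u. - F (1 / u)) \<circ> real_of_ereal) \<longlongrightarrow> - (- (\<Sum>j<n. v j * Ln (- v j)))) (at_left \<infinity>)"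
      unfolding ereal_tendsto_simps by (intro tendsto_minus filterlim_compose[OF F0] inv0)
  qed (use int(2) ei in simp_all)
  then show "(LINT u:{0<..}|lborel. G (1 / u) / of_real (u\<^sup>2)) = (\<Sum>j<n. v j * Ln (- v j))"
    by (simp add: interval_lebesgue_integral_def ei)
qed

text \<open>For an angle between 0 and pi this is the open sector 0 < arg w < \<alpha>, written as
  two half-planes so that no branch of the argument is involved.\<close>

definition sector :: "real \<Rightarrow> complex set" where
  "sector \<alpha> = {w. Im w > 0 \<and> Im (w * cis (- \<alpha>)) < 0}"

lemma sector_polar:
  assumes "m > 0"
  shows "complex_of_real m * cis t \<in> sector \<alpha> \<longleftrightarrow> sin t > 0 \<and> sin (t - \<alpha>) < 0"
proof -
  have e: "complex_of_real m * cis t * cis (- \<alpha>) = complex_of_real m * cis (t - \<alpha>)"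
    by (simp add: mult.assoc cis_mult)
  show ?thesis unfolding sector_def mem_Collect_eq e
    using assms by (simp add: zero_less_mult_iff mult_less_0_iff)
qed

text \<open>As functions of \<open>w\<close>, the first logarithm is cut along the positive axis and
  the second one along the ray of argument \<open>\<alpha>\<close>. Off the cuts they differ by \<i>
  \<alpha>, with one additional turn exactly in the region between the cuts.\<close>

lemma Ln_minus_rotate:
  assumes \<alpha>: "0 < \<alpha>" "\<alpha> < pi" and w: "w \<notin> \<real>\<^sub>\<ge>\<^sub>0" and wa: "w * cis (- \<alpha>) \<notin> \<real>\<^sub>\<ge>\<^sub>0"
  shows "Ln (- w) - Ln (- (w * cis (- \<alpha>))) = \<i> * \<alpha> - (if w \<in> sector \<alpha> then 2 * pi * \<i> else 0)"
proof -
  have w0: "w \<noteq> 0" using w by auto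
  define a b where "a = Ln (- w)" and "b = Ln (- (w * cis (- \<alpha>)))"
  have ab: "exp a = - w" "exp b = - (w * cis (- \<alpha>))" using w0 by (auto simp: a_def b_def)
  have mw: "- w \<notin> \<real>\<^sub>\<le>\<^sub>0" "- (w * cis (- \<alpha>)) \<notin> \<real>\<^sub>\<le>\<^sub>0"
    using w wa by (auto simp: complex_nonneg_Reals_iff complex_nonpos_Reals_iff)
  have ai: "- pi < Im a" "Im a < pi" "- pi < Im b" "Im b < pi"
    using mw w0 by (auto simp: a_def b_def mpi_less_Im_Ln Im_Ln_less_pi)
  have "exp (a - b) = exp (\<i> * \<alpha>)" using w0 by (simp add: exp_diff ab cis_conv_exp[symmetric] divide_simps cis_mult)

  then obtain k :: int where k: "a - b = \<i> * \<alpha> + of_int (2 * k) * (pi * \<i>)"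
    unfolding exp_eq by (auto simp: algebra_simps)
  have ki: "Im a - Im b = \<alpha> + 2 * of_int k * pi" using arg_cong[OF k, of Im] by simp
  have "w = - exp a" using ab by simp
  also have "\<dots> = of_real (exp (Re a)) * cis (Im a + pi)"
    by (simp add: exp_eq_polar cis_mult[symmetric])
  finally have wp: "w \<in> sector \<alpha> \<longleftrightarrow> sin (Im a + pi) > 0 \<and> sin (Im a + pi - \<alpha>) < 0"
    using sector_polar by simp
  \<comment> \<open>Both imaginary parts lie strictly between -pi and pi, so \<open>k\<close> is 0
    or -1: the cases outside and inside the sector.\<close>
  have "2 * of_int k * pi < 2 * pi" "- (4 * pi) < 2 * of_int k * pi" using ki ai \<alpha> by linarith+
  then have "0 < (1 - real_of_int k) * pi" "0 < (real_of_int k + 2) * pi" by (simp_all add: algebra_simps)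
  then have "of_int k < (1::real)" "(-2::real) < of_int k" using pi_gt_zero by (auto simp: zero_less_mult_iff)
  then have "k = 0 \<or> k = -1" by linarith
  then show ?thesis
  proof
    assume k0: "k = 0"
    then have i: "Im a = Im b + \<alpha>" using ki by simp
    have "w \<notin> sector \<alpha>"
    proof
      assume "w \<in> sector \<alpha>"
      then have s: "sin (Im a + pi) > 0" "sin (Im a + pi - \<alpha>) < 0" using wp by auto
      show False
      proof (cases "Im a \<ge> 0")
        case True
        then have "sin (Im a) \<ge> 0" using ai by (intro sin_ge_zero) auto
        then show False using s by simp
      next
        case False
        then have "sin (Im a + pi - \<alpha>) \<ge> 0" using i ai \<alpha> by (intro sin_ge_zero) auto
        then show False using s by simp
      qed
    qed
    then show ?thesis using k k0 by (simp add: a_def b_def)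
  next
    assume k1: "k = -1"
    then have i: "Im a = Im b + \<alpha> - 2 * pi" using ki by simp
    have "sin (Im a + pi) > 0" using i ai \<alpha> by (intro sin_gt_zero) auto
    moreover have "sin (\<alpha> - (Im a + pi)) > 0" using i ai \<alpha> by (intro sin_gt_zero) auto
    then have "sin (Im a + pi - \<alpha>) < 0" by (metis minus_diff_eq neg_0_less_iff_less sin_minus)
    ultimately have "w \<in> sector \<alpha>" using wp by simp
    then show ?thesis using k k1 by (simp add: a_def b_def)
  qed
qed

section \<open>The root in the sector\<close>

text \<open>The quadratic equation is the vanishing of the logarithmic derivative of z, with
  denominators cleared; \<open>w_star\<close> is its positive root.\<close>

lemma w_star_quadratic:
  assumes "s < r"
  shows "w_star r s > 0"
    and "(real r - real s) * (w_star r s)\<^sup>2 + (real s - 1) * w_star r s = real r + 1"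
proof -
  define a b c where "a = real r - real s" and "b = 1 - real s" and "c = real r + 1"
  have a: "a > 0" and c: "c > 0" using assms by (auto simp: a_def c_def)
  define q where "q = sqrt (b\<^sup>2 + 4 * c * a)"
  have q2: "q\<^sup>2 = b\<^sup>2 + 4 * c * a" using a c by (simp add: q_def)
  have w: "w_star r s = (b + q) / (2 * a)" by (simp add: w_star_def a_def b_def c_def q_def)
  have "b\<^sup>2 < b\<^sup>2 + 4 * c * a" using a c by simp
  then have "\<bar>b\<bar> < q" unfolding q_def by (metis real_sqrt_abs real_sqrt_less_mono)
  then show "w_star r s > 0" using a by (simp add: w)
  have "2 * a * w_star r s = b + q" using a by (simp add: w)
  then have "(2 * a * w_star r s - b)\<^sup>2 = q\<^sup>2" by simp
  then have "4 * a * (a * (w_star r s)\<^sup>2 - b * w_star r s) = 4 * a * c"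
    unfolding q2 by (simp add: power2_eq_square algebra_simps)
  then have "a * (w_star r s)\<^sup>2 - b * w_star r s = c" using a by simp
  then show "(real r - real s) * (w_star r s)\<^sup>2 + (real s - 1) * w_star r s = real r + 1"
    by (simp add: a_def b_def c_def algebra_simps)
qed

lemma w_star_gt_1:
  assumes "s < r"
  shows "w_star r s > 1"
proof (rule ccontr)
  assume "\<not> w_star r s > 1"
  then have w: "w_star r s \<le> 1" "w_star r s > 0" using w_star_quadratic(1)[OF assms] by auto
  then have "(w_star r s)\<^sup>2 \<le> w_star r s" by (simp add: power2_eq_square)
  then have "(real r - real s) * (w_star r s)\<^sup>2 \<le> (real r - real s) * w_star r s"
    using assms by (intro mult_left_mono) auto
  then have "real r + 1 \<le> (real r - 1) * w_star r s"
    using w_star_quadratic(2)[OF assms] by (simp add: algebra_simps)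
  also have "\<dots> \<le> (real r - 1) * 1" using w assms by (intro mult_left_mono) auto
  finally show False by simp
qed

text \<open>The quadratic turns \<open>(r + 1) (w - 1) (w + 1)\<close> into
  \<open>w ((s + 1) w - (s - 1))\<close>, which identifies the closed formula with the critical
  value z(w_star).\<close>

lemma x_star_eq:
  assumes "s < r"
  shows "x_star r s = w_star r s ^ (r + 1) / ((w_star r s - 1) * (w_star r s + 1) ^ s)"
    and "x_star r s > 0"
proof -
  define w where "w = w_star r s"
  have w: "w > 1" using w_star_gt_1[OF assms] by (simp add: w_def)
  have q: "(real r - real s) * w\<^sup>2 + (real s - 1) * w = real r + 1"
    using w_star_quadratic(2)[OF assms] by (simp add: w_def)
  have e: "(real r + 1) * (w - 1) * (w + 1) = w * ((real s + 1) * w - (real s - 1))"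
    using q by (simp add: algebra_simps power2_eq_square)
  define d where "d = (real s + 1) * (w - (real s - 1) / (real s + 1))"
  have d: "d = (real s + 1) * w - (real s - 1)"
  proof -
    have "(real s + 1) * ((real s - 1) / (real s + 1)) = real s - 1"
      by (subst times_divide_eq_right, rule nonzero_mult_div_cancel_left) linarith
    then show ?thesis by (simp only: d_def right_diff_distrib)
  qed
  \<comment> \<open>For \<open>s = 0\<close> the exponent is -1, hence the integer power.\<close>
  have p: "(w + 1) powi (int s - 1) * (w + 1) = (w + 1) ^ s"
    using power_int_add_1[of "w + 1" "int s - 1"] w by simp
  have "x_star r s = (real r + 1) * w ^ r / ((w + 1) powi (int s - 1) * d)"
    by (simp add: x_star_def w_def d_def mult_ac)
  also have "\<dots> = ((real r + 1) * w ^ r) * w / (((w + 1) powi (int s - 1) * d) * w)"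
    using w by simp
  also have "\<dots> = ((real r + 1) * w ^ r) * w / ((w + 1) powi (int s - 1) * (w * d))"
    by (simp add: mult_ac)
  also have "\<dots> = (real r + 1) * w ^ (r + 1) / ((real r + 1) * ((w - 1) * ((w + 1) powi (int s - 1) * (w + 1))))"
    unfolding d e[symmetric] by (simp add: mult_ac)
  also have "\<dots> = w ^ (r + 1) / ((w - 1) * (w + 1) ^ s)" unfolding p by simp
  finally show "x_star r s = w_star r s ^ (r + 1) / ((w_star r s - 1) * (w_star r s + 1) ^ s)" by (simp add: w_def)
  then show "x_star r s > 0" using w by (simp add: w_def)
qed

text \<open>On (1, infinity) the logarithmic derivative of z changes sign only at
  \<open>w_star\<close>, from negative to positive. The multiplied form also covers
  \<open>t \<le> 1\<close>, where the left-hand side is not positive.\<close>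

lemma x_star_minimal:
  assumes sr: "s < r" and t: "t > 0"
  shows "x_star r s * ((t - 1) * (t + 1) ^ s) \<le> t ^ (r + 1)"
proof (cases "t > 1")
  case False
  have "(t - 1) * (t + 1) ^ s \<le> 0" using False t by (simp add: mult_nonpos_nonneg)
  then have "x_star r s * ((t - 1) * (t + 1) ^ s) \<le> 0" using x_star_eq(2)[OF sr] by (simp add: mult_nonneg_nonpos)
  also have "0 \<le> t ^ (r + 1)" using t by simp
  finally show ?thesis .
next
  case True
  define w where "w = w_star r s"
  have w: "w > 1" using w_star_gt_1[OF sr] by (simp add: w_def)
  define l where "l y = (real r + 1) * ln y - ln (y - 1) - real s * ln (y + 1)" for y :: real
  define l' where "l' y = (real r + 1) / y - 1 / (y - 1) - real s / (y + 1)" for y :: real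
  have dl: "(l has_real_derivative l' y) (at y)" if "y > 1" for y
    using that unfolding l_def l'_def by (auto intro!: derivative_eq_intros)
  have q: "(real r - real s) * w\<^sup>2 + (real s - 1) * w = real r + 1"
    using w_star_quadratic(2)[OF sr] by (simp add: w_def)
  have l': "l' y = (y - w) * ((real r - real s) * (y + w) + (real s - 1)) / (y * (y - 1) * (y + 1))" if "y > 1" for y
  proof -
    have "(y - w) * ((real r - real s) * (y + w) + (real s - 1)) = (real r - real s) * y\<^sup>2 + (real s - 1) * y - (real r + 1)"
      unfolding q[symmetric] by (simp add: algebra_simps power2_eq_square)
    also have "\<dots> = (real r + 1) * ((y - 1) * (y + 1)) - y * (y + 1) - real s * (y * (y - 1))"
      by (simp add: algebra_simps power2_eq_square)
    finally show ?thesis using that by (simp add: l'_def divide_simps) (simp add: algebra_simps)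
  qed
  have pos: "(real r - real s) * (y + w) + (real s - 1) > 0" if "y > 1" for y
  proof -
    have "(real r - real s) * (y + w) > 1 * 2"
      using that w sr by (intro mult_less_le_imp_less mult_le_less_imp_less) auto
    then show ?thesis by simp
  qed
  have lwt: "l w \<le> l t"
  proof (cases "w \<le> t")
    case wt: True
    show ?thesis
    proof (rule DERIV_nonneg_imp_nondecreasing[OF wt])
      fix y assume "w \<le> y" "y \<le> t"
      then show "\<exists>d. (l has_real_derivative d) (at y) \<and> 0 \<le> d"
        using dl[of y] l'[of y] pos[of y] w by (intro exI[of _ "l' y"]) auto
    qed
  next
    case False
    show ?thesis
    proof (rule DERIV_nonpos_imp_nonincreasing[of t w l])
      show "t \<le> w" using False by simp
      fix y assume y: "t \<le> y" "y \<le> w"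
      then have "(y - w) * ((real r - real s) * (y + w) + (real s - 1)) \<le> 0"
        using pos[of y] True by (intro mult_nonpos_nonneg) auto
      then have "l' y \<le> 0" using y True l'[of y] by (simp add: divide_nonpos_nonneg)
      then show "\<exists>d. (l has_real_derivative d) (at y) \<and> d \<le> 0"
        using dl[of y] y True by (intro exI[of _ "l' y"]) auto
    qed
  qed
  have el: "exp (l y) = y ^ (r + 1) / ((y - 1) * (y + 1) ^ s)" if "y > 1" for y
  proof -
    have "exp ((real r + 1) * ln y) = y ^ (r + 1)"
      using that exp_of_nat_mult[of "r + 1" "ln y"] by (simp add: add.commute)
    moreover have "exp (real s * ln (y + 1)) = (y + 1) ^ s"
      using that by (simp add: exp_of_nat_mult)
    ultimately show ?thesis using that by (simp add: l_def exp_diff)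
  qed
  have "exp (l w) \<le> exp (l t)" using lwt by simp
  then have "x_star r s \<le> t ^ (r + 1) / ((t - 1) * (t + 1) ^ s)"
    unfolding x_star_eq(1)[OF sr] el[OF w] el[OF True] by (simp only: w_def)
  moreover have "(t - 1) * (t + 1) ^ s > 0" using True by simp
  ultimately show ?thesis by (simp only: pos_le_divide_eq)
qed

section \<open>The characteristic polynomial and its roots\<close>

lemma monic_poly_roots:
  fixes p :: "complex poly"
  assumes "degree p = n" "lead_coeff p = 1"
  shows "\<exists>w. p = (\<Prod>j<n. [:- w j, 1:])"
  using assms
proof (induction n arbitrary: p)
  case 0
  then show ?case by (auto elim!: degree_eq_zeroE)
next
  case (Suc n)
  then obtain a where "poly p a = 0" using alg_closed_imp_poly_has_root[of p] by auto
  then obtain q where q: "p = [:- a, 1:] * q" by (auto simp: poly_eq_0_iff_dvd)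
  then have "q \<noteq> 0" using Suc.prems by auto
  then have "degree q = n"
    using Suc.prems(1) unfolding q by (auto simp: degree_mult_eq simp del: mult_pCons_left)
  moreover have "lead_coeff q = 1"
    using Suc.prems(2) unfolding q lead_coeff_mult by simp
  ultimately have "degree q = n" "lead_coeff q = 1" by auto
  then obtain w where w: "q = (\<Prod>j<n. [:- w j, 1:])" using Suc.IH by blast
  have "p = (\<Prod>j<Suc n. [:- (w(n := a)) j, 1:])" unfolding q w by simp
  then show ?case by blast
qed

lemma coeff_prod_monic_linear:
  fixes w :: "nat \<Rightarrow> 'a::comm_ring_1"
  shows "coeff (\<Prod>j<n. [:- w j, 1:]) n = 1"
    and "coeff (\<Prod>j<Suc n. [:- w j, 1:]) n = - (\<Sum>j<Suc n. w j)"
proof -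
  have up: "coeff (\<Prod>j<n. [:- w j, 1:]) m = 0" if "m > n" for m n
    using that
  proof (induction n arbitrary: m)
    case (Suc n)
    then show ?case by (cases m) (auto simp: mult.commute[of _ "[:- w n, 1:]"])
  qed auto
  have top: "coeff (\<Prod>j<n. [:- w j, 1:]) n = 1" for n
    by (induction n) (auto simp: mult.commute[of _ "[:- w _, 1:]"] up)
  then show "coeff (\<Prod>j<n. [:- w j, 1:]) n = 1" .
  show "coeff (\<Prod>j<Suc n. [:- w j, 1:]) n = - (\<Sum>j<Suc n. w j)"
  proof (induction n)
    case (Suc n)
    have "coeff (\<Prod>j<Suc (Suc n). [:- w j, 1:]) (Suc n) =
        coeff (\<Prod>j<Suc n. [:- w j, 1:]) n - w (Suc n) * coeff (\<Prod>j<Suc n. [:- w j, 1:]) (Suc n)"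
      by (subst prod.lessThan_Suc) (simp add: mult.commute[of _ "[:- w (Suc n), 1:]"] del: prod.lessThan_Suc)
    then show ?case unfolding top Suc by simp
  qed simp
qed

text \<open>The subtracted polynomial has degree at most \<open>s + 1 < r\<close>, so the
  coefficient of index \<open>r\<close> vanishes; it is minus the sum of the roots.\<close>

lemma char_poly_roots:
  assumes rs: "r \<ge> s + 2"
  obtains w :: "nat \<Rightarrow> complex"
  where "\<And>t. t ^ (r + 1) - x * ((t - 1) * (t + 1) ^ s) = (\<Prod>j<r + 1. t - w j)" "(\<Sum>j<r + 1. w j) = 0"
proof -
  define q :: "complex poly" where "q = smult x ([:-1, 1:] * [:1, 1:] ^ s)"
  define p where "p = monom 1 (r + 1) - q"
  have "degree q \<le> s + 1"
    unfolding q_def by (intro order.trans[OF degree_smult_le] order.trans[OF degree_mult_le])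
      (auto intro: order.trans[OF degree_power_le])
  then have q0: "coeff q m = 0" if "m \<ge> r" for m using that rs by (intro coeff_eq_0) auto
  have c1: "coeff p (r + 1) = 1" and c0: "coeff p r = 0" using q0 by (auto simp: p_def)
  have "degree p = r + 1"
  proof (rule antisym)
    show "degree p \<le> r + 1" by (rule degree_le) (auto simp: p_def q0)
    show "r + 1 \<le> degree p" by (rule le_degree) (use c1 in simp)
  qed
  then obtain w where w: "p = (\<Prod>j<r + 1. [:- w j, 1:])" using monic_poly_roots[of p "r + 1"] c1 by auto
  show thesis
  proof (rule that)
    show "(\<Sum>j<r + 1. w j) = 0"
    proof -
      have "coeff p r = - (\<Sum>j<r + 1. w j)"
        unfolding w using coeff_prod_monic_linear(2)[of w r] by (simp only: Suc_eq_plus1)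
      then show ?thesis using c0 by (metis neg_equal_0_iff_equal)
    qed
    fix t
    have "poly p t = (\<Prod>j<r + 1. t - w j)" unfolding w poly_prod by (intro prod.cong) auto
    then show "t ^ (r + 1) - x * ((t - 1) * (t + 1) ^ s) = (\<Prod>j<r + 1. t - w j)"
      by (simp add: p_def q_def poly_monom algebra_simps)
  qed
qed

section \<open>The logarithm's argument on the two rays\<close>

lemma path_angle_bounds:
  assumes "r \<ge> 2"
  shows "0 < path_angle r" "path_angle r < pi" "(real r + 1) * path_angle r = 2 * pi"
proof -
  have r: "real r + 1 > 2" using assms by simp
  then show "0 < path_angle r" "(real r + 1) * path_angle r = 2 * pi" by (simp_all add: path_angle_def)
  show "path_angle r < pi" using r by (simp add: path_angle_def pos_divide_less_eq)
qed

lemma path_angle_cis_power: "cis (path_angle r) ^ (r + 1) = 1"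
proof -
  have "cis (path_angle r) ^ (r + 1) = cis (real (r + 1) * path_angle r)" by (rule Complex.DeMoivre)
  also have "real (r + 1) * path_angle r = 2 * pi"
  proof -
    have "real r + 1 > 0" by linarith
    then have "(real r + 1) * path_angle r = 2 * pi" by (simp add: path_angle_def)
    moreover have "real (r + 1) = real r + 1" by simp
    ultimately show ?thesis by metis
  qed
  finally show ?thesis by simp
qed

text \<open>On both rays \<open>t ^ (r + 1)\<close> equals \<open>u ^ (r + 1) > 0\<close>. A value
  on the cut would make \<open>(t - 1) * (t + 1) ^ s\<close> a positive number of size at least
  \<open>u ^ (r + 1) / x\<close>. On the positive axis this contradicts
  \<open>x < x_star r s\<close>, on the other ray the estimate of arguments.\<close>

lemma log_argument_not_nonpos:
  assumes rs: "r \<ge> s + 2" and x: "0 < x" "x < x_star r s" and u: "u > 0"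
    and \<tau>: "\<tau> = 1 \<or> \<tau> = cis (path_angle r)"
  defines "t \<equiv> complex_of_real u * \<tau>"
  shows "1 - complex_of_real x * ((t - 1) * (t + 1) ^ s / t ^ (r + 1)) \<notin> \<real>\<^sub>\<le>\<^sub>0"
proof
  assume "1 - complex_of_real x * ((t - 1) * (t + 1) ^ s / t ^ (r + 1)) \<in> \<real>\<^sub>\<le>\<^sub>0"
  then obtain y where y: "y \<le> 0" "1 - complex_of_real x * ((t - 1) * (t + 1) ^ s / t ^ (r + 1)) = of_real y"
    by (auto elim!: nonpos_Reals_cases)
  have "\<tau> ^ (r + 1) = 1" using \<tau> path_angle_cis_power by auto
  then have tr: "t ^ (r + 1) = complex_of_real (u ^ (r + 1))"
    by (simp only: t_def power_mult_distrib mult_1_right of_real_power)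
  define p where "p = (1 - y) * u ^ (r + 1) / x"
  have p: "p > 0" using y u x by (simp add: p_def)
  have "complex_of_real x * ((t - 1) * (t + 1) ^ s) = of_real ((1 - y) * u ^ (r + 1))"
    using y(2) u unfolding tr by (simp add: field_simps)
  then have tp: "(t - 1) * (t + 1) ^ s = of_real p"
    using x by (simp add: p_def field_simps)
  from \<tau> show False
  proof
    assume "\<tau> = 1"
    then have "complex_of_real ((u - 1) * (u + 1) ^ s) = of_real p" using tp by (simp add: t_def)
    then have "(u - 1) * (u + 1) ^ s = p" by (simp only: of_real_eq_iff)
    then have "x * ((u - 1) * (u + 1) ^ s) \<ge> u ^ (r + 1)" using x y u by (simp add: p_def)
    moreover have "x * ((u - 1) * (u + 1) ^ s) < x_star r s * ((u - 1) * (u + 1) ^ s)"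
      using \<open>(u - 1) * (u + 1) ^ s = p\<close> p x by simp
    ultimately show False using x_star_minimal[of s r u] rs u by simp
  next
    assume "\<tau> = cis (path_angle r)"
    then show False using ray_product_not_pos_real[OF rs u p] tp by (simp add: t_def path_angle_def)
  qed
qed

text \<open>Dividing the roots by \<open>\<tau>\<close> rotates the ray onto the positive axis, so
  the results on logarithms apply to both rays in one form. A root on a ray would be a zero of the
  argument of the logarithm, which avoids 0.\<close>

lemma ray_factorization:
  assumes rs: "r \<ge> s + 2" and x: "0 < x" "x < x_star r s"
    and w: "\<And>t. t ^ (r + 1) - complex_of_real x * ((t - 1) * (t + 1) ^ s) = (\<Prod>j<r + 1. t - w j)"
    and \<tau>: "\<tau> = 1 \<or> \<tau> = cis (path_angle r)"
  shows "\<And>u. u > 0 \<Longrightarrow> 1 - complex_of_real x * ((of_real u * \<tau> - 1) * (of_real u * \<tau> + 1) ^ s / (of_real u * \<tau>) ^ (r + 1))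
      = (\<Prod>j<r + 1. 1 - w j / \<tau> / of_real u)"
    and "\<And>u. u > 0 \<Longrightarrow> (\<Prod>j<r + 1. 1 - w j / \<tau> / of_real u) \<notin> \<real>\<^sub>\<le>\<^sub>0"
    and "\<And>j. j < r + 1 \<Longrightarrow> w j / \<tau> \<notin> \<real>\<^sub>\<ge>\<^sub>0"
    and "(\<Prod>j<r + 1. - (w j / \<tau>)) = complex_of_real x"
proof -
  have \<tau>0: "\<tau> \<noteq> 0" using \<tau> by auto
  have \<tau>1: "\<tau> ^ (r + 1) = 1" using \<tau> path_angle_cis_power by auto
  have w0: "(\<Prod>j<r + 1. - w j) = complex_of_real x" using w[of 0] by simp
  show eq: "1 - complex_of_real x * ((of_real u * \<tau> - 1) * (of_real u * \<tau> + 1) ^ s / (of_real u * \<tau>) ^ (r + 1))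
      = (\<Prod>j<r + 1. 1 - w j / \<tau> / of_real u)" if u: "u > 0" for u
  proof -
    define t where "t = of_real u * \<tau>"
    have t0: "t \<noteq> 0" using u \<tau>0 by (simp add: t_def)
    have "(\<Prod>j<r + 1. 1 - w j / \<tau> / of_real u) = (\<Prod>j<r + 1. (t - w j) / t)"
      using t0 by (intro prod.cong refl) (simp add: t_def field_simps)
    also have "\<dots> = (t ^ (r + 1) - complex_of_real x * ((t - 1) * (t + 1) ^ s)) / t ^ (r + 1)"
      unfolding w by (simp only: prod_dividef prod_constant card_lessThan)
    also have "\<dots> = 1 - complex_of_real x * ((t - 1) * (t + 1) ^ s / t ^ (r + 1))"
      using t0 by (simp add: diff_divide_distrib)
    finally show ?thesis by (simp add: t_def)
  qed
  show nonpos: "(\<Prod>j<r + 1. 1 - w j / \<tau> / of_real u) \<notin> \<real>\<^sub>\<le>\<^sub>0" if "u > 0" for u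
    using log_argument_not_nonpos[OF rs x that \<tau>] unfolding eq[OF that] .
  show "w j / \<tau> \<notin> \<real>\<^sub>\<ge>\<^sub>0" if j: "j < r + 1" for j
  proof
    assume "w j / \<tau> \<in> \<real>\<^sub>\<ge>\<^sub>0"
    then obtain y where y: "w j / \<tau> = of_real y" "y \<ge> 0" by (auto elim!: nonneg_Reals_cases)
    show False
    proof (cases "y = 0")
      case True
      then have "w j = 0" using y \<tau>0 by simp
      then have "(\<Prod>j<r + 1. - w j) = 0" using j by (intro prod_zero) auto
      then have "complex_of_real x = 0" using w0 by (simp only:)
      then show False using x by simp
    next
      case False
      then have "1 - w j / \<tau> / of_real y = 0" using y by simp
      then have "(\<Prod>j<r + 1. 1 - w j / \<tau> / of_real y) = 0"
        using j by (intro prod_zero[OF finite_lessThan] bexI[of _ j]) simp_all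
      then show False using nonpos[of y] y(2) False nonpos_Reals_zero_I by (metis less_eq_real_def)
    qed
  qed
  have "(\<Prod>j<r + 1. - (w j / \<tau>)) = (\<Prod>j<r + 1. - w j / \<tau>)" by simp
  also have "\<dots> = complex_of_real x / \<tau> ^ (r + 1)"
    unfolding w0[symmetric] by (simp only: prod_dividef prod_constant card_lessThan)
  finally show "(\<Prod>j<r + 1. - (w j / \<tau>)) = complex_of_real x" unfolding \<tau>1 by simp
qed

text \<open>
  The numbers \<open>Ln (- w j)\<close> and \<open>Ln (- w j / cis \<alpha>)\<close> have the same sum \<open>ln x\<close>. They differ by
  \<open>\<i> \<alpha>\<close>, and by a further \<open>- 2 \<pi> \<i>\<close> exactly when \<open>w j\<close> lies in the sector, and \<open>(r + 1) \<alpha> = 2 \<pi>\<close>.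
\<close>

lemma one_root_in_sector:
  assumes rs: "r \<ge> s + 2" and x: "0 < x" "x < x_star r s"
    and w: "\<And>t. t ^ (r + 1) - complex_of_real x * ((t - 1) * (t + 1) ^ s) = (\<Prod>j<r + 1. t - w j)"
  shows "card {j. j < r + 1 \<and> w j \<in> sector (path_angle r)} = 1"
proof -
  define \<alpha> where "\<alpha> = path_angle r"
  have \<alpha>: "0 < \<alpha>" "\<alpha> < pi" "(real r + 1) * \<alpha> = 2 * pi" using path_angle_bounds[of r] rs by (auto simp: \<alpha>_def)
  note inn = ray_factorization[OF rs x w, of "cis \<alpha>", unfolded \<alpha>_def, OF disjI2[OF refl], folded \<alpha>_def]
  have cs: "w j / cis \<alpha> = w j * cis (- \<alpha>)" for j by (simp add: divide_inverse)
  have 1: "(\<Sum>j<r + 1. Ln (- (w j / 1))) = complex_of_real (ln x)"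
    by (rule sum_Ln_minus) (use ray_factorization[OF rs x w, of 1] x in auto)
  have 2: "(\<Sum>j<r + 1. Ln (- (w j / cis \<alpha>))) = complex_of_real (ln x)"
    by (rule sum_Ln_minus) (use inn x in auto)
  have "0 = (\<Sum>j<r + 1. Ln (- w j) - Ln (- (w j / cis \<alpha>)))"
    using 1 2 by (simp add: sum_subtractf)
  also have "\<dots> = (\<Sum>j<r + 1. \<i> * \<alpha> - (if w j \<in> sector \<alpha> then 2 * pi * \<i> else 0))"
  proof (rule sum.cong[OF refl])
    fix j assume "j \<in> {..<r + 1}"
    then show "Ln (- w j) - Ln (- (w j / cis \<alpha>)) = \<i> * \<alpha> - (if w j \<in> sector \<alpha> then 2 * pi * \<i> else 0)"
      unfolding cs using ray_factorization(3)[OF rs x w, of 1 j] inn(3)[of j]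
      by (intro Ln_minus_rotate \<alpha>) (auto simp: cs)
  qed
  also have "\<dots> = of_nat (r + 1) * (\<i> * \<alpha>) - (\<Sum>j\<in>{j \<in> {..<r + 1}. w j \<in> sector \<alpha>}. 2 * pi * \<i>)"
    by (subst sum.inter_filter) (simp_all add: sum_subtractf)
  also have "of_nat (r + 1) * (\<i> * \<alpha>) = \<i> * complex_of_real ((real r + 1) * \<alpha>)" by simp
  finally have "2 * pi * \<i> * (1 - of_nat (card {j. j < r + 1 \<and> w j \<in> sector \<alpha>})) = 0"
    unfolding \<alpha>(3) by (simp add: algebra_simps)
  then have "of_nat (card {j. j < r + 1 \<and> w j \<in> sector \<alpha>}) = (1::complex)" by simp
  then show ?thesis unfolding \<alpha>_def by (metis of_nat_1_eq_iff)
qed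

lemma unique_root_in_sector:
  assumes rs: "r \<ge> s + 2" and x: "0 < x" "x < x_star r s"
  shows "\<exists>!w. w \<in> sector (path_angle r) \<and> w ^ (r + 1) = complex_of_real x * ((w - 1) * (w + 1) ^ s)"
proof -
  obtain w where w: "\<And>t. t ^ (r + 1) - complex_of_real x * ((t - 1) * (t + 1) ^ s) = (\<Prod>j<r + 1. t - w j)"
    using char_poly_roots[OF rs] by metis
  have root: "t ^ (r + 1) = complex_of_real x * ((t - 1) * (t + 1) ^ s) \<longleftrightarrow> (\<exists>j<r + 1. t = w j)" for t
  proof -
    have "t ^ (r + 1) = complex_of_real x * ((t - 1) * (t + 1) ^ s) \<longleftrightarrow> (\<Prod>j<r + 1. t - w j) = 0"
      by (simp only: w[symmetric] right_minus_eq)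
    then show ?thesis by (simp only: prod_zero_iff[OF finite_lessThan] right_minus_eq Bex_def lessThan_iff)
  qed
  obtain k where k: "{j. j < r + 1 \<and> w j \<in> sector (path_angle r)} = {k}"
    using one_root_in_sector[OF rs x w] by (meson card_1_singletonE)
  then have kk: "k < r + 1" "w k \<in> sector (path_angle r)" by auto
  show ?thesis
  proof (rule ex1I[of _ "w k"])
    show "w k \<in> sector (path_angle r) \<and> w k ^ (r + 1) = complex_of_real x * ((w k - 1) * (w k + 1) ^ s)"
      using kk root[of "w k"] by blast
    fix v assume v: "v \<in> sector (path_angle r) \<and> v ^ (r + 1) = complex_of_real x * ((v - 1) * (v + 1) ^ s)"
    then obtain j where j: "j < r + 1" "v = w j" using root[of v] by blast
    then have "j \<in> {j. j < r + 1 \<and> w j \<in> sector (path_angle r)}" using v by simp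
    then show "v = w k" unfolding k using j by simp
  qed
qed

section \<open>Evaluation of the integral along the path\<close>

lemma log_integrand_on_ray:
  assumes rs: "r \<ge> s + 2" and x: "0 < x" "x < x_star r s"
    and w: "\<And>t. t ^ (r + 1) - complex_of_real x * ((t - 1) * (t + 1) ^ s) = (\<Prod>j<r + 1. t - w j)"
    and \<tau>: "\<tau> = 1 \<or> \<tau> = cis (path_angle r)" and u: "u > 0"
  shows "log_integrand r s x (of_real u * \<tau>) = Ln (\<Prod>j<r + 1. 1 - w j / \<tau> / of_real u)"
proof -
  define g where "g t = 1 - complex_of_real x * ((t - 1) * (t + 1) ^ s / t ^ (r + 1))" for t
  have \<tau>0: "\<tau> \<noteq> 0" using \<tau> by auto
  have gt: "g (complex_of_real k * (of_real u * \<tau>)) = g (of_real (k * u) * \<tau>)" for k by (simp add: mult.assoc)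
  have "log_along_ray g (of_real u * \<tau>) = Ln (g (of_real u * \<tau>))"
  proof (rule log_along_ray_eq_Ln)
    show "continuous_on {1..} (\<lambda>k. g (complex_of_real k * (of_real u * \<tau>)))"
      unfolding g_def using u \<tau>0 by (intro continuous_intros) auto
    show "g (complex_of_real k * (of_real u * \<tau>)) \<notin> \<real>\<^sub>\<le>\<^sub>0" if "k \<ge> 1" for k
      unfolding gt unfolding g_def by (rule log_argument_not_nonpos[OF rs x _ \<tau>]) (use that u in simp)
  qed
  also have "g (of_real u * \<tau>) = (\<Prod>j<r + 1. 1 - w j / \<tau> / of_real u)"
    unfolding g_def by (rule ray_factorization(1)[OF rs x w \<tau> u])
  finally show ?thesis by (simp only: log_integrand_def g_def[abs_def])
qed

lemma vector_derivative_gamma_in: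
  assumes "t > 0"
  shows "vector_derivative (gamma_in \<alpha>) (at t) = - (cis \<alpha> / of_real (t\<^sup>2))"
proof (rule vector_derivative_at)
  have "((\<lambda>z. cis \<alpha> / z) has_field_derivative - (cis \<alpha> / of_real (t\<^sup>2))) (at (complex_of_real t))"
    using assms by (auto intro!: derivative_eq_intros simp: power2_eq_square)
  then show "(gamma_in \<alpha> has_vector_derivative - (cis \<alpha> / of_real (t\<^sup>2))) (at t)"
    unfolding gamma_in_def[abs_def] by (rule has_vector_derivative_real_field)
qed

lemma vector_derivative_gamma_out: "vector_derivative gamma_out (at t) = 1"
  unfolding gamma_out_def[abs_def]
  by (rule vector_derivative_at, rule has_vector_derivative_real_field[where f = "\<lambda>z. z"]) simp

text \<open>The incoming ray gives \<open>- cis \<alpha>\<close> times a sum over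
  \<open>w j / cis \<alpha>\<close>, so the rotation cancels and the integral is the sum of
  \<open>w j * (Ln (- w j) - Ln (- (w j / cis \<alpha>)))\<close>. The part \<i> \<alpha> disappears
  with the sum of the roots; the root in the sector leaves -2 pi \<i> v, whose real part is 2 pi Im
  v.\<close>

theorem mu_density_eq_Im_root:
  assumes rs: "r \<ge> s + 2" and x: "0 < x" "x < x_star r s"
    and v: "v \<in> sector (path_angle r)" "v ^ (r + 1) = complex_of_real x * ((v - 1) * (v + 1) ^ s)"
  shows "gamma_integrable (path_angle r) (log_integrand r s x)"
    and "mu_density r s x = Im v / (pi * x)"
proof -
  define \<alpha> where "\<alpha> = path_angle r"
  have \<alpha>: "0 < \<alpha>" "\<alpha> < pi" using path_angle_bounds[of r] rs by (auto simp: \<alpha>_def)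
  obtain w where w: "\<And>t. t ^ (r + 1) - complex_of_real x * ((t - 1) * (t + 1) ^ s) = (\<Prod>j<r + 1. t - w j)"
    and w0: "(\<Sum>j<r + 1. w j) = 0"
    using char_poly_roots[OF rs] by metis
  define G where "G \<tau> u = Ln (\<Prod>j<r + 1. 1 - w j / \<tau> / complex_of_real u)" for \<tau> u
  have t1: "(1::complex) = 1 \<or> (1::complex) = cis (path_angle r)" by simp
  have t2: "cis \<alpha> = 1 \<or> cis \<alpha> = cis (path_angle r)" by (simp add: \<alpha>_def)
  have wt0: "(\<Sum>j<r + 1. w j / \<tau>) = 0" for \<tau> using w0 by (metis sum_divide_distrib div_0)
  note ri1 = ray_integrals[of "r + 1" "\<lambda>j. w j / 1", OF ray_factorization(3)[OF rs x w t1] wt0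
      ray_factorization(2)[OF rs x w t1], folded G_def]
  note ri2 = ray_integrals[of "r + 1" "\<lambda>j. w j / cis \<alpha>", OF ray_factorization(3)[OF rs x w t2] wt0
      ray_factorization(2)[OF rs x w t2], folded G_def]
  define S1 S2 where "S1 = (\<Sum>j<r + 1. w j / 1 * Ln (- (w j / 1)))"
    and "S2 = (\<Sum>j<r + 1. w j / cis \<alpha> * Ln (- (w j / cis \<alpha>)))"
  have out: "log_integrand r s x (gamma_out u) * vector_derivative gamma_out (at u) = G 1 u" if "u > 0" for u
    using log_integrand_on_ray[OF rs x w t1 that] by (simp add: gamma_out_def vector_derivative_gamma_out G_def)
  have inn: "log_integrand r s x (gamma_in \<alpha> u) * vector_derivative (gamma_in \<alpha>) (at u) = - cis \<alpha> * (G (cis \<alpha>) (1 / u) / of_real (u\<^sup>2))"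
    if "u > 0" for u
  proof -
    have "gamma_in \<alpha> u = of_real (1 / u) * cis \<alpha>" by (simp add: gamma_in_def)
    then have "log_integrand r s x (gamma_in \<alpha> u) = G (cis \<alpha>) (1 / u)"
      using log_integrand_on_ray[OF rs x w t2, of "1 / u"] that by (simp only: G_def) simp
    then show ?thesis using that by (simp add: vector_derivative_gamma_in)
  qed
  have i1: "set_integrable lborel {0<..} (\<lambda>u. log_integrand r s x (gamma_out u) * vector_derivative gamma_out (at u))"
    using ri1(1) by (subst set_integrable_cong[OF refl refl out]) auto
  have "set_integrable lborel {0<..} (\<lambda>u. - cis \<alpha> * (G (cis \<alpha>) (1 / u) / of_real (u\<^sup>2)))"
    by (intro set_integrable_mult_right ri2(2))
  then have i2: "set_integrable lborel {0<..} (\<lambda>u. log_integrand r s x (gamma_in \<alpha> u) * vector_derivative (gamma_in \<alpha>) (at u))"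
    by (subst set_integrable_cong[OF refl refl inn]) auto
  show "gamma_integrable (path_angle r) (log_integrand r s x)"
    using i1 i2 by (simp add: gamma_integrable_def \<alpha>_def)
  have "(LINT u:{0<..}|lborel. log_integrand r s x (gamma_out u) * vector_derivative gamma_out (at u)) = S1"
  proof -
    have "(LINT u:{0<..}|lborel. log_integrand r s x (gamma_out u) * vector_derivative gamma_out (at u))
        = (LINT u:{0<..}|lborel. G 1 u)"
      by (intro set_lebesgue_integral_cong allI impI) (simp, rule out, simp)
    also have "\<dots> = S1" unfolding S1_def by (rule ri1(3))
    finally show ?thesis .
  qed
  moreover have "(LINT u:{0<..}|lborel. log_integrand r s x (gamma_in \<alpha> u) * vector_derivative (gamma_in \<alpha>) (at u)) = - cis \<alpha> * S2"
  proof -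
    have "(LINT u:{0<..}|lborel. log_integrand r s x (gamma_in \<alpha> u) * vector_derivative (gamma_in \<alpha>) (at u))
        = (LINT u:{0<..}|lborel. - cis \<alpha> * (G (cis \<alpha>) (1 / u) / of_real (u\<^sup>2)))"
      by (intro set_lebesgue_integral_cong allI impI) (simp, rule inn, simp)
    also have "\<dots> = - cis \<alpha> * (LINT u:{0<..}|lborel. G (cis \<alpha>) (1 / u) / of_real (u\<^sup>2))"
      by (rule set_integral_mult_right)
    also have "\<dots> = - cis \<alpha> * S2" unfolding S2_def by (rule arg_cong[OF ri2(4)])
    finally show ?thesis .
  qed
  ultimately have "gamma_integral \<alpha> (log_integrand r s x) = S1 - cis \<alpha> * S2"
    by (simp add: gamma_integral_def)
  also have "\<dots> = (\<Sum>j<r + 1. w j * (Ln (- w j) - Ln (- (w j / cis \<alpha>))))"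
    unfolding S1_def S2_def sum_distrib_left sum_subtractf[symmetric] by (intro sum.cong) (auto simp: algebra_simps)
  also have "\<dots> = (\<Sum>j<r + 1. w j * (\<i> * \<alpha>) - (if w j \<in> sector \<alpha> then w j * (2 * pi * \<i>) else 0))"
  proof (rule sum.cong[OF refl])
    fix j assume "j \<in> {..<r + 1}"
    then have j: "j < r + 1" by simp
    have cs: "w j / cis \<alpha> = w j * cis (- \<alpha>)" by (simp add: divide_inverse)
    have "Ln (- w j) - Ln (- (w j / cis \<alpha>)) = \<i> * \<alpha> - (if w j \<in> sector \<alpha> then 2 * pi * \<i> else 0)"
      unfolding cs using ray_factorization(3)[OF rs x w t1 j] ray_factorization(3)[OF rs x w t2 j]
      by (intro Ln_minus_rotate \<alpha>) (auto simp: cs)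
    then show "w j * (Ln (- w j) - Ln (- (w j / cis \<alpha>))) = w j * (\<i> * \<alpha>) - (if w j \<in> sector \<alpha> then w j * (2 * pi * \<i>) else 0)"
      by (simp add: right_diff_distrib)
  qed
  also have "\<dots> = (\<Sum>j<r + 1. w j) * (\<i> * \<alpha>) - (\<Sum>j\<in>{j \<in> {..<r + 1}. w j \<in> sector \<alpha>}. w j * (2 * pi * \<i>))"
    by (subst sum.inter_filter) (simp_all only: sum_subtractf sum_distrib_right finite_lessThan)
  also have "\<dots> = - (v * (2 * pi * \<i>))"
  proof -
    obtain k where k: "{j. j < r + 1 \<and> w j \<in> sector \<alpha>} = {k}"
      using one_root_in_sector[OF rs x w] unfolding \<alpha>_def by (meson card_1_singletonE)
    have "(\<Prod>j<r + 1. v - w j) = 0" by (simp only: w[symmetric] right_minus_eq v(2))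
    then obtain j where j: "j < r + 1" "v = w j"
      by (auto simp only: prod_zero_iff[OF finite_lessThan] right_minus_eq Bex_def lessThan_iff)
    then have "j = k" using k v(1) by (auto simp: \<alpha>_def)
    then have "{j \<in> {..<r + 1}. w j \<in> sector \<alpha>} = {j}" using k by auto
    then show ?thesis unfolding w0 using j by simp
  qed
  finally have gi: "gamma_integral \<alpha> (log_integrand r s x) = - (v * (2 * pi * \<i>))" .
  show "mu_density r s x = Im v / (pi * x)"
    unfolding mu_density_def gi[unfolded \<alpha>_def] using x by (simp add: power2_eq_square)
qed

section \<open>Dependence of the root on the parameter\<close>

text \<open>An inverse function theorem, applied to z itself at interior points and to a local
  coordinate at each endpoint. That values of \<open>p\<close> stay in \<open>S\<close> allows them
  to be recognised as roots in the sector.\<close>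

lemma holomorphic_local_inverse:
  assumes q: "q holomorphic_on S" "open S" "a \<in> S" "deriv q a \<noteq> 0"
  obtains p \<delta> where "\<delta> > 0" "\<And>y. y \<in> ball (q a) \<delta> \<Longrightarrow> p y \<in> S \<and> q (p y) = y" "p (q a) = a"
    "(p has_field_derivative inverse (deriv q a)) (at (q a))"
proof -
  obtain e where e: "e > 0" "ball a e \<subseteq> S" "inj_on q (ball a e)"
    using has_complex_derivative_locally_injective[OF q(1,3,2,4)] by blast
  have hol: "q holomorphic_on ball a e" using q(1) e(2) by (rule holomorphic_on_subset)
  obtain p where p: "p holomorphic_on (q ` ball a e)" "\<And>z. z \<in> ball a e \<Longrightarrow> deriv q z * deriv p (q z) = 1"
      "\<And>z. z \<in> ball a e \<Longrightarrow> p (q z) = z"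
    using holomorphic_has_inverse[OF hol open_ball e(3)] by blast
  have op: "open (q ` ball a e)" by (rule open_mapping_thm3[OF hol open_ball e(3)])
  have ina: "q a \<in> q ` ball a e" using e(1) by simp
  obtain \<delta> where \<delta>: "\<delta> > 0" "ball (q a) \<delta> \<subseteq> q ` ball a e" using op ina open_contains_ball by blast
  show thesis
  proof (rule that[OF \<delta>(1)])
    fix y assume "y \<in> ball (q a) \<delta>"
    then obtain z where z: "z \<in> ball a e" "y = q z" using \<delta>(2) by blast
    then show "p y \<in> S \<and> q (p y) = y" using p(3)[OF z(1)] e(2) by auto
  next
    show "p (q a) = a" using p(3)[of a] e(1) by simp
    have "(p has_field_derivative deriv p (q a)) (at (q a))"
      using holomorphic_derivI[OF p(1) op ina] .
    moreover have "deriv p (q a) = inverse (deriv q a)"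
      using p(2)[of a] e(1) q(4) by (simp add: field_simps)
    ultimately show "(p has_field_derivative inverse (deriv q a)) (at (q a))" by simp
  qed
qed

definition param_map :: "nat \<Rightarrow> nat \<Rightarrow> complex \<Rightarrow> complex" where
  "param_map r s w = w ^ (r + 1) / ((w - 1) * (w + 1) ^ s)"

definition sector_root :: "nat \<Rightarrow> nat \<Rightarrow> real \<Rightarrow> complex" where
  "sector_root r s x = (THE w. w \<in> sector (path_angle r) \<and> w ^ (r + 1) = complex_of_real x * ((w - 1) * (w + 1) ^ s))"

lemma param_map_eq_iff:
  assumes "w \<noteq> 1" "w \<noteq> - 1"
  shows "param_map r s w = c \<longleftrightarrow> w ^ (r + 1) = c * ((w - 1) * (w + 1) ^ s)"
proof -
  have "(w - 1) * (w + 1) ^ s \<noteq> 0" using assms by (auto simp: eq_neg_iff_add_eq_0)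
  then show ?thesis unfolding param_map_def by (rule nonzero_divide_eq_eq)
qed

lemma sector_Im: "w \<in> sector \<alpha> \<Longrightarrow> Im w > 0"
  by (simp add: sector_def)

lemma Im_pos_neq: "Im w > 0 \<Longrightarrow> w \<noteq> 0 \<and> w \<noteq> 1 \<and> w \<noteq> - 1"
  by auto

lemma Im_pos_nonzero: "Im w > 0 \<Longrightarrow> w \<noteq> 0"
  by auto

lemma open_sector: "open (sector \<alpha>)"
proof -
  have "open {w. Im w > 0}" "open {w. Im (w * cis (- \<alpha>)) < 0}"
    by (intro open_Collect_less continuous_intros)+
  moreover have "sector \<alpha> = {w. Im w > 0} \<inter> {w. Im (w * cis (- \<alpha>)) < 0}" by (auto simp: sector_def)
  ultimately show ?thesis by auto
qed

lemma sector_root: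
  assumes "r \<ge> s + 2" "0 < x" "x < x_star r s"
  shows "sector_root r s x \<in> sector (path_angle r)" "param_map r s (sector_root r s x) = of_real x"
    and "\<And>w. w \<in> sector (path_angle r) \<Longrightarrow> param_map r s w = of_real x \<Longrightarrow> sector_root r s x = w"
proof -
  note u = unique_root_in_sector[OF assms]
  have W: "sector_root r s x \<in> sector (path_angle r) \<and>
      sector_root r s x ^ (r + 1) = complex_of_real x * ((sector_root r s x - 1) * (sector_root r s x + 1) ^ s)"
    unfolding sector_root_def by (rule theI'[OF u])
  then show 1: "sector_root r s x \<in> sector (path_angle r)" by simp
  show "param_map r s (sector_root r s x) = of_real x"
    using W Im_pos_neq[OF sector_Im[OF 1]] by (subst param_map_eq_iff) auto
  fix w assume w: "w \<in> sector (path_angle r)" "param_map r s w = of_real x"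
  then have "w ^ (r + 1) = complex_of_real x * ((w - 1) * (w + 1) ^ s)"
    using Im_pos_neq[OF sector_Im[OF w(1)]] by (subst (asm) param_map_eq_iff) auto
  then show "sector_root r s x = w" using u W w(1) by blast
qed

lemma mu_density_eq_sector_root:
  assumes "r \<ge> s + 2" "0 < x" "x < x_star r s"
  shows "gamma_integrable (path_angle r) (log_integrand r s x)"
    and "mu_density r s x = Im (sector_root r s x) / (pi * x)"
proof -
  have W: "sector_root r s x \<in> sector (path_angle r) \<and>
      sector_root r s x ^ (r + 1) = complex_of_real x * ((sector_root r s x - 1) * (sector_root r s x + 1) ^ s)"
    unfolding sector_root_def by (rule theI'[OF unique_root_in_sector[OF assms]])
  show "gamma_integrable (path_angle r) (log_integrand r s x)"
    and "mu_density r s x = Im (sector_root r s x) / (pi * x)"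
    using mu_density_eq_Im_root[OF assms, of "sector_root r s x"] W by auto
qed

text \<open>The derivative of z with the factor \<open>w - w_star\<close> split off; the linear
  numerator carries the other root of the quadratic. Its value at \<open>w_star\<close> is nonzero,
  so that critical point is simple.\<close>

definition param_factor :: "nat \<Rightarrow> nat \<Rightarrow> complex \<Rightarrow> complex" where
  "param_factor r s w = param_map r s w *
     (of_real (real r - real s) * (w + of_real (w_star r s)) + of_real (real s - 1)) / (w * (w - 1) * (w + 1))"

text \<open>To be read with \<open>a = w - 1\<close>, \<open>b = w + 1\<close>,
  \<open>D = (w + 1) ^ s\<close>, \<open>N = w ^ r\<close> and \<open>R = r + 1\<close>: z times its
  logarithmic derivative against the quotient rule. Opaque letters keep powers out of the field
  arithmetic.\<close>

lemma param_map_derivative_identity: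
  fixes w a b D N R s :: complex
  assumes "w \<noteq> 0" "a \<noteq> 0" "b \<noteq> 0" "D \<noteq> 0"
  shows "w * N / (a * D) * (R * (a * b) - w * b - s * (w * a)) / (w * a * b) =
    (R * N * (a * D) - w * N * (D + a * (s * D / b))) / ((a * D) * (a * D))"
proof -
  have "w * N / (a * D) * (R * (a * b) - w * b - s * (w * a)) / (w * a * b) =
      N * (R * (a * b) - w * b - s * (w * a)) / (a * a * D * b)"
    using assms by simp
  also have "\<dots> = (N * (R * (a * b) - w * b - s * (w * a)) * D / b) / ((a * D) * (a * D))"
    using assms by simp
  also have "N * (R * (a * b) - w * b - s * (w * a)) * D / b = R * N * (a * D) - w * N * (D + a * (s * D / b))"
    using assms by (simp add: field_simps)
  finally show ?thesis .
qed

lemma param_map_has_field_derivative: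
  assumes sr: "s < r" and w: "w \<noteq> 0" "w \<noteq> 1" "w \<noteq> - 1"
  shows "(param_map r s has_field_derivative (w - of_real (w_star r s)) * param_factor r s w) (at w)"
proof -
  define ws where "ws = w_star r s"
  have w1: "w - 1 \<noteq> 0" "w + 1 \<noteq> 0" using w by (auto simp: eq_neg_iff_add_eq_0)
  define N D where "N = w ^ r" and "D = (w + 1) ^ s"
  have D0: "D \<noteq> 0" using w1 by (simp add: D_def)
  have dpow: "((\<lambda>w. (w + 1) ^ s) has_field_derivative of_nat s * D / (w + 1)) (at w)"
  proof -
    have "((\<lambda>w. w + 1) has_field_derivative 1) (at w)" by (auto intro!: derivative_eq_intros)
    from DERIV_power[OF this, of s]
    have "((\<lambda>w. (w + 1) ^ s) has_field_derivative of_nat s * (1 * (w + 1) ^ (s - Suc 0))) (at w)" .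
    moreover have "of_nat s * (1 * (w + 1) ^ (s - Suc 0)) = of_nat s * D / (w + 1)"
      using w1 by (cases s) (simp_all add: D_def)
    ultimately show ?thesis by (simp only:)
  qed
  have dnum: "((\<lambda>w. w ^ (r + 1)) has_field_derivative of_nat (r + 1) * N) (at w)"
    using DERIV_power[OF DERIV_ident, of "r + 1" w UNIV] by (simp add: N_def)
  have dden: "((\<lambda>w. (w - 1) * (w + 1) ^ s) has_field_derivative D + (w - 1) * (of_nat s * D / (w + 1))) (at w)"
  proof -
    have "((\<lambda>w. w - 1) has_field_derivative 1) (at w)" by (auto intro!: derivative_eq_intros)
    from DERIV_mult[OF this dpow] show ?thesis by (rule DERIV_cong) (simp add: D_def)
  qed
  have "((\<lambda>w. w ^ (r + 1) / ((w - 1) * (w + 1) ^ s)) has_field_derivative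
     (of_nat (r + 1) * N * ((w - 1) * (w + 1) ^ s) - w ^ (r + 1) * (D + (w - 1) * (of_nat s * D / (w + 1))))
       / (((w - 1) * (w + 1) ^ s) * ((w - 1) * (w + 1) ^ s))) (at w)"
    by (rule DERIV_divide[OF dnum dden]) (use w1 in auto)
  also have "(of_nat (r + 1) * N * ((w - 1) * (w + 1) ^ s) - w ^ (r + 1) * (D + (w - 1) * (of_nat s * D / (w + 1))))
       / (((w - 1) * (w + 1) ^ s) * ((w - 1) * (w + 1) ^ s)) = (w - of_real ws) * param_factor r s w"
  proof -
    have q: "of_real (real r - real s) * (of_real ws)\<^sup>2 + of_real (real s - 1) * of_real ws = (of_nat r + 1 :: complex)"
      using arg_cong[OF w_star_quadratic(2)[OF sr], of complex_of_real] by (simp add: ws_def)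
    have f: "(w - of_real ws) * (of_real (real r - real s) * (w + of_real ws) + of_real (real s - 1))
        = (of_nat r + 1) * ((w - 1) * (w + 1)) - w * (w + 1) - of_nat s * (w * (w - 1))"
    proof -
      have "(w - of_real ws) * (of_real (real r - real s) * (w + of_real ws) + of_real (real s - 1))
        = of_real (real r - real s) * w\<^sup>2 + of_real (real s - 1) * w
          - (of_real (real r - real s) * (of_real ws)\<^sup>2 + of_real (real s - 1) * of_real ws)"
        by (simp add: algebra_simps power2_eq_square)
      then show ?thesis unfolding q by (simp add: algebra_simps power2_eq_square)
    qed
    have "(w - of_real ws) * param_factor r s w = w * N / ((w - 1) * D) *
        ((w - of_real ws) * (of_real (real r - real s) * (w + of_real ws) + of_real (real s - 1))) / (w * (w - 1) * (w + 1))"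
      by (simp add: param_factor_def param_map_def N_def D_def ws_def)
    also have "\<dots> = (of_nat (r + 1) * N * ((w - 1) * D) - w * N * (D + (w - 1) * (of_nat s * D / (w + 1))))
       / (((w - 1) * D) * ((w - 1) * D))"
      unfolding f using param_map_derivative_identity[OF w(1) w1 D0, of N "of_nat r + 1" "of_nat s"]
      by (simp only: of_nat_add of_nat_1)
    finally show ?thesis by (simp add: N_def D_def)
  qed
  finally show ?thesis unfolding param_map_def[abs_def] ws_def .
qed

lemma param_map_holomorphic: "S \<inter> {1, - 1} = {} \<Longrightarrow> param_map r s holomorphic_on S"
  unfolding param_map_def[abs_def] by (intro holomorphic_intros) (auto dest: eq_neg_iff_add_eq_0[THEN iffD2])

text \<open>All zeros of z' are real, so z is locally invertible at the root. The local inverse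
  takes values in the open sector, and uniqueness of the root identifies it with
  \<open>sector_root\<close>.\<close>

lemma sector_root_has_vector_derivative:
  assumes rs: "r \<ge> s + 2" and x: "0 < x" "x < x_star r s"
  obtains d where "(sector_root r s has_vector_derivative d) (at x)"
    "deriv (param_map r s) (sector_root r s x) * d = 1"
proof -
  define W where "W = sector_root r s x"
  have W: "W \<in> sector (path_angle r)" "param_map r s W = of_real x" unfolding W_def by (rule sector_root(1)[OF assms], rule sector_root(2)[OF assms])
  have Wn: "W \<noteq> 0" "W \<noteq> 1" "W \<noteq> - 1" using Im_pos_neq[OF sector_Im[OF W(1)]] by auto
  have hol: "param_map r s holomorphic_on sector (path_angle r)"
    by (rule param_map_holomorphic) (auto simp: sector_def)
  have d: "deriv (param_map r s) W = (W - of_real (w_star r s)) * param_factor r s W"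
    by (rule DERIV_imp_deriv[OF param_map_has_field_derivative]) (use rs Wn in auto)
  have "Im (of_real (real r - real s) * (W + of_real (w_star r s)) + of_real (real s - 1)) > 0"
    using sector_Im[OF W(1)] rs by simp
  then have "of_real (real r - real s) * (W + of_real (w_star r s)) + of_real (real s - 1) \<noteq> 0"
    by (rule Im_pos_nonzero)
  moreover have "Im (W - of_real (w_star r s)) > 0" using sector_Im[OF W(1)] by simp
  then have "W - of_real (w_star r s) \<noteq> 0" by (rule Im_pos_nonzero)
  moreover have "W + 1 \<noteq> 0" using Wn(3) by (auto simp: eq_neg_iff_add_eq_0)
  ultimately have d0: "deriv (param_map r s) W \<noteq> 0"
    unfolding d param_factor_def W(2) using Wn x by auto
  obtain p \<delta> where p: "\<delta> > 0" "\<And>y. y \<in> ball (param_map r s W) \<delta> \<Longrightarrow> p y \<in> sector (path_angle r) \<and> param_map r s (p y) = y"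
      "p (param_map r s W) = W" "(p has_field_derivative inverse (deriv (param_map r s) W)) (at (param_map r s W))"
    using holomorphic_local_inverse[OF hol open_sector W(1) d0] by blast
  have deriv_p: "((\<lambda>y. p (of_real y)) has_vector_derivative inverse (deriv (param_map r s) W)) (at x)"
    using p(4) unfolding W(2) by (rule has_vector_derivative_real_field)
  have ev: "\<forall>\<^sub>F y in nhds x. p (of_real y) = sector_root r s y"
  proof -
    have "\<forall>\<^sub>F y in nhds x. y \<in> ball x \<delta> \<and> y \<in> {0<..<x_star r s}"
      using x p(1) by (intro eventually_conj eventually_nhds_in_open) auto
    then show ?thesis
    proof eventually_elim
      case (elim y)
      then have "complex_of_real y \<in> ball (param_map r s W) \<delta>" by (simp add: W(2) dist_real_def dist_norm flip: of_real_diff)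
      then show ?case using p(2)[of "of_real y"] sector_root(3)[OF rs, of y "p (of_real y)"] elim by auto
    qed
  qed
  have "(sector_root r s has_vector_derivative inverse (deriv (param_map r s) W)) (at x)"
  proof (subst has_vector_derivative_cong_ev[symmetric])
    show "((\<lambda>y. p (of_real y)) has_vector_derivative inverse (deriv (param_map r s) W)) (at x)" by (rule deriv_p)
    show "\<forall>\<^sub>F y in nhds x. y \<in> UNIV \<longrightarrow> p (of_real y) = sector_root r s y"
      using ev by eventually_elim simp
    show "p (of_real x) = sector_root r s x" using p(3) unfolding W(2) by (simp add: W_def)
  qed
  then show thesis using that d0 by (simp add: W_def)
qed

text \<open>With \<open>p\<close> the inverse of a local coordinate and \<open>h\<close> the value
  of that coordinate, this gives the leading term of the root at either endpoint, on the real scale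
  \<open>k\<close>.\<close>

lemma tendsto_difference_quotient_of_real:
  assumes p: "(p has_field_derivative d) (at b)" "p b = a"
    and h: "(h \<longlongrightarrow> 0) F" "\<forall>\<^sub>F x in F. h x \<noteq> 0" "((\<lambda>x. h x / of_real (k x)) \<longlongrightarrow> l) F"
  shows "((\<lambda>x. (p (b + h x) - a) / of_real (k x)) \<longlongrightarrow> d * l) F"
proof -
  have "((\<lambda>h. (p (b + h) - a) / h) \<longlongrightarrow> d) (at 0)" using p by (simp add: DERIV_def)
  moreover have "filterlim h (at 0) F" using h(1,2) by (simp add: filterlim_at)
  ultimately have "((\<lambda>x. (p (b + h x) - a) / h x) \<longlongrightarrow> d) F" by (rule filterlim_compose)
  then have "((\<lambda>x. (p (b + h x) - a) / h x * (h x / of_real (k x))) \<longlongrightarrow> d * l) F"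
    by (intro tendsto_mult h(3))
  moreover have "\<forall>\<^sub>F x in F. (p (b + h x) - a) / h x * (h x / of_real (k x)) = (p (b + h x) - a) / of_real (k x)"
    using h(2) by eventually_elim simp
  ultimately show ?thesis by (rule Lim_transform_eventually)
qed

text \<open>
  Near the origin \<open>param_map\<close> is \<open>- q\<^sup>r\<^sup>+\<^sup>1\<close> for a local coordinate \<open>q\<close>, near \<open>w_star\<close> it is
  \<open>x_star + q\<^sup>2\<close>. A preimage under \<open>q\<close> which lies in the sector is the root, by uniqueness.
\<close>

lemma sector_root_asymp_0:
  assumes rs: "r \<ge> s + 2"
  shows "((\<lambda>x. sector_root r s x / of_real (x powr (1 / (real r + 1)))) \<longlongrightarrow> cis (pi / (real r + 1))) (at_right 0)"
proof -
  \<comment> \<open>This is \<open>w\<close> divided by the root of order r + 1 of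
    \<open>(1 - w) (1 + w)^s\<close>, taken through principal logarithms on the unit disc. Hence
    \<open>q ^ (r + 1)\<close> is -z, and q has derivative 1 at 0.\<close>
  define q where "q w = w * exp (- (Ln (1 - w) + of_nat s * Ln (1 + w)) / (of_nat r + 1))" for w :: complex
  define S where "S = ball (0::complex) 1"
  have np: "1 - w \<notin> \<real>\<^sub>\<le>\<^sub>0" "1 + w \<notin> \<real>\<^sub>\<le>\<^sub>0" if "w \<in> S" for w
  proof -
    have "\<bar>Re w\<bar> < 1" using that abs_Re_le_cmod[of w] by (simp add: S_def)
    then show "1 - w \<notin> \<real>\<^sub>\<le>\<^sub>0" "1 + w \<notin> \<real>\<^sub>\<le>\<^sub>0" by (auto simp: complex_nonpos_Reals_iff)
  qed
  have r1: "(of_nat r + 1 :: complex) \<noteq> 0" by (metis of_nat_Suc of_nat_eq_0_iff Suc_not_Zero add.commute)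
  have qS: "q holomorphic_on S"
    unfolding q_def using np r1 by (intro holomorphic_intros) auto
  have "((\<lambda>w. exp (- (Ln (1 - w) + of_nat s * Ln (1 + w)) / (of_nat r + 1))) has_field_derivative
      deriv (\<lambda>w. exp (- (Ln (1 - w) + of_nat s * Ln (1 + w)) / (of_nat r + 1))) 0) (at 0)"
    by (rule holomorphic_derivI[of _ S]) (use np r1 in \<open>auto simp: S_def intro!: holomorphic_intros\<close>)
  from DERIV_mult[OF DERIV_ident this] have "(q has_field_derivative 1) (at 0)" by (simp add: q_def[abs_def])
  then have dq: "deriv q 0 = 1" by (rule DERIV_imp_deriv)
  have q0: "q 0 = 0" by (simp add: q_def)
  have qpow: "q w ^ (r + 1) = - param_map r s w" if w: "w \<in> S" for w
  proof -
    have nz: "1 - w \<noteq> 0" "1 + w \<noteq> 0" using np[OF w] nonpos_Reals_zero_I by metis+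
    have "q w ^ (r + 1) = w ^ (r + 1) * exp (of_nat (r + 1) * (- (Ln (1 - w) + of_nat s * Ln (1 + w)) / (of_nat r + 1)))"
      by (simp only: q_def power_mult_distrib exp_of_nat_mult)
    also have "of_nat (r + 1) * (- (Ln (1 - w) + of_nat s * Ln (1 + w)) / (of_nat r + 1)) = - (Ln (1 - w) + of_nat s * Ln (1 + w))"
    proof -
      have "of_nat (r + 1) = (of_nat r + 1 :: complex)" by simp
      then show ?thesis by (simp only: times_divide_eq_right nonzero_mult_div_cancel_left[OF r1])
    qed
    also have "exp (- (Ln (1 - w) + of_nat s * Ln (1 + w))) = inverse ((1 - w) * (1 + w) ^ s)"
      by (simp only: exp_minus exp_add exp_of_nat_mult exp_Ln[OF nz(1)] exp_Ln[OF nz(2)])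
    also have "w ^ (r + 1) * inverse ((1 - w) * (1 + w) ^ s) = - param_map r s w"
    proof -
      have "(1 - w) * (1 + w) ^ s = - ((w - 1) * (w + 1) ^ s)" by (simp add: algebra_simps)
      then show ?thesis by (simp add: param_map_def divide_inverse)
    qed
    finally show ?thesis .
  qed
  obtain p \<delta> where p: "\<delta> > 0" "\<And>y. y \<in> ball (q 0) \<delta> \<Longrightarrow> p y \<in> S \<and> q (p y) = y" "p (q 0) = 0"
      "(p has_field_derivative inverse (deriv q 0)) (at (q 0))"
  proof -
    have "open S" "0 \<in> S" "deriv q 0 \<noteq> 0" by (simp_all add: S_def dq)
    from holomorphic_local_inverse[OF qS this] show thesis using that by blast
  qed
  define k where "k x = x powr (1 / (real r + 1))" for x :: real
  \<comment> \<open>The root of -1 of order r + 1 on the bisector of the sector; every other one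
    points out of the sector.\<close>
  define e where "e = cis (pi / (real r + 1))"
  define h where "h x = of_real (k x) * e" for x
  have r0: "real r + 1 > 0" by linarith
  have k0: "(k \<longlongrightarrow> 0) (at_right 0)"
  proof -
    have "\<forall>\<^sub>F x in at_right 0. 0 \<le> (x::real)"
      using eventually_at_right_less[of "0::real"] by eventually_elim simp
    moreover have "0 < 1 / (real r + 1)" using r0 by simp
    ultimately have "(k \<longlongrightarrow> 0 powr (1 / (real r + 1))) (at_right 0)"
      unfolding k_def by (intro tendsto_powr'[OF tendsto_ident_at tendsto_const]) blast
    then show ?thesis by simp
  qed
  have h0: "(h \<longlongrightarrow> 0) (at_right 0)"
    using tendsto_mult[OF tendsto_of_real[OF k0, where ?'a = complex] tendsto_const[of e]] by (simp add: h_def[abs_def])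
  have pos: "\<forall>\<^sub>F x in at_right (0::real). x > 0" by (rule eventually_at_right_less)
  have kpos: "k x > 0" if "x > 0" for x using that by (simp add: k_def)
  have lim: "((\<lambda>x. (p (0 + h x) - 0) / of_real (k x)) \<longlongrightarrow> 1 * e) (at_right 0)"
  proof (rule tendsto_difference_quotient_of_real[OF _ _ h0])
    show "(p has_field_derivative 1) (at 0)" using p(4) by (simp add: q0 dq)
    show "p 0 = 0" using p(3) by (simp add: q0)
    show "\<forall>\<^sub>F x in at_right 0. h x \<noteq> 0"
      using pos by eventually_elim (use kpos in \<open>force simp: h_def e_def\<close>)
    have "\<forall>\<^sub>F x in at_right 0. e = h x / of_real (k x)"
      using pos by eventually_elim (use kpos in \<open>force simp: h_def\<close>)
    then show "((\<lambda>x. h x / of_real (k x)) \<longlongrightarrow> e) (at_right 0)"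
      by (rule Lim_transform_eventually[OF tendsto_const])
  qed
  have \<alpha>: "0 < path_angle r" "path_angle r < pi" using path_angle_bounds[of r] rs by auto
  have half: "pi / (real r + 1) = path_angle r / 2"
  proof -
    have "path_angle r = 2 * (pi / (real r + 1))" by (simp add: path_angle_def)
    then show ?thesis by linarith
  qed
  have sinh: "sin (pi / (real r + 1)) > 0" unfolding half using \<alpha> by (intro sin_gt_zero) auto
  \<comment> \<open>The limiting direction \<open>e\<close> lies in the open sector, so
    \<open>p (h x)\<close> does too for small \<open>x\<close>.\<close>
  have "((\<lambda>x. Im (p (h x) / of_real (k x))) \<longlongrightarrow> Im e) (at_right 0)"
    using tendsto_Im[OF lim] by simp
  then have ev1: "\<forall>\<^sub>F x in at_right 0. Im (p (h x) / of_real (k x)) > 0"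
    by (rule order_tendstoD(1)) (use sinh in \<open>simp add: e_def\<close>)
  have "((\<lambda>x. Im (p (h x) / of_real (k x) * cis (- path_angle r))) \<longlongrightarrow> Im (e * cis (- path_angle r))) (at_right 0)"
    by (intro tendsto_intros) (use lim in simp)
  then have ev2: "\<forall>\<^sub>F x in at_right 0. Im (p (h x) / of_real (k x) * cis (- path_angle r)) < 0"
  proof (rule order_tendstoD(2))
    have "e * cis (- path_angle r) = cis (- (pi / (real r + 1)))"
      unfolding e_def half cis_mult by simp
    then show "Im (e * cis (- path_angle r)) < 0" using sinh by simp
  qed
  have "\<forall>\<^sub>F x in at_right 0. h x \<in> ball (q 0) \<delta>"
    using order_tendstoD(2)[OF tendsto_norm[OF h0], of \<delta>] p(1) by (simp add: q0)
  moreover have "\<forall>\<^sub>F x in at_right 0. x < x_star r s"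
    using x_star_eq(2)[of s r] rs by (intro order_tendstoD(2)[OF tendsto_ident_at]) auto
  ultimately have "\<forall>\<^sub>F x in at_right 0. (p (0 + h x) - 0) / of_real (k x) = sector_root r s x / of_real (x powr (1 / (real r + 1)))"
    using ev1 ev2 pos
  proof eventually_elim
    case (elim x)
    have kx: "k x > 0" using kpos elim by simp
    have ph: "p (h x) \<in> S" "q (p (h x)) = h x" using p(2) elim by auto
    have "h x ^ (r + 1) = - of_real x"
    proof -
      have rr: "real (r + 1) = real r + 1" by simp
      have "k x ^ (r + 1) = k x powr real (r + 1)" by (rule powr_realpow[OF kx, symmetric])
      also have "\<dots> = x powr (1 / (real r + 1) * real (r + 1))" unfolding k_def by (rule powr_powr)
      also have "1 / (real r + 1) * real (r + 1) = 1" unfolding rr using r0 by simp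
      finally have "k x ^ (r + 1) = x" using elim by simp
      moreover have "e ^ (r + 1) = - 1"
      proof -
        have "e ^ (r + 1) = cis (real (r + 1) * (pi / (real r + 1)))" unfolding e_def by (rule Complex.DeMoivre)
        also have "real (r + 1) * (pi / (real r + 1)) = pi" unfolding rr using r0 by simp
        finally show ?thesis by simp
      qed
      ultimately show ?thesis by (simp only: h_def power_mult_distrib of_real_power[symmetric]) simp
    qed
    then have "param_map r s (p (h x)) = of_real x" using qpow[OF ph(1)] ph(2) by simp
    moreover have "p (h x) \<in> sector (path_angle r)"
    proof -
      have "Im (p (h x)) > 0" using elim kx by (simp add: zero_less_divide_iff)
      moreover have "p (h x) / of_real (k x) * cis (- path_angle r) = p (h x) * cis (- path_angle r) / of_real (k x)" by simp
      then have "Im (p (h x) * cis (- path_angle r)) < 0" using elim kx by (simp only: Im_divide_of_real divide_less_0_iff) auto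
      ultimately show ?thesis by (simp add: sector_def)
    qed
    ultimately have "sector_root r s x = p (h x)" using sector_root(3)[OF rs] elim by blast
    then show ?case by (simp add: k_def)
  qed
  from Lim_transform_eventually[OF lim this] show ?thesis by (simp add: e_def)
qed
lemma param_map_of_real:
  assumes "t > 0" "t \<noteq> 1"
  shows "param_map r s (of_real t) = of_real (t ^ (r + 1) / ((t - 1) * (t + 1) ^ s))"
  by (simp add: param_map_def)

text \<open>The critical point is simple, so z - x_star is the square of a coordinate
  \<open>(w - w_star) * g w\<close>. The number \<open>g w_star\<close> is real because z has a
  minimum there along the real axis. For x below \<open>x_star\<close> the coordinate is imaginary,
  of modulus \<open>sqrt (x_star - x)\<close>, and the root leaves \<open>w_star\<close>
  vertically.\<close>

lemma sector_root_asymp_x_star: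
  assumes rs: "r \<ge> s + 2"
  obtains c where "c > 0" "((\<lambda>x. Im (sector_root r s x) / sqrt (x_star r s - x)) \<longlongrightarrow> c) (at_left (x_star r s))"
    "(sector_root r s \<longlongrightarrow> of_real (w_star r s)) (at_left (x_star r s))"
proof -
  have sr: "s < r" using rs by simp
  define a xs where "a = w_star r s" and "xs = x_star r s"
  have a: "a > 1" using w_star_gt_1[OF sr] by (simp add: a_def)
  have xs: "xs > 0" using x_star_eq(2)[OF sr] by (simp add: xs_def)
  define S where "S = {w. Re w > 1}"
  have S: "open S" "of_real a \<in> S" using a by (auto simp: S_def open_halfspace_Re_gt)
  have Sn: "w \<noteq> 0 \<and> w \<noteq> 1 \<and> w \<noteq> - 1" if "w \<in> S" for w using that by (auto simp: S_def)
  have hol: "param_map r s holomorphic_on S" using Sn by (intro param_map_holomorphic) blast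
  have za: "param_map r s (of_real a) = of_real xs"
    using a param_map_of_real[of a r s] x_star_eq(1)[OF sr] by (simp add: a_def xs_def)
  have dz: "deriv (param_map r s) w = (w - of_real a) * param_factor r s w" if "w \<in> S" for w
    unfolding a_def by (rule DERIV_imp_deriv[OF param_map_has_field_derivative[OF sr]]) (use Sn[OF that] in auto)
  have d1: "deriv (param_map r s) (of_real a) = 0" using dz[OF S(2)] by simp
  have holf: "param_factor r s holomorphic_on S"
    unfolding param_factor_def[abs_def]
    by (intro holomorphic_intros hol) (use Sn in \<open>auto dest: eq_neg_iff_add_eq_0[THEN iffD2]\<close>)
  have fa: "param_factor r s (of_real a) \<noteq> 0"
  proof -
    have "of_real (real r - real s) * (of_real a + of_real (w_star r s)) + of_real (real s - 1)
       = complex_of_real ((real r - real s) * (a + a) + (real s - 1))" by (simp add: a_def)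
    moreover have "(real r - real s) * (a + a) > 1 * 2" using a sr by (intro mult_less_le_imp_less mult_le_less_imp_less) auto
    then have "(real r - real s) * (a + a) + (real s - 1) > 0" by simp
    ultimately have "of_real (real r - real s) * (of_real a + of_real (w_star r s)) + of_real (real s - 1) \<noteq> (0::complex)"
      by (metis less_irrefl of_real_eq_0_iff)
    moreover have "complex_of_real a \<noteq> 0" "complex_of_real a - 1 \<noteq> 0" using a by auto
    moreover have "complex_of_real a + 1 \<noteq> 0"
    proof -
      have "complex_of_real a + 1 = of_real (a + 1)" by simp
      then show ?thesis using a by (metis of_real_eq_0_iff add_pos_pos less_trans zero_less_one less_irrefl)
    qed
    ultimately show ?thesis unfolding param_factor_def za using xs by simp
  qed
  have d2: "deriv (deriv (param_map r s)) (of_real a) \<noteq> 0"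
  proof -
    have "(param_factor r s has_field_derivative deriv (param_factor r s) (of_real a)) (at (of_real a))"
      by (rule holomorphic_derivI[OF holf S])
    moreover have "((\<lambda>w. w - complex_of_real a) has_field_derivative 1) (at (of_real a))"
      by (auto intro!: derivative_eq_intros)
    ultimately have "((\<lambda>w. (w - of_real a) * param_factor r s w) has_field_derivative
        1 * param_factor r s (of_real a) + deriv (param_factor r s) (of_real a) * (of_real a - of_real a)) (at (of_real a))"
      by (intro DERIV_mult)
    then have "(deriv (param_map r s) has_field_derivative
        1 * param_factor r s (of_real a) + deriv (param_factor r s) (of_real a) * (of_real a - of_real a)) (at (of_real a))"
      by (rule has_field_derivative_transform_within_open[OF _ S]) (simp add: dz)
    then show ?thesis using fa by (simp add: DERIV_imp_deriv)
  qed
  obtain g e where ge: "0 < e" "g holomorphic_on ball (of_real a) e"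
    "\<And>w. w \<in> ball (of_real a) e \<Longrightarrow> param_map r s w - param_map r s (of_real a) = ((w - of_real a) * g w) ^ 2"
    "\<And>w. w \<in> ball (of_real a) e \<Longrightarrow> g w \<noteq> 0"
  proof (rule holomorphic_factor_order_of_zero_strong[OF hol S, of 2])
    show "(deriv ^^ 2) (param_map r s) (of_real a) \<noteq> 0" using d2 by (simp add: numeral_2_eq_2)
    show "(deriv ^^ i) (param_map r s) (of_real a) = 0" if "0 < i" "i < 2" for i
    proof -
      have "i = 1" using that by simp
      then show ?thesis using d1 by simp
    qed
  qed auto
  define \<gamma> where "\<gamma> = g (of_real a)"
  have \<gamma>0: "\<gamma> \<noteq> 0" using ge(1,4) by (simp add: \<gamma>_def)
  \<comment> \<open>Just to the right of \<open>a\<close> the quotient of z - xs by (t - a)^2 is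
    nonnegative by minimality of \<open>xs\<close>, and its limit is the square of
    \<open>\<gamma>\<close>.\<close>
  have g2: "\<gamma>\<^sup>2 \<in> \<real>\<^sub>\<ge>\<^sub>0"
  proof (rule Lim_in_closed_set)
    show "closed (\<real>\<^sub>\<ge>\<^sub>0 :: complex set)" by (rule closed_nonneg_Reals_complex)
    have cont: "isCont g (of_real a)"
      using ge(1) by (intro continuous_on_interior[OF holomorphic_on_imp_continuous_on[OF ge(2)]]) simp
    have "((\<lambda>t. complex_of_real t) \<longlongrightarrow> of_real a) (at_right a)" by (intro tendsto_intros)
    from isCont_tendsto_compose[OF cont this] have "((\<lambda>t. g (of_real t)) \<longlongrightarrow> \<gamma>) (at_right a)" by (simp only: \<gamma>_def)
    then show "((\<lambda>t. (g (of_real t))\<^sup>2) \<longlongrightarrow> \<gamma>\<^sup>2) (at_right a)" by (rule tendsto_power)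
    have "\<forall>\<^sub>F t in at_right a. t < a + e" using ge(1) by (intro order_tendstoD(2)[OF tendsto_ident_at]) auto
    then show "\<forall>\<^sub>F t in at_right a. (g (of_real t))\<^sup>2 \<in> \<real>\<^sub>\<ge>\<^sub>0"
      using eventually_at_right_less[of a]
    proof eventually_elim
      case (elim t)
      define z where "z = t ^ (r + 1) / ((t - 1) * (t + 1) ^ s)"
      have t: "t > 1" using elim a by linarith
      have "xs * ((t - 1) * (t + 1) ^ s) \<le> t ^ (r + 1)" unfolding xs_def using t by (intro x_star_minimal sr) simp
      then have "xs \<le> z" unfolding z_def using t by (subst pos_le_divide_eq) auto
      have "complex_of_real t \<in> ball (of_real a) e" using elim by (simp add: dist_norm flip: of_real_diff)
      from ge(3)[OF this] have "complex_of_real (z - xs) = (of_real (t - a))\<^sup>2 * (g (of_real t))\<^sup>2"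
        unfolding za using t param_map_of_real[of t r s] by (simp add: z_def power_mult_distrib)
      then have "(g (of_real t))\<^sup>2 = of_real ((z - xs) / (t - a)\<^sup>2)" using elim by (simp add: field_simps)
      then show ?case using \<open>xs \<le> z\<close> by (simp del: of_real_divide)
    qed
  qed simp
  obtain \<sigma> where \<sigma>: "\<gamma> = of_real \<sigma>" "\<sigma> \<noteq> 0"
  proof -
    obtain y where y: "\<gamma>\<^sup>2 = of_real y" "y \<ge> 0" using g2 by (auto elim!: nonneg_Reals_cases)
    then have "\<gamma>\<^sup>2 = (of_real (sqrt y))\<^sup>2" by (simp flip: of_real_power)
    then have "\<gamma> = of_real (sqrt y) \<or> \<gamma> = of_real (- sqrt y)" by (simp add: power2_eq_iff)
    then show thesis using that \<gamma>0 by (metis of_real_0)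
  qed
  define q where "q w = (w - of_real a) * g w" for w
  have qhol: "q holomorphic_on ball (of_real a) e"
    unfolding q_def by (intro holomorphic_intros ge(2))
  have "(g has_field_derivative deriv g (of_real a)) (at (of_real a))"
    by (rule holomorphic_derivI[OF ge(2)]) (use ge(1) in auto)
  moreover have "((\<lambda>w. w - complex_of_real a) has_field_derivative 1) (at (of_real a))"
    by (auto intro!: derivative_eq_intros)
  ultimately have "(q has_field_derivative 1 * g (of_real a) + deriv g (of_real a) * (of_real a - of_real a)) (at (of_real a))"
    unfolding q_def by (intro DERIV_mult)
  then have dq: "deriv q (of_real a) = \<gamma>" by (simp add: DERIV_imp_deriv \<gamma>_def)
  have qa: "q (of_real a) = 0" by (simp add: q_def)
  obtain p \<delta> where p: "\<delta> > 0" "\<And>y. y \<in> ball (q (of_real a)) \<delta> \<Longrightarrow> p y \<in> ball (of_real a) e \<and> q (p y) = y"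
      "p (q (of_real a)) = of_real a" "(p has_field_derivative inverse (deriv q (of_real a))) (at (q (of_real a)))"
  proof -
    have "open (ball (complex_of_real a) e)" "complex_of_real a \<in> ball (of_real a) e" "deriv q (of_real a) \<noteq> 0"
      using ge(1) \<gamma>0 by (simp_all add: dq)
    from holomorphic_local_inverse[OF qhol this] show thesis using that by blast
  qed
  define k where "k x = sqrt (xs - x)" for x
  \<comment> \<open>The sign of \<open>\<sigma>\<close> selects the square root whose preimage lies
    in the upper half-plane.\<close>
  define h where "h x = \<i> * of_real (sgn \<sigma> * k x)" for x
  have k0: "(k \<longlongrightarrow> 0) (at_left xs)"
    unfolding k_def by (auto intro!: tendsto_eq_intros)
  have h0: "(h \<longlongrightarrow> 0) (at_left xs)"
    unfolding h_def using k0 by (auto intro!: tendsto_eq_intros)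
  have pos: "\<forall>\<^sub>F x in at_left xs. x < xs" by (simp add: eventually_at_filter)
  have kpos: "k x > 0" if "x < xs" for x using that by (simp add: k_def)
  have hx: "h x \<noteq> 0" if "x < xs" for x
    using kpos[OF that] \<sigma>(2) by (simp add: h_def sgn_if)
  have hk: "\<i> * of_real (sgn \<sigma>) = h x / of_real (k x)" if "x < xs" for x
    using kpos[OF that] by (simp add: h_def)
  have lim: "((\<lambda>x. (p (0 + h x) - of_real a) / of_real (k x)) \<longlongrightarrow> inverse \<gamma> * (\<i> * of_real (sgn \<sigma>))) (at_left xs)"
  proof (rule tendsto_difference_quotient_of_real[OF _ _ h0])
    show "(p has_field_derivative inverse \<gamma>) (at 0)" using p(4) by (simp add: qa dq)
    show "p 0 = of_real a" using p(3) by (simp add: qa)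
    show "\<forall>\<^sub>F x in at_left xs. h x \<noteq> 0"
      using pos by eventually_elim (rule hx)
    have "\<forall>\<^sub>F x in at_left xs. \<i> * of_real (sgn \<sigma>) = h x / of_real (k x)"
      using pos by eventually_elim (rule hk)
    then show "((\<lambda>x. h x / of_real (k x)) \<longlongrightarrow> \<i> * of_real (sgn \<sigma>)) (at_left xs)"
      by (rule Lim_transform_eventually[OF tendsto_const])
  qed
  define c where "c = 1 / \<bar>\<sigma>\<bar>"
  have c: "c > 0" using \<sigma> by (simp add: c_def)
  have icc: "inverse \<gamma> * (\<i> * of_real (sgn \<sigma>)) = \<i> * of_real c"
    using \<sigma> by (simp add: c_def sgn_if field_simps)
  have lim': "((\<lambda>x. (p (h x) - of_real a) / of_real (k x)) \<longlongrightarrow> \<i> * of_real c) (at_left xs)"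
    using lim by (simp only: icc add_0)
  have limI: "((\<lambda>x. Im ((p (h x) - of_real a) / of_real (k x))) \<longlongrightarrow> c) (at_left xs)"
    using tendsto_Im[OF lim'] by simp
  have limp: "((\<lambda>x. p (h x)) \<longlongrightarrow> of_real a) (at_left xs)"
  proof -
    have l: "((\<lambda>x. (p (h x) - of_real a) / of_real (k x) * of_real (k x) + of_real a) \<longlongrightarrow> \<i> * of_real c * of_real 0 + of_real a) (at_left xs)"
      by (intro tendsto_intros lim' k0)
    have "\<forall>\<^sub>F x in at_left xs. (p (h x) - of_real a) / of_real (k x) * of_real (k x) + of_real a = p (h x)"
      using pos
    proof eventually_elim
      case (elim x)
      then show ?case using kpos[of x] by simp
    qed
    from Lim_transform_eventually[OF l this] show ?thesis by simp
  qed
  have \<alpha>: "0 < path_angle r" "path_angle r < pi" using path_angle_bounds[of r] rs by auto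
  have ev1: "\<forall>\<^sub>F x in at_left xs. Im ((p (h x) - of_real a) / of_real (k x)) > 0"
    by (rule order_tendstoD(1)[OF limI c])
  have "((\<lambda>x. Im (p (h x) * cis (- path_angle r))) \<longlongrightarrow> Im (of_real a * cis (- path_angle r))) (at_left xs)"
    by (intro tendsto_intros limp)
  then have ev2: "\<forall>\<^sub>F x in at_left xs. Im (p (h x) * cis (- path_angle r)) < 0"
  proof (rule order_tendstoD(2))
    have "sin (path_angle r) > 0" using \<alpha> by (rule sin_gt_zero)
    then show "Im (of_real a * cis (- path_angle r)) < 0" using a by simp
  qed
  have "\<forall>\<^sub>F x in at_left xs. h x \<in> ball (q (of_real a)) \<delta>"
    using order_tendstoD(2)[OF tendsto_norm[OF h0], of \<delta>] p(1) by (simp add: qa)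
  moreover have "\<forall>\<^sub>F x in at_left xs. x > 0"
    using xs by (intro order_tendstoD(1)[OF tendsto_ident_at]) auto
  ultimately have ev: "\<forall>\<^sub>F x in at_left xs. p (h x) = sector_root r s x"
    using ev1 ev2 pos
  proof eventually_elim
    case (elim x)
    have kx: "k x > 0" using kpos elim by simp
    have ph: "p (h x) \<in> ball (of_real a) e" "q (p (h x)) = h x" using p(2) elim by auto
    have "(h x)\<^sup>2 = of_real (x - xs)"
    proof -
      have "(sgn \<sigma> * k x)\<^sup>2 = xs - x" using elim \<sigma> by (simp add: power_mult_distrib k_def sgn_if)
      then have "(complex_of_real (sgn \<sigma> * k x))\<^sup>2 = of_real (xs - x)" by (simp only: of_real_power[symmetric])
      then show ?thesis by (simp add: h_def power_mult_distrib del: of_real_mult)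
    qed
    then have "param_map r s (p (h x)) = of_real x"
      using ge(3)[OF ph(1)] ph(2) unfolding za by (simp add: q_def)
    moreover have "p (h x) \<in> sector (path_angle r)"
    proof -
      have "Im (p (h x)) > 0" using elim kx by (simp add: zero_less_divide_iff)
      then show ?thesis using elim by (simp add: sector_def)
    qed
    ultimately show ?case using sector_root(3)[OF rs, of x "p (h x)"] elim by (simp add: xs_def)
  qed
  show thesis
  proof (rule that[OF c])
    show "(sector_root r s \<longlongrightarrow> of_real (w_star r s)) (at_left (x_star r s))"
      using Lim_transform_eventually[OF limp ev] by (simp add: a_def xs_def)
    have "\<forall>\<^sub>F x in at_left xs. Im ((p (h x) - of_real a) / of_real (k x)) = Im (sector_root r s x) / sqrt (x_star r s - x)"
      using ev by eventually_elim (simp add: k_def xs_def)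
    from Lim_transform_eventually[OF limI this]
    show "((\<lambda>x. Im (sector_root r s x) / sqrt (x_star r s - x)) \<longlongrightarrow> c) (at_left (x_star r s))"
      by (simp add: xs_def)
  qed
qed

section \<open>Moments of the density\<close>

text \<open>Division by \<open>w - a\<close> is repeated, with the singularity removed each time.
  Real coefficients and a remainder that is real on the real axis are what lets an imaginary part
  isolate the residue.\<close>

lemma real_on_reals_taylor_remainder:
  fixes f :: "complex \<Rightarrow> complex" and a :: real
  assumes f: "f holomorphic_on S" "\<And>t. of_real t \<in> S \<Longrightarrow> f (of_real t) \<in> \<real>"
    and S: "open S" "of_real a \<in> S"
  shows "\<exists>c E. (\<forall>j. c j \<in> \<real>) \<and> E holomorphic_on S \<and> (\<forall>t. of_real t \<in> S \<longrightarrow> E (of_real t) \<in> \<real>) \<and>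
    (\<forall>w\<in>S. f w = (\<Sum>j<k. c j * (w - of_real a) ^ j) + (w - of_real a) ^ k * E w)"
proof (induction k)
  case 0
  then show ?case using f by (intro exI[of _ "\<lambda>_. 0"] exI[of _ f]) auto
next
  case (Suc k)
  then obtain c E where c: "\<forall>j. c j \<in> \<real>" and E: "E holomorphic_on S" "\<And>t. of_real t \<in> S \<Longrightarrow> E (of_real t) \<in> \<real>"
    and eq: "\<And>w. w \<in> S \<Longrightarrow> f w = (\<Sum>j<k. c j * (w - of_real a) ^ j) + (w - of_real a) ^ k * E w"
    by blast
  define E' where "E' z = (if z = of_real a then deriv E (of_real a) else (E z - E (of_real a)) / (z - of_real a))" for z
  have E': "E' holomorphic_on S"
    unfolding E'_def[abs_def] by (rule pole_lemma_open[OF E(1) S(1)])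
  have Ea: "E (of_real a) \<in> \<real>" using E(2) S(2) .
  have off: "E' (of_real t) \<in> \<real>" if "of_real t \<in> S" "t \<noteq> a" for t
    using that Ea E(2)[OF that(1)] by (auto simp: E'_def intro!: Reals_divide Reals_diff Reals_of_real)
  \<comment> \<open>At \<open>a\<close> the quotient is real as a limit of real difference
    quotients.\<close>
  have "E' (of_real a) \<in> \<real>"
  proof (rule Lim_in_closed_set)
    show "closed (\<real> :: complex set)" by (rule closed_complex_Reals)
    have c: "isCont E' (of_real a)"
      using S by (intro continuous_on_interior[OF holomorphic_on_imp_continuous_on[OF E']]) (simp add: interior_open)
    have t: "((\<lambda>t. complex_of_real t) \<longlongrightarrow> of_real a) (at_right a)" by (intro tendsto_intros)
    show "((\<lambda>t. E' (of_real t)) \<longlongrightarrow> E' (of_real a)) (at_right a)"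
      by (rule isCont_tendsto_compose[OF c t])
    have "\<forall>\<^sub>F t in at_right a. complex_of_real t \<in> S" using topological_tendstoD[OF t S] .
    then show "\<forall>\<^sub>F t in at_right a. E' (of_real t) \<in> \<real>"
      using eventually_at_right_less[of a] by eventually_elim (rule off, auto)
  qed simp
  then have E'r: "E' (of_real t) \<in> \<real>" if "of_real t \<in> S" for t
    using off[OF that] by (cases "t = a") auto
  have "f w = (\<Sum>j<Suc k. (c(k := E (of_real a))) j * (w - of_real a) ^ j) + (w - of_real a) ^ Suc k * E' w" if w: "w \<in> S" for w
  proof -
    have "E w = E (of_real a) + (w - of_real a) * E' w" by (simp add: E'_def)
    then have "(w - of_real a) ^ k * E w = (w - of_real a) ^ k * (E (of_real a) + (w - of_real a) * E' w)" by (rule arg_cong)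
    also have "\<dots> = E (of_real a) * (w - of_real a) ^ k + (w - of_real a) ^ Suc k * E' w"
      by (simp add: distrib_left mult_ac)
    finally have e: "(w - of_real a) ^ k * E w = E (of_real a) * (w - of_real a) ^ k + (w - of_real a) ^ Suc k * E' w" .
    show ?thesis unfolding eq[OF w] e by simp
  qed
  then show ?case using c Ea E' E'r
    by (intro exI[of _ "c(k := E (of_real a))"] exI[of _ E']) auto
qed

text \<open>Connects the analytic side with the formal one: the Taylor coefficients below order
  \<open>k\<close> are those of the formal series, as it comes out of Lagrange inversion.\<close>

lemma has_fps_expansion_taylor_coeff:
  assumes F: "(\<lambda>v. f (a + v)) has_fps_expansion F" and S: "open S" "a \<in> S"
    and E: "E holomorphic_on S" and eq: "\<And>w. w \<in> S \<Longrightarrow> f w = (\<Sum>j<k. c j * (w - a) ^ j) + (w - a) ^ k * E w"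
    and j: "j < k"
  shows "fps_nth F j = c j"
proof -
  obtain e where e: "e > 0" "ball a e \<subseteq> S" using S open_contains_ball by blast
  have "(\<lambda>v. E (a + v)) holomorphic_on ball 0 e"
    by (rule holomorphic_on_compose_gen[of "\<lambda>v. a + v" _ E S, unfolded o_def])
       (use E e in \<open>auto intro!: holomorphic_intros simp: dist_norm\<close>)
  then have "(\<lambda>v. E (a + v)) has_fps_expansion fps_expansion (\<lambda>v. E (a + v)) 0"
    by (rule has_fps_expansion_fps_expansion[rotated 2]) (use e in auto)
  then have "(\<lambda>v. (\<Sum>j<k. c j * v ^ j) + v ^ k * E (a + v)) has_fps_expansion
      (\<Sum>j<k. fps_const (c j) * fps_X ^ j) + fps_X ^ k * fps_expansion (\<lambda>v. E (a + v)) 0"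
    by (intro fps_expansion_intros)
  moreover have "\<forall>\<^sub>F v in nhds 0. (\<Sum>j<k. c j * v ^ j) + v ^ k * E (a + v) = f (a + v)"
  proof -
    have "\<forall>\<^sub>F v in nhds 0. v \<in> ball (0::complex) e" using e by (intro eventually_nhds_in_open) auto
    then show ?thesis
    proof eventually_elim
      case (elim v)
      then have "a + v \<in> S" using e by (auto simp: dist_norm)
      from eq[OF this] show ?case by simp
    qed
  qed
  ultimately have "(\<lambda>v. f (a + v)) has_fps_expansion
      (\<Sum>j<k. fps_const (c j) * fps_X ^ j) + fps_X ^ k * fps_expansion (\<lambda>v. E (a + v)) 0"
    by (simp add: has_fps_expansion_cong)
  then have "F = (\<Sum>j<k. fps_const (c j) * fps_X ^ j) + fps_X ^ k * fps_expansion (\<lambda>v. E (a + v)) 0"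
    by (rule fps_expansion_unique_complex[OF F])
  then have "fps_nth F j = (\<Sum>i<k. if i = j then c i else 0)"
    using j by (simp add: fps_sum_nth fps_X_power_mult_nth fps_X_power_nth if_distrib cong: if_cong)
  then show ?thesis using j by simp
qed

text \<open>A primitive of \<open>(w - 1)^(-m)\<close> for \<open>m > 0\<close>. The factor -\<i>
  turns the cut of the logarithm into the vertical half-line below 1, which meets the closed upper
  half-plane only at 1. At \<open>m = 0\<close> truncated subtraction and division by zero give the
  constant 0.\<close>

definition power_primitive :: "nat \<Rightarrow> complex \<Rightarrow> complex" where
  "power_primitive m w = (if m = 1 then Ln (- \<i> * (w - 1)) else - 1 / (of_nat (m - 1) * (w - 1) ^ (m - 1)))"

lemma power_primitive_deriv:
  assumes "Im w > 0" "m > 0"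
  shows "(power_primitive m has_field_derivative 1 / (w - 1) ^ m) (at w)"
proof (cases "m = 1")
  case True
  have "- \<i> * (w - 1) \<notin> \<real>\<^sub>\<le>\<^sub>0" using assms by (auto simp: complex_nonpos_Reals_iff)
  moreover have "w - 1 \<noteq> 0" using assms by auto
  ultimately have "((\<lambda>w. Ln (- \<i> * (w - 1))) has_field_derivative 1 / (w - 1)) (at w)"
    by (auto intro!: derivative_eq_intros simp: field_simps)
  then show ?thesis using True by (simp add: power_primitive_def[abs_def])
next
  case False
  then obtain n where m: "m = Suc (Suc n)" using assms(2) by (metis One_nat_def Suc_pred not0_implies_Suc neq0_conv)
  have w: "w - 1 \<noteq> 0" using assms by auto
  have d1: "((\<lambda>w. w - 1) has_field_derivative 1) (at w)" by (auto intro!: derivative_eq_intros)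
  have n0: "(of_nat (Suc n) :: complex) \<noteq> 0" by (rule of_nat_neq_0)
  have d: "((\<lambda>w. (w - 1) ^ Suc n) has_field_derivative of_nat (Suc n) * (w - 1) ^ n) (at w)"
    using DERIV_power[OF d1, of "Suc n"] by simp
  have "((\<lambda>w. inverse ((w - 1) ^ Suc n)) has_field_derivative
      - (inverse ((w - 1) ^ Suc n) * (of_nat (Suc n) * (w - 1) ^ n) * inverse ((w - 1) ^ Suc n))) (at w)"
    by (rule DERIV_inverse'[OF d]) (use w in simp)
  from DERIV_cmult[OF this, of "- 1 / of_nat (Suc n)"]
  have "((\<lambda>w. - 1 / of_nat (Suc n) * inverse ((w - 1) ^ Suc n)) has_field_derivative
      - 1 / of_nat (Suc n) * (- (inverse ((w - 1) ^ Suc n) * (of_nat (Suc n) * (w - 1) ^ n) * inverse ((w - 1) ^ Suc n)))) (at w)" .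
  moreover have "- 1 / of_nat (Suc n) * (- (inverse ((w - 1) ^ Suc n) * (of_nat (Suc n) * (w - 1) ^ n) * inverse ((w - 1) ^ Suc n))) = 1 / (w - 1) ^ m"
  proof -
    have "- 1 / of_nat (Suc n) * (- (inverse ((w - 1) ^ Suc n) * (of_nat (Suc n) * (w - 1) ^ n) * inverse ((w - 1) ^ Suc n)))
        = (of_nat (Suc n) / of_nat (Suc n)) * ((w - 1) ^ n * inverse ((w - 1) ^ Suc n) * inverse ((w - 1) ^ Suc n))" by simp
    also have "\<dots> = (w - 1) ^ n * inverse ((w - 1) ^ Suc n) * inverse ((w - 1) ^ Suc n)" by (simp only: divide_self[OF n0] mult_1)
    also have "\<dots> = 1 / (w - 1) ^ m"
    proof -
      have "v ^ n * inverse (v ^ Suc n) * inverse (v ^ Suc n) = 1 / v ^ Suc (Suc n)" if "v \<noteq> 0" for v :: complex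
        using that by (simp add: field_simps)
      from this[OF w] show ?thesis by (simp only: m)
    qed
    finally show ?thesis .
  qed
  moreover have "power_primitive m = (\<lambda>w. - 1 / of_nat (Suc n) * inverse ((w - 1) ^ Suc n))"
    by (rule ext) (simp only: power_primitive_def m, simp add: field_simps del: of_nat_Suc power_Suc)
  ultimately show ?thesis by simp
qed

lemma power_primitive_isCont:
  assumes "t \<noteq> (1::real)"
  shows "isCont (power_primitive m) (of_real t)"
proof -
  have "complex_of_real t - 1 \<noteq> 0" using assms by auto
  moreover have "- \<i> * (complex_of_real t - 1) \<notin> \<real>\<^sub>\<le>\<^sub>0" using assms by (auto simp: complex_nonpos_Reals_iff)
  ultimately show ?thesis
    unfolding power_primitive_def[abs_def] by (cases "m = 1"; cases "m = 0") (auto intro!: continuous_intros)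
qed

lemma Ln_rotated_of_real:
  assumes "t > 1"
  shows "Ln (- \<i> * (of_real t - 1)) = of_real (ln (t - 1)) - \<i> * of_real (pi / 2)"
proof -
  have "Ln (- \<i> * (of_real t - 1)) = Ln (of_real (t - 1) * (- \<i>))" by (simp add: mult.commute)
  also have "\<dots> = of_real (ln (t - 1)) + Ln (- \<i>)"
    using Ln_times_of_real[of "t - 1" "- \<i>"] Ln_of_real[of "t - 1"] assms by simp
  finally show ?thesis by simp
qed

text \<open>At real points only the logarithm can be nonreal: \<open>- \<i> * (w - 1)\<close> is
  \<i> at 0 and a negative multiple of \<i> beyond 1. The difference pi is half a turn around
  1.\<close>

lemma Im_power_primitive:
  shows "Im (power_primitive m 0) = (if m = 1 then pi / 2 else 0)"
    and "t > 1 \<Longrightarrow> Im (power_primitive m (of_real t)) = (if m = 1 then - pi / 2 else 0)"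
proof -
  have "Im (- 1 / (of_nat (m - 1) * (0 - 1) ^ (m - 1))) = 0"
  proof -
    have "- 1 / (of_nat (m - 1) * (0 - 1) ^ (m - 1)) = complex_of_real (- 1 / (real (m - 1) * (- 1) ^ (m - 1)))" by simp
    then show ?thesis by (metis Im_complex_of_real)
  qed
  then show "Im (power_primitive m 0) = (if m = 1 then pi / 2 else 0)"
    by (simp add: power_primitive_def)
  assume t: "t > 1"
  have "- 1 / (of_nat (m - 1) * (of_real t - 1) ^ (m - 1)) = complex_of_real (- 1 / (real (m - 1) * (t - 1) ^ (m - 1)))" by simp
  then have a: "Im (- 1 / (of_nat (m - 1) * (of_real t - 1) ^ (m - 1))) = 0" by (metis Im_complex_of_real)
  have "Im (Ln (- \<i> * (of_real t - 1))) = - pi / 2" unfolding Ln_rotated_of_real[OF t] by simp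
  then show "Im (power_primitive m (of_real t)) = (if m = 1 then - pi / 2 else 0)"
    using a by (simp add: power_primitive_def)
qed

text \<open>
  The rotated logarithm in \<open>power_primitive\<close> is continuous at both endpoints of the path of
  roots, so the jump of its imaginary part by \<open>\<pi>\<close> picks out the residue of the integrand at \<open>1\<close>.
\<close>

lemma param_map_power_primitive:
  assumes k: "k > 0" and a: "a > 1"
  obtains Q c where
    "\<And>w. Im w > 0 \<Longrightarrow> (Q has_field_derivative param_map r s w ^ k) (at w)"
    "isCont Q 0" "isCont Q (of_real a)"
    "Im (Q 0) - Im (Q (of_real a)) = pi * c"
    "fps_nth (((1 + fps_X) ^ (r + 1) * inverse (2 + fps_X) ^ s) ^ k) (k - 1) = complex_of_real c"
proof -
  \<comment> \<open>The plane slit from -infinity to -1. It is starlike, contains 1 and both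
    endpoints 0 and \<open>a\<close>, and leaves out the pole at -1.\<close>
  define S where "S = - complex_of_real ` {.. -1}"
  have S: "open S" "of_real 1 \<in> S" by (auto simp: S_def closed_slot_left intro: open_Compl)
  have Sn: "w + 1 \<noteq> 0" if "w \<in> S" for w
  proof
    assume "w + 1 = 0"
    then have "w = complex_of_real (-1)" by (simp add: eq_neg_iff_add_eq_0)
    then show False using that unfolding S_def by blast
  qed
  \<comment> \<open>The k-th power of z with its pole at 1 cancelled by
    \<open>(w - 1) ^ k\<close>.\<close>
  define N where "N w = (w ^ (r + 1) * inverse (w + 1) ^ s) ^ k" for w :: complex
  have N: "N holomorphic_on S" unfolding N_def[abs_def] using Sn by (intro holomorphic_intros) auto
  have Nr: "N (of_real t) \<in> \<real>" for t unfolding N_def by (intro Reals_power Reals_mult Reals_inverse Reals_add Reals_of_real Reals_1)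
  obtain c E where c: "\<forall>j. c j \<in> \<real>" and E: "E holomorphic_on S" "\<And>t. of_real t \<in> S \<Longrightarrow> E (of_real t) \<in> \<real>"
    and eq: "\<And>w. w \<in> S \<Longrightarrow> N w = (\<Sum>j<k. c j * (w - of_real 1) ^ j) + (w - of_real 1) ^ k * E w"
    using real_on_reals_taylor_remainder[OF N Nr S, of k] by blast
  have cr: "c j = of_real (Re (c j))" for j using c by (simp add: complex_is_Real_iff complex_eq_iff)
  have "\<exists>QE. \<forall>w\<in>S. (QE has_field_derivative E w) (at w)"
  proof (rule holomorphic_starlike_primitive[where k = "{}"])
    show "continuous_on S E" by (rule holomorphic_on_imp_continuous_on[OF E(1)])
    show "starlike S" unfolding S_def by (rule starlike_slotted_complex_plane_left)
    show "E field_differentiable at x" if "x \<in> S - {}" for x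
      using that by (intro holomorphic_on_imp_differentiable_at[OF E(1) S(1)]) auto
  qed (use S in auto)
  then obtain QE where QE: "\<And>w. w \<in> S \<Longrightarrow> (QE has_field_derivative E w) (at w)" by blast
  have memS: "complex_of_real t \<in> S \<longleftrightarrow> t > -1" for t
  proof -
    have "complex_of_real t \<in> complex_of_real ` {.. -1} \<longleftrightarrow> t \<in> {.. -1}" by (auto simp: image_iff)
    then show ?thesis by (auto simp: S_def)
  qed
  \<comment> \<open>\<open>E\<close> is real on the real axis, so the imaginary part of its
    primitive is constant from 0 to \<open>a\<close>: the remainder adds nothing to the
    jump.\<close>
  have ImQE: "Im (QE (of_real a)) = Im (QE (of_real 0))"
  proof -
    have d: "((\<lambda>t. Im (QE (of_real t))) has_real_derivative 0) (at t)" if "t > -1" for t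
    proof -
      have "((\<lambda>t. QE (of_real t)) has_vector_derivative E (of_real t)) (at t)"
        by (rule has_vector_derivative_real_field[OF QE]) (use that memS in simp)
      then have "((\<lambda>t. Im (QE (of_real t))) has_vector_derivative Im (E (of_real t))) (at t)"
        by (rule bounded_linear.has_vector_derivative[OF bounded_linear_Im])
      moreover have "Im (E (of_real t)) = 0" using E(2)[of t] memS that by (simp add: complex_is_Real_iff)
      ultimately show ?thesis by (simp add: has_real_derivative_iff_has_vector_derivative)
    qed
    show ?thesis
    proof (rule DERIV_isconst_end[of 0 a "\<lambda>t. Im (QE (of_real t))"])
      show "0 < a" using a by simp
      show "continuous_on {0..a} (\<lambda>t. Im (QE (of_real t)))"
        by (intro continuous_at_imp_continuous_on ballI DERIV_isCont[OF d]) simp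
      show "((\<lambda>t. Im (QE (of_real t))) has_real_derivative 0) (at t)" if "0 < t" "t < a" for t
        using that by (intro d) simp
    qed
  qed
  define Q where "Q w = (\<Sum>j<k. c j * power_primitive (k - j) w) + QE w" for w
  show thesis
  proof (rule that[of Q "Re (c (k - 1))"])
    fix w :: complex assume w: "Im w > 0"
    have wS: "w \<in> S" using w by (auto simp: S_def)
    have w1: "w - 1 \<noteq> 0" using w by auto
    have "(Q has_field_derivative (\<Sum>j<k. c j * (1 / (w - 1) ^ (k - j))) + E w) (at w)"
      unfolding Q_def[abs_def] using w
      by (intro DERIV_add DERIV_sum DERIV_cmult power_primitive_deriv QE wS) auto
    moreover have "(\<Sum>j<k. c j * (1 / (w - 1) ^ (k - j))) + E w = param_map r s w ^ k"
    proof -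
      have "param_map r s w ^ k = N w / (w - 1) ^ k"
        by (simp add: param_map_def N_def divide_inverse power_mult_distrib power_inverse mult_ac)
      also have "\<dots> = (\<Sum>j<k. c j * (w - 1) ^ j / (w - 1) ^ k) + E w"
        unfolding eq[OF wS] using w1 by (simp add: add_divide_distrib sum_divide_distrib)
      also have "(\<Sum>j<k. c j * (w - 1) ^ j / (w - 1) ^ k) = (\<Sum>j<k. c j * (1 / (w - 1) ^ (k - j)))"
      proof (rule sum.cong[OF refl])
        fix j assume "j \<in> {..<k}"
        then have "(w - 1) ^ k = (w - 1) ^ j * (w - 1) ^ (k - j)" by (simp flip: power_add)
        then show "c j * (w - 1) ^ j / (w - 1) ^ k = c j * (1 / (w - 1) ^ (k - j))" using w1 by simp
      qed
      finally show ?thesis by simp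
    qed
    ultimately show "(Q has_field_derivative param_map r s w ^ k) (at w)" by simp
  next
    have cont: "isCont Q (of_real t)" if "t \<noteq> 1" "t > -1" for t
    proof -
      have pp: "(power_primitive m \<longlongrightarrow> power_primitive m (of_real t)) (at (of_real t))" for m
        using power_primitive_isCont[OF that(1)] unfolding isCont_def .
      have "isCont QE (of_real t)" using DERIV_isCont[OF QE] memS that(2) by blast
      then have qe: "(QE \<longlongrightarrow> QE (of_real t)) (at (of_real t))" unfolding isCont_def .
      show ?thesis
        unfolding isCont_def Q_def[abs_def] by (intro tendsto_add tendsto_sum tendsto_mult tendsto_const pp qe)
    qed
    show "isCont Q 0" using cont[of 0] by simp
    show "isCont Q (of_real a)" using cont[of a] a by simp
    have ImQ: "Im (Q w) = (\<Sum>j<k. Re (c j) * Im (power_primitive (k - j) w)) + Im (QE w)" for w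
    proof -
      have "Im (c j * z) = Re (c j) * Im z" for j z by (subst cr) simp
      then show ?thesis by (simp only: Q_def plus_complex.simps Im_sum)
    qed
    \<comment> \<open>Only \<open>j = k - 1\<close> has exponent \<open>k - j = 1\<close> and hence
      a logarithm, so exactly the residue survives.\<close>
    have "(\<Sum>j<k. Re (c j) * Im (power_primitive (k - j) 0)) = (\<Sum>j<k. if j = k - 1 then Re (c j) * (pi / 2) else 0)"
      by (intro sum.cong) (auto simp: Im_power_primitive(1))
    also have "\<dots> = Re (c (k - 1)) * (pi / 2)" using k by simp
    finally have i0: "(\<Sum>j<k. Re (c j) * Im (power_primitive (k - j) 0)) = Re (c (k - 1)) * (pi / 2)" .
    have "(\<Sum>j<k. Re (c j) * Im (power_primitive (k - j) (of_real a))) = (\<Sum>j<k. if j = k - 1 then Re (c j) * (- pi / 2) else 0)"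
      by (intro sum.cong) (auto simp: Im_power_primitive(2)[OF a])
    also have "\<dots> = Re (c (k - 1)) * (- pi / 2)" using k by simp
    finally have i1: "(\<Sum>j<k. Re (c j) * Im (power_primitive (k - j) (of_real a))) = Re (c (k - 1)) * (- pi / 2)" .
    show "Im (Q 0) - Im (Q (of_real a)) = pi * Re (c (k - 1))"
      unfolding ImQ i0 i1 using ImQE by simp
    have "(\<lambda>v. ((1 + v) ^ (r + 1) * inverse (2 + v) ^ s) ^ k) has_fps_expansion
        (((1 + fps_X) ^ (r + 1) * inverse (2 + fps_X) ^ s) ^ k :: complex fps)"
      by (intro fps_expansion_intros) auto
    then have "(\<lambda>v. N (1 + v)) has_fps_expansion (((1 + fps_X) ^ (r + 1) * inverse (2 + fps_X) ^ s) ^ k)"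
      by (simp add: N_def add.commute add.left_commute)
    then have "(\<lambda>v. N (of_real 1 + v)) has_fps_expansion (((1 + fps_X) ^ (r + 1) * inverse (2 + fps_X) ^ s) ^ k)" by simp
    from has_fps_expansion_taylor_coeff[OF this S E(1) eq, of "k - 1"]
    show "fps_nth (((1 + fps_X) ^ (r + 1) * inverse (2 + fps_X) ^ s) ^ k) (k - 1) = complex_of_real (Re (c (k - 1)))"
      using k cr by simp
  qed
qed

text \<open>A branch of log z on the upper half-plane, needed for the total mass. The last term
  undoes the rotation inside \<open>Ln (- \<i> * (w - 1))\<close>, so that the branch is real beyond
  1.\<close>

definition log_param :: "nat \<Rightarrow> nat \<Rightarrow> complex \<Rightarrow> complex" where
  "log_param r s w = of_nat (r + 1) * Ln w - Ln (- \<i> * (w - 1)) - of_nat s * Ln (w + 1) - \<i> * of_real (pi / 2)"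

definition log_param_primitive :: "nat \<Rightarrow> nat \<Rightarrow> complex \<Rightarrow> complex" where
  "log_param_primitive r s w = of_nat (r + 1) * (w * Ln w - w) - ((w - 1) * Ln (- \<i> * (w - 1)) - (w - 1))
     - of_nat s * ((w + 1) * Ln (w + 1) - (w + 1)) - \<i> * of_real (pi / 2) * w"

lemma log_param_domain:
  assumes "Im w > 0 \<or> (Im w = 0 \<and> Re w > 1)"
  shows "w \<notin> \<real>\<^sub>\<le>\<^sub>0" "- \<i> * (w - 1) \<notin> \<real>\<^sub>\<le>\<^sub>0" "w + 1 \<notin> \<real>\<^sub>\<le>\<^sub>0"
  using assms by (auto simp: complex_nonpos_Reals_iff)

lemma exp_log_param:
  assumes "Im w > 0 \<or> (Im w = 0 \<and> Re w > 1)"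
  shows "exp (log_param r s w) = param_map r s w"
proof -
  have nz: "w \<noteq> 0" "- \<i> * (w - 1) \<noteq> 0" "w + 1 \<noteq> 0"
    using log_param_domain[OF assms] nonpos_Reals_zero_I by metis+
  have "exp (log_param r s w) = w ^ (r + 1) / (- \<i> * (w - 1)) / (w + 1) ^ s / exp (\<i> * of_real (pi / 2))"
    unfolding log_param_def by (simp only: exp_diff exp_of_nat_mult exp_Ln[OF nz(1)] exp_Ln[OF nz(2)] exp_Ln[OF nz(3)])
  also have "exp (\<i> * of_real (pi / 2)) = \<i>" by (simp only: cis_conv_exp[symmetric] cis_pi_half)
  also have "w ^ (r + 1) / (- \<i> * (w - 1)) / (w + 1) ^ s / \<i> = w ^ (r + 1) / ((- \<i> * \<i>) * ((w - 1) * (w + 1) ^ s))"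
    by (simp only: divide_divide_eq_left mult_ac)
  finally show ?thesis by (simp add: param_map_def)
qed

lemma log_param_isCont:
  assumes "Im w > 0 \<or> (Im w = 0 \<and> Re w > 1)"
  shows "isCont (log_param r s) w"
  unfolding log_param_def[abs_def] using log_param_domain[OF assms] by (intro continuous_intros)

lemma log_param_primitive_isCont:
  assumes "Im w > 0 \<or> (Im w = 0 \<and> Re w > 1)"
  shows "isCont (log_param_primitive r s) w"
  unfolding log_param_primitive_def[abs_def] using log_param_domain[OF assms] by (intro continuous_intros)

lemma log_param_primitive_deriv:
  assumes "Im w > 0"
  shows "(log_param_primitive r s has_field_derivative log_param r s w) (at w)"
proof -
  have dom: "w \<notin> \<real>\<^sub>\<le>\<^sub>0" "- \<i> * (w - 1) \<notin> \<real>\<^sub>\<le>\<^sub>0" "w + 1 \<notin> \<real>\<^sub>\<le>\<^sub>0" using log_param_domain assms by auto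
  have "w + 1 \<noteq> 0" using dom(3) nonpos_Reals_zero_I by metis
  then have nz: "w \<noteq> 0" "w - 1 \<noteq> 0" "w + 1 \<noteq> 0" using assms by auto
  have d1: "((\<lambda>w. w * Ln w - w) has_field_derivative Ln w) (at w)"
    using dom nz by (auto intro!: derivative_eq_intros)
  have d3: "((\<lambda>w. (w + 1) * Ln (w + 1) - (w + 1)) has_field_derivative Ln (w + 1)) (at w)"
    using dom nz by (auto intro!: derivative_eq_intros)
  have "((\<lambda>w. - \<i> * (w - 1)) has_field_derivative - \<i>) (at w)" by (auto intro!: derivative_eq_intros)
  from DERIV_chain2[OF has_field_derivative_Ln[OF dom(2)] this]
  have dl: "((\<lambda>w. Ln (- \<i> * (w - 1))) has_field_derivative inverse (- \<i> * (w - 1)) * - \<i>) (at w)" .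
  have "((\<lambda>w. w - 1) has_field_derivative 1) (at w)" by (auto intro!: derivative_eq_intros)
  from DERIV_diff[OF DERIV_mult[OF this dl] this]
  have d2: "((\<lambda>w. (w - 1) * Ln (- \<i> * (w - 1)) - (w - 1)) has_field_derivative Ln (- \<i> * (w - 1))) (at w)"
    by (rule DERIV_cong) (use nz in \<open>simp add: field_simps\<close>)
  have d4: "((\<lambda>w. \<i> * of_real (pi / 2) * w) has_field_derivative \<i> * of_real (pi / 2)) (at w)"
    by (rule DERIV_cong[OF DERIV_cmult[OF DERIV_ident]]) simp
  show ?thesis
    unfolding log_param_primitive_def[abs_def] log_param_def
    by (intro DERIV_diff DERIV_cmult d1 d2 d3 d4)
qed

lemma tendsto_mult_Ln_0: "((\<lambda>w::complex. w * Ln w) \<longlongrightarrow> 0) (at 0)"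
proof (rule Lim_null_comparison)
  have "((\<lambda>y::real. y * (\<bar>ln y\<bar> + pi)) \<longlongrightarrow> 0) (at_right 0)" by real_asymp
  moreover have "filterlim (norm :: complex \<Rightarrow> real) (at_right 0) (at 0)"
    by (auto simp: filterlim_at eventually_at_filter intro!: tendsto_eq_intros)
  ultimately show "((\<lambda>w::complex. norm w * (\<bar>ln (norm w)\<bar> + pi)) \<longlongrightarrow> 0) (at 0)"
    by (rule filterlim_compose)
  have "norm (w * Ln w) \<le> norm w * (\<bar>ln (norm w)\<bar> + pi)" if "w \<noteq> 0" for w :: complex
  proof -
    have "norm (Ln w) \<le> \<bar>Re (Ln w)\<bar> + \<bar>Im (Ln w)\<bar>" by (rule cmod_le)
    also have "\<dots> \<le> \<bar>ln (norm w)\<bar> + pi"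
      using mpi_less_Im_Ln[OF that] Im_Ln_le_pi[OF that] that by (auto simp: abs_le_iff)
    finally show ?thesis by (simp add: norm_mult mult_left_mono)
  qed
  then show "\<forall>\<^sub>F w in at 0. norm (w * Ln w) \<le> norm w * (\<bar>ln (norm w)\<bar> + pi)"
    by (auto simp: eventually_at_filter)
qed

text \<open>The nonreal terms are \<open>(a - 1) * \<i> * pi / 2\<close>, from the rotated
  logarithm, and \<open>- \<i> * pi / 2 * a\<close>.\<close>

lemma Im_log_param_primitive_w_star:
  assumes "a > 1"
  shows "Im (log_param_primitive r s (of_real a)) = - pi / 2"
proof -
  have l1: "Ln (of_real a) = of_real (ln a)" using assms by (simp add: Ln_of_real)
  have l2: "Ln (of_real a + 1) = of_real (ln (a + 1))" using assms Ln_of_real[of "a + 1"] by simp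
  note l3 = Ln_rotated_of_real[OF assms]
  show ?thesis unfolding log_param_primitive_def l1 l2 l3 by (simp add: field_simps)
qed

lemma log_param_of_real:
  assumes a: "a > 1"
  shows "log_param r s (of_real a) = of_real (ln (a ^ (r + 1) / ((a - 1) * (a + 1) ^ s)))"
proof -
  have l1: "Ln (of_real a) = of_real (ln a)" using assms by (simp add: Ln_of_real)
  have l2: "Ln (of_real a + 1) = of_real (ln (a + 1))" using assms Ln_of_real[of "a + 1"] by simp
  note l3 = Ln_rotated_of_real[OF assms]
  have "log_param r s (of_real a) = of_real (real (r + 1) * ln a - ln (a - 1) - real s * ln (a + 1))"
    unfolding log_param_def l1 l2 l3 by simp
  also have "real (r + 1) * ln a - ln (a - 1) - real s * ln (a + 1) = ln (a ^ (r + 1) / ((a - 1) * (a + 1) ^ s))"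
    using a by (simp add: ln_div ln_mult ln_realpow del: power_Suc of_nat_Suc)
  finally show ?thesis .
qed

lemma sector_root_isCont:
  assumes "r \<ge> s + 2" "0 < x" "x < x_star r s"
  shows "isCont (sector_root r s) x"
  using sector_root_has_vector_derivative[OF assms] has_vector_derivative_continuous by metis

text \<open>The difference of both sides has exponential 1, so it is constant on the interval. At
  the right endpoint the root tends to \<open>w_star > 1\<close>, where the branch is real, and the
  constant is 0.\<close>

lemma log_param_sector_root:
  assumes rs: "r \<ge> s + 2" and x: "0 < x" "x < x_star r s"
  shows "log_param r s (sector_root r s x) = of_real (ln x)"
proof -
  have sr: "s < r" using rs by simp
  define xs where "xs = x_star r s"
  define D where "D y = log_param r s (sector_root r s y) - of_real (ln y)" for y
  have Im: "Im (sector_root r s y) > 0" if "0 < y" "y < xs" for y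
    using sector_Im sector_root(1)[OF rs] that by (auto simp: xs_def)
  have "D constant_on {0<..<xs}"
  proof (rule exp_eq_1_imp_constant_on)
    have "isCont D y" if y: "0 < y" "y < xs" for y
    proof -
      have "isCont (\<lambda>y. log_param r s (sector_root r s y)) y"
        using Im[OF y] y by (intro isCont_o2[OF sector_root_isCont[OF rs]] log_param_isCont) (auto simp: xs_def)
      then show ?thesis unfolding D_def[abs_def] using y by (intro continuous_intros) auto
    qed
    then show "continuous_on {0<..<xs} D" by (intro continuous_at_imp_continuous_on) auto
    show "exp (D y) = 1" if "y \<in> {0<..<xs}" for y
      using that Im[of y] sector_root(2)[OF rs, of y] by (simp add: D_def exp_diff exp_log_param exp_of_real xs_def)
  qed simp
  then obtain c where c: "\<And>y. 0 < y \<Longrightarrow> y < xs \<Longrightarrow> D y = c" by (auto simp: constant_on_def)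
  define a where "a = w_star r s"
  have a: "a > 1" using w_star_gt_1[OF sr] by (simp add: a_def)
  have xs0: "xs > 0" using x_star_eq(2)[OF sr] by (simp add: xs_def)
  have W: "(sector_root r s \<longlongrightarrow> of_real a) (at_left xs)"
    using sector_root_asymp_x_star[OF rs] by (metis a_def xs_def)
  have xs_eq: "xs = a ^ (r + 1) / ((a - 1) * (a + 1) ^ s)" by (simp only: xs_def a_def x_star_eq(1)[OF sr])
  have "isCont (log_param r s) (of_real a)" by (rule log_param_isCont) (use a in simp)
  from isCont_tendsto_compose[OF this W]
  have "(D \<longlongrightarrow> log_param r s (of_real a) - of_real (ln xs)) (at_left xs)"
    unfolding D_def[abs_def] using xs0 by (intro tendsto_intros) auto
  also have "log_param r s (of_real a) - of_real (ln xs) = 0"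
    unfolding log_param_of_real[OF a] xs_eq by (rule diff_self)
  finally have lim: "(D \<longlongrightarrow> 0) (at_left xs)" .
  have "\<forall>\<^sub>F y in at_left xs. y > 0" using xs0 by (intro order_tendstoD(1)[OF tendsto_ident_at]) auto
  moreover have "\<forall>\<^sub>F y in at_left xs. y < xs" by (simp add: eventually_at_filter)
  ultimately have "\<forall>\<^sub>F y in at_left xs. D y = c" by eventually_elim (rule c)
  from tendsto_unique[OF trivial_limit_at_left_real tendsto_eventually[OF this] lim]
  have "D x = 0" using c x by (simp add: xs_def)
  then show ?thesis by (simp add: D_def)
qed

text \<open>The root is of order \<open>x powr (1 / (r + 1))\<close>, which absorbs the
  logarithm.\<close>

lemma sector_root_tendsto_0:
  assumes rs: "r \<ge> s + 2"
  shows "(sector_root r s \<longlongrightarrow> 0) (at_right 0)"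
    and "((\<lambda>x. of_real (ln x) * sector_root r s x) \<longlongrightarrow> 0) (at_right 0)"
proof -
  define c where "c = 1 / (real r + 1)"
  have c: "c > 0" by (simp add: c_def add_nonneg_pos)
  have l1: "((\<lambda>x::real. x powr c) \<longlongrightarrow> 0) (at_right 0)" using c by real_asymp
  have l2: "((\<lambda>x::real. ln x * x powr c) \<longlongrightarrow> 0) (at_right 0)" using c by real_asymp
  have W: "((\<lambda>x. sector_root r s x / of_real (x powr c)) \<longlongrightarrow> cis (pi / (real r + 1))) (at_right 0)"
    unfolding c_def by (rule sector_root_asymp_0[OF rs])
  have pos: "\<forall>\<^sub>F x in at_right (0::real). x > 0" by (rule eventually_at_right_less)
  have "((\<lambda>x. sector_root r s x / of_real (x powr c) * of_real (x powr c)) \<longlongrightarrow> cis (pi / (real r + 1)) * of_real 0) (at_right 0)"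
    by (intro tendsto_mult W tendsto_of_real l1)
  moreover have "\<forall>\<^sub>F x in at_right 0. sector_root r s x / of_real (x powr c) * of_real (x powr c) = sector_root r s x"
    using pos by eventually_elim simp
  ultimately have "(sector_root r s \<longlongrightarrow> cis (pi / (real r + 1)) * of_real 0) (at_right 0)" by (rule Lim_transform_eventually)
  then show "(sector_root r s \<longlongrightarrow> 0) (at_right 0)" by simp
  have "((\<lambda>x. sector_root r s x / of_real (x powr c) * of_real (ln x * x powr c)) \<longlongrightarrow> cis (pi / (real r + 1)) * of_real 0) (at_right 0)"
    by (intro tendsto_mult W tendsto_of_real l2)
  moreover have "\<forall>\<^sub>F x in at_right 0. sector_root r s x / of_real (x powr c) * of_real (ln x * x powr c) = of_real (ln x) * sector_root r s x"
    using pos by eventually_elim simp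
  ultimately have "((\<lambda>x. of_real (ln x) * sector_root r s x) \<longlongrightarrow> cis (pi / (real r + 1)) * of_real 0) (at_right 0)"
    by (rule Lim_transform_eventually)
  then show "((\<lambda>x. of_real (ln x) * sector_root r s x) \<longlongrightarrow> 0) (at_right 0)" by simp
qed

text \<open>Shared by all moments, with \<open>b = 1\<close> for the mass and \<open>b = k\<close>
  otherwise; writing \<open>x ^ k / x\<close> admits \<open>k = 0\<close>. As the integrand is
  nonnegative, limits of the primitive at both ends also give integrability, despite the singularity
  at 0.\<close>

lemma sector_root_integral:
  fixes G :: "real \<Rightarrow> complex"
  assumes rs: "r \<ge> s + 2" and b: "b > 0"
    and G: "\<And>x. 0 < x \<Longrightarrow> x < x_star r s \<Longrightarrow> (G has_vector_derivative of_real (b * x ^ k / x) * sector_root r s x) (at x)"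
    and G0: "((\<lambda>x. Im (G x)) \<longlongrightarrow> A) (at_right 0)" and G1: "((\<lambda>x. Im (G x)) \<longlongrightarrow> B) (at_left (x_star r s))"
  shows "set_integrable lborel {0<..<x_star r s} (\<lambda>x. x ^ k * (Im (sector_root r s x) / (pi * x)))"
    and "(LINT x:{0<..<x_star r s}|lborel. x ^ k * (Im (sector_root r s x) / (pi * x))) = (B - A) / (pi * b)"
proof -
  define xs where "xs = x_star r s"
  have xs: "xs > 0" using x_star_eq(2)[of s r] rs by (simp add: xs_def)
  define F where "F x = Im (G x) / (pi * b)" for x
  define f where "f x = x ^ k * (Im (sector_root r s x) / (pi * x))" for x
  have ei: "einterval 0 (ereal xs) = {0<..<xs}" by (auto simp: einterval_def)
  have lt: "(0::ereal) < ereal xs" using xs by simp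
  have d: "DERIV F x :> f x" if "0 < ereal x" "ereal x < ereal xs" for x
  proof -
    have x: "0 < x" "x < x_star r s" using that by (auto simp: xs_def)
    have "((\<lambda>x. Im (G x)) has_vector_derivative Im (of_real (b * x ^ k / x) * sector_root r s x)) (at x)"
      by (rule bounded_linear.has_vector_derivative[OF bounded_linear_Im G[OF x]])
    then have "((\<lambda>x. Im (G x)) has_real_derivative (b * x ^ k / x) * Im (sector_root r s x)) (at x)"
      by (simp add: has_real_derivative_iff_has_vector_derivative)
    from DERIV_cdivide[OF this, of "pi * b"] have "(F has_real_derivative (b * x ^ k / x) * Im (sector_root r s x) / (pi * b)) (at x)"
      by (simp only: F_def[abs_def])
    moreover have "(b * x ^ k / x) * Im (sector_root r s x) / (pi * b) = f x" using b by (simp add: f_def)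
    ultimately show ?thesis by simp
  qed
  have cont: "isCont f x" if "0 < ereal x" "ereal x < ereal xs" for x
  proof -
    have x: "0 < x" "x < x_star r s" using that by (auto simp: xs_def)
    have "isCont (\<lambda>x. Im (sector_root r s x)) x"
      using sector_root_isCont[OF rs x] unfolding isCont_def by (rule tendsto_Im)
    then show ?thesis unfolding f_def[abs_def] using x by (intro continuous_intros) auto
  qed
  have nn: "AE x in lborel. 0 < ereal x \<longrightarrow> ereal x < ereal xs \<longrightarrow> 0 \<le> f x"
  proof (intro AE_I2 impI)
    fix x assume "0 < ereal x" "ereal x < ereal xs"
    then have x: "0 < x" "x < x_star r s" by (auto simp: xs_def)
    have "Im (sector_root r s x) > 0" using sector_Im[OF sector_root(1)[OF rs x]] .
    then show "0 \<le> f x" using x by (simp add: f_def)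
  qed
  have l0: "((F \<circ> real_of_ereal) \<longlongrightarrow> A / (pi * b)) (at_right 0)"
    unfolding zero_ereal_def ereal_tendsto_simps F_def[abs_def] by (intro tendsto_intros G0) (use b in auto)
  have l1: "((F \<circ> real_of_ereal) \<longlongrightarrow> B / (pi * b)) (at_left (ereal xs))"
    unfolding ereal_tendsto_simps F_def[abs_def] by (intro tendsto_intros G1[folded xs_def]) (use b in auto)
  have fin1: "set_integrable lborel (einterval 0 (ereal xs)) f"
    by (rule interval_integral_FTC_nonneg(1)[OF lt d cont nn l0 l1])
  have fin2: "(LBINT x=0..ereal xs. f x) = B / (pi * b) - A / (pi * b)"
    by (rule interval_integral_FTC_nonneg(2)[OF lt d cont nn l0 l1])
  show "set_integrable lborel {0<..<x_star r s} (\<lambda>x. x ^ k * (Im (sector_root r s x) / (pi * x)))"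
    using fin1 unfolding ei unfolding f_def[abs_def] xs_def .
  have "(LBINT x=0..ereal xs. f x) = (LINT x:{0<..<xs}|lborel. f x)"
    using lt by (simp add: interval_lebesgue_integral_def ei)
  then show "(LINT x:{0<..<x_star r s}|lborel. x ^ k * (Im (sector_root r s x) / (pi * x))) = (B - A) / (pi * b)"
    using fin2 by (simp add: f_def xs_def diff_divide_distrib)
qed

text \<open>Since log z equals ln x along the curve of roots W, integration by parts gives W / x the
  primitive \<open>ln x * W\<close> minus the primitive of log z at W. Its imaginary part runs from
  -pi/2 to pi/2.\<close>

lemma sector_root_mass:
  assumes rs: "r \<ge> s + 2"
  shows "set_integrable lborel {0<..<x_star r s} (\<lambda>x. x ^ 0 * (Im (sector_root r s x) / (pi * x)))"
    and "(LINT x:{0<..<x_star r s}|lborel. x ^ 0 * (Im (sector_root r s x) / (pi * x))) = 1"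
proof -
  have sr: "s < r" using rs by simp
  define xs a where "xs = x_star r s" and "a = w_star r s"
  have a: "a > 1" using w_star_gt_1[OF sr] by (simp add: a_def)
  have xs0: "xs > 0" using x_star_eq(2)[OF sr] by (simp add: xs_def)
  define G where "G x = of_real (ln x) * sector_root r s x - log_param_primitive r s (sector_root r s x)" for x
  have G: "(G has_vector_derivative of_real (1 * x ^ 0 / x) * sector_root r s x) (at x)"
    if x: "0 < x" "x < x_star r s" for x
  proof -
    obtain d where d: "(sector_root r s has_vector_derivative d) (at x)"
      using sector_root_has_vector_derivative[OF rs x] by metis
    have Im: "Im (sector_root r s x) > 0" using sector_Im[OF sector_root(1)[OF rs x]] .
    have p: "((log_param_primitive r s \<circ> sector_root r s) has_vector_derivative d * log_param r s (sector_root r s x)) (at x)"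
      by (rule field_vector_diff_chain_at[OF d log_param_primitive_deriv[OF Im]])
    have "((\<lambda>x. complex_of_real (ln x)) has_vector_derivative of_real (1 / x)) (at x)"
      by (rule has_vector_derivative_of_real) (use x in \<open>auto intro!: derivative_eq_intros simp flip: has_real_derivative_iff_has_vector_derivative\<close>)
    from has_vector_derivative_diff[OF has_vector_derivative_mult[OF this d] p]
    have "(G has_vector_derivative (of_real (ln x) * d + of_real (1 / x) * sector_root r s x) - d * log_param r s (sector_root r s x)) (at x)"
      by (simp only: G_def[abs_def] o_def)
    moreover have "(of_real (ln x) * d + of_real (1 / x) * sector_root r s x) - d * log_param r s (sector_root r s x) = of_real (1 * x ^ 0 / x) * sector_root r s x"
      unfolding log_param_sector_root[OF rs x] by simp
    ultimately show ?thesis by (simp only:)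
  qed
  have W0: "(sector_root r s \<longlongrightarrow> 0) (at_right 0)" by (rule sector_root_tendsto_0(1)[OF rs])
  have "\<forall>\<^sub>F x in at_right 0. x < xs" using xs0 by (intro order_tendstoD(2)[OF tendsto_ident_at]) auto
  then have "\<forall>\<^sub>F x in at_right 0. sector_root r s x \<noteq> 0"
    using eventually_at_right_less[of "0::real"]
  proof eventually_elim
    case (elim x)
    then show ?case using Im_pos_neq[OF sector_Im[OF sector_root(1)[OF rs, of x]]] by (simp add: xs_def)
  qed
  then have "filterlim (sector_root r s) (at 0) (at_right 0)" using W0 by (simp add: filterlim_at)
  from filterlim_compose[OF tendsto_mult_Ln_0 this]
  have WL: "((\<lambda>x. sector_root r s x * Ln (sector_root r s x)) \<longlongrightarrow> 0) (at_right 0)" .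
  \<comment> \<open>The term with \<open>w * Ln w\<close> vanishes in the limit; the only nonreal
    remainder is \<open>Ln \<i>\<close>, with imaginary part pi/2.\<close>
  have "((\<lambda>x. log_param_primitive r s (sector_root r s x)) \<longlongrightarrow>
      of_nat (r + 1) * (0 - 0) - ((0 - 1) * Ln (- \<i> * (0 - 1)) - (0 - 1))
     - of_nat s * ((0 + 1) * Ln (0 + 1) - (0 + 1)) - \<i> * of_real (pi / 2) * 0) (at_right 0)"
    unfolding log_param_primitive_def by (intro tendsto_intros WL W0) (auto simp: complex_nonpos_Reals_iff)
  then have "((\<lambda>x. G x) \<longlongrightarrow> 0 - (of_nat (r + 1) * (0 - 0) - ((0 - 1) * Ln (- \<i> * (0 - 1)) - (0 - 1))
     - of_nat s * ((0 + 1) * Ln (0 + 1) - (0 + 1)) - \<i> * of_real (pi / 2) * 0)) (at_right 0)"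
    unfolding G_def by (intro tendsto_diff sector_root_tendsto_0(2)[OF rs])
  from tendsto_Im[OF this] have G0: "((\<lambda>x. Im (G x)) \<longlongrightarrow> - pi / 2) (at_right 0)" by simp
  have W: "(sector_root r s \<longlongrightarrow> of_real a) (at_left xs)"
    using sector_root_asymp_x_star[OF rs] by (metis a_def xs_def)
  have "isCont (log_param_primitive r s) (of_real a)" by (rule log_param_primitive_isCont) (use a in simp)
  from isCont_tendsto_compose[OF this W]
  have "((\<lambda>x. G x) \<longlongrightarrow> of_real (ln xs) * of_real a - log_param_primitive r s (of_real a)) (at_left xs)"
    unfolding G_def using xs0 by (intro tendsto_intros W) auto
  from tendsto_Im[OF this] have G1: "((\<lambda>x. Im (G x)) \<longlongrightarrow> pi / 2) (at_left xs)"
    by (simp add: Im_log_param_primitive_w_star[OF a])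
  show "set_integrable lborel {0<..<x_star r s} (\<lambda>x. x ^ 0 * (Im (sector_root r s x) / (pi * x)))"
    by (rule sector_root_integral(1)[OF rs zero_less_one G G0 G1[unfolded xs_def]])
  have "(LINT x:{0<..<x_star r s}|lborel. x ^ 0 * (Im (sector_root r s x) / (pi * x))) = (pi / 2 - - pi / 2) / (pi * 1)"
    by (rule sector_root_integral(2)[OF rs zero_less_one G G0 G1[unfolded xs_def]])
  then show "(LINT x:{0<..<x_star r s}|lborel. x ^ 0 * (Im (sector_root r s x) / (pi * x))) = 1" by simp
qed

lemma sector_root_moment:
  assumes rs: "r \<ge> s + 2" and k: "k > 0"
  shows "set_integrable lborel {0<..<x_star r s} (\<lambda>x. x ^ k * (Im (sector_root r s x) / (pi * x)))"
    and "of_nat k * complex_of_real (LINT x:{0<..<x_star r s}|lborel. x ^ k * (Im (sector_root r s x) / (pi * x))) =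
      fps_nth (((1 + fps_X) ^ (r + 1) * inverse (2 + fps_X) ^ s) ^ k) (k - 1)"
proof -
  have sr: "s < r" using rs by simp
  define xs a where "xs = x_star r s" and "a = w_star r s"
  have a: "a > 1" using w_star_gt_1[OF sr] by (simp add: a_def)
  obtain Q c where Q: "\<And>w. Im w > 0 \<Longrightarrow> (Q has_field_derivative param_map r s w ^ k) (at w)"
    "isCont Q 0" "isCont Q (of_real a)" "Im (Q 0) - Im (Q (of_real a)) = pi * c"
    "fps_nth (((1 + fps_X) ^ (r + 1) * inverse (2 + fps_X) ^ s) ^ k) (k - 1) = complex_of_real c"
    using param_map_power_primitive[OF k a, of r s] by metis
  define G where "G x = of_real (x ^ k) * sector_root r s x - Q (sector_root r s x)" for x
  have k0: "real k > 0" using k by simp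
  have G: "(G has_vector_derivative of_real (real k * x ^ k / x) * sector_root r s x) (at x)"
    if x: "0 < x" "x < x_star r s" for x
  proof -
    obtain d where d: "(sector_root r s has_vector_derivative d) (at x)"
      using sector_root_has_vector_derivative[OF rs x] by metis
    have Im: "Im (sector_root r s x) > 0" using sector_Im[OF sector_root(1)[OF rs x]] .
    have p: "((Q \<circ> sector_root r s) has_vector_derivative d * param_map r s (sector_root r s x) ^ k) (at x)"
      by (rule field_vector_diff_chain_at[OF d Q(1)[OF Im]])
    have "((\<lambda>x. x ^ k) has_real_derivative real k * x ^ (k - 1)) (at x)" by (auto intro!: derivative_eq_intros)
    moreover have "real k * x ^ (k - 1) = real k * x ^ k / x" using k x by (cases k) auto
    ultimately have "((\<lambda>x. x ^ k) has_real_derivative real k * x ^ k / x) (at x)"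
      by (simp only:)
    then have "((\<lambda>x. complex_of_real (x ^ k)) has_vector_derivative of_real (real k * x ^ k / x)) (at x)"
      by (rule has_vector_derivative_of_real)
    from has_vector_derivative_diff[OF has_vector_derivative_mult[OF this d] p]
    have "(G has_vector_derivative (of_real (x ^ k) * d + of_real (real k * x ^ k / x) * sector_root r s x) - d * param_map r s (sector_root r s x) ^ k) (at x)"
      by (simp only: G_def[abs_def] o_def)
    \<comment> \<open>The terms with the derivative \<open>d\<close> of the root cancel because z
      takes the value \<open>x\<close> at the root.\<close>
    moreover have "(of_real (x ^ k) * d + of_real (real k * x ^ k / x) * sector_root r s x) - d * param_map r s (sector_root r s x) ^ k = of_real (real k * x ^ k / x) * sector_root r s x"
      unfolding sector_root(2)[OF rs x] by simp
    ultimately show ?thesis by (simp only:)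
  qed
  have W0: "(sector_root r s \<longlongrightarrow> 0) (at_right 0)" by (rule sector_root_tendsto_0(1)[OF rs])
  from isCont_tendsto_compose[OF Q(2) this]
  have "((\<lambda>x. G x) \<longlongrightarrow> of_real (0 ^ k) * 0 - Q 0) (at_right 0)"
    unfolding G_def by (intro tendsto_intros W0)
  from tendsto_Im[OF this] have G0: "((\<lambda>x. Im (G x)) \<longlongrightarrow> - Im (Q 0)) (at_right 0)" by simp
  have W: "(sector_root r s \<longlongrightarrow> of_real a) (at_left xs)"
    using sector_root_asymp_x_star[OF rs] by (metis a_def xs_def)
  from isCont_tendsto_compose[OF Q(3) this]
  have "((\<lambda>x. G x) \<longlongrightarrow> of_real (xs ^ k) * of_real a - Q (of_real a)) (at_left xs)"
    unfolding G_def by (intro tendsto_intros W)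
  from tendsto_Im[OF this] have G1: "((\<lambda>x. Im (G x)) \<longlongrightarrow> - Im (Q (of_real a))) (at_left xs)"
    by (simp flip: of_real_power)
  show "set_integrable lborel {0<..<x_star r s} (\<lambda>x. x ^ k * (Im (sector_root r s x) / (pi * x)))"
    by (rule sector_root_integral(1)[OF rs k0 G G0 G1[unfolded xs_def]])
  have "(LINT x:{0<..<x_star r s}|lborel. x ^ k * (Im (sector_root r s x) / (pi * x))) = (- Im (Q (of_real a)) - - Im (Q 0)) / (pi * real k)"
    by (rule sector_root_integral(2)[OF rs k0 G G0 G1[unfolded xs_def]])
  also have "\<dots> = c / real k" using Q(4) by simp
  finally have "real k * (LINT x:{0<..<x_star r s}|lborel. x ^ k * (Im (sector_root r s x) / (pi * x))) = c"
    using k0 by simp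
  then show "of_nat k * complex_of_real (LINT x:{0<..<x_star r s}|lborel. x ^ k * (Im (sector_root r s x) / (pi * x))) =
      fps_nth (((1 + fps_X) ^ (r + 1) * inverse (2 + fps_X) ^ s) ^ k) (k - 1)"
  proof -
    have "complex_of_real (real k * (LINT x:{0<..<x_star r s}|lborel. x ^ k * (Im (sector_root r s x) / (pi * x)))) = complex_of_real c"
      using \<open>real k * _ = c\<close> by (rule arg_cong)
    then show ?thesis unfolding Q(5) by (simp only: of_real_mult of_real_of_nat_eq)
  qed
qed

section \<open>Identification of the measure\<close>

text \<open>For bounded support the characteristic function is the sum of the moment series; the
  bound \<open>M\<close> justifies exchanging sum and integral. Levy's uniqueness theorem does the
  rest.\<close>

lemma measure_eq_of_moments:
  fixes \<mu> \<nu> :: "real measure"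
  assumes "prob_space \<mu>" "prob_space \<nu>" "sets \<mu> = sets borel" "sets \<nu> = sets borel"
    and bd: "AE x in \<mu>. \<bar>x\<bar> \<le> M" "AE x in \<nu>. \<bar>x\<bar> \<le> M"
    and mom: "\<And>k. (\<integral>x. x ^ k \<partial>\<mu>) = (\<integral>x. x ^ k \<partial>\<nu>)"
  shows "\<mu> = \<nu>"
proof -
  have char: "(\<lambda>k. ((\<i> * of_real t) ^ k / fact k) * complex_of_real (\<integral>x. x ^ k \<partial>\<rho>)) sums char \<rho> t"
    if \<rho>: "prob_space \<rho>" "sets \<rho> = sets borel" "AE x in \<rho>. \<bar>x\<bar> \<le> M" for \<rho> :: "real measure" and t :: real
  proof -
    interpret prob_space \<rho> by fact
    have [measurable_cong]: "sets \<rho> = sets borel" by fact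
    have xk: "integrable \<rho> (\<lambda>x. x ^ k)" for k
    proof (rule integrable_const_bound)
      show "AE x in \<rho>. norm (x ^ k) \<le> M ^ k"
        using \<rho>(3) by eventually_elim (simp add: power_abs power_mono)
    qed measurable
    define f where "f k x = ((\<i> * of_real t) ^ k / fact k) * complex_of_real (x ^ k)" for k :: nat and x :: real
    have fi: "integrable \<rho> (f k)" for k unfolding f_def by (intro integrable_mult_right integrable_of_real xk)
    have nf: "norm (f k x) = (\<bar>t\<bar> * \<bar>x\<bar>) ^ k / fact k" for k x
      by (simp add: f_def norm_mult norm_divide norm_power power_mult_distrib)
    have se: "summable (\<lambda>k. a ^ k / fact k)" for a :: real
      using summable_exp_generic[of a] by (simp add: divide_inverse mult.commute scaleR_conv_of_real)
    have "(\<lambda>k. integral\<^sup>L \<rho> (f k)) sums (\<integral>x. suminf (\<lambda>k. f k x) \<partial>\<rho>)"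
    proof (rule sums_integral)
      show "AE x in \<rho>. summable (\<lambda>k. norm (f k x))" unfolding nf using se by simp
      show "summable (\<lambda>k. \<integral>x. norm (f k x) \<partial>\<rho>)"
      proof (rule summable_comparison_test'[OF se[of "\<bar>t\<bar> * M"], of 0])
        fix k :: nat
        have "(\<integral>x. norm (f k x) \<partial>\<rho>) \<le> (\<integral>x. (\<bar>t\<bar> * M) ^ k / fact k \<partial>\<rho>)"
        proof (rule integral_mono_AE)
          show "AE x in \<rho>. norm (f k x) \<le> (\<bar>t\<bar> * M) ^ k / fact k"
            using \<rho>(3) by eventually_elim (auto simp: nf intro!: divide_right_mono power_mono mult_left_mono)
        qed (use fi in auto)
        then show "norm (\<integral>x. norm (f k x) \<partial>\<rho>) \<le> (\<bar>t\<bar> * M) ^ k / fact k"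
          by (simp add: prob_space)
      qed
    qed (rule fi)
    moreover have "suminf (\<lambda>k. f k x) = iexp (t * x)" for x
    proof -
      have "f k x = (\<i> * of_real (t * x)) ^ k /\<^sub>R fact k" for k
        by (simp add: f_def power_mult_distrib scaleR_conv_of_real divide_inverse mult_ac)
      then show ?thesis by (simp add: exp_def)
    qed
    moreover have "integral\<^sup>L \<rho> (f k) = ((\<i> * of_real t) ^ k / fact k) * complex_of_real (\<integral>x. x ^ k \<partial>\<rho>)" for k
      unfolding f_def by (simp only: integral_mult_right_zero integral_complex_of_real)
    ultimately show ?thesis by (simp add: char_def)
  qed
  have "char \<mu> t = char \<nu> t" for t
    using sums_unique2[OF char[OF assms(1,3) bd(1), of t]] char[OF assms(2,4) bd(2), of t] unfolding mom by blast
  then have "char \<mu> = char \<nu>" by blast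
  moreover have "real_distribution \<mu>" "real_distribution \<nu>"
    using assms by (auto intro!: real_distribution.intro simp: real_distribution_axioms_def dest: sets_eq_imp_space_eq)
  ultimately show ?thesis by (intro Levy_uniqueness)
qed

section \<open>Positivity and boundary behaviour of the density\<close>

lemma mu_density_pos:
  assumes "r \<ge> s + 2" "0 < x" "x < x_star r s"
  shows "mu_density r s x > 0"
  using mu_density_eq_sector_root(2)[OF assms] sector_Im[OF sector_root(1)[OF assms]] assms(2) by simp

text \<open>The exponent is 1 - 1/(r + 1), so the factor 1/x of the density turns the product into
  the imaginary part of the rescaled root over pi. The limit is
  \<open>sin (pi / (r + 1)) / pi\<close>.\<close>

lemma mu_density_at_0:
  assumes rs: "r \<ge> s + 2"
  shows "\<exists>c>0. ((\<lambda>x. x powr (real r / (real r + 1)) * mu_density r s x) \<longlongrightarrow> c) (at_right 0)"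
proof (intro exI conjI)
  define b where "b = 1 / (real r + 1)"
  define c where "c = sin (pi / (real r + 1)) / pi"
  have r1: "real r + 1 > 1" using rs by simp
  have "pi / (real r + 1) < pi" using r1 by (simp add: pos_divide_less_eq)
  then have "sin (pi / (real r + 1)) > 0" using r1 by (intro sin_gt_zero) auto
  then show "c > 0" by (simp add: c_def)
  have "x_star r s > 0" using x_star_eq(2)[of s r] rs by simp
  then have "\<forall>\<^sub>F x in at_right 0. x < x_star r s" by (intro order_tendstoD(2)[OF tendsto_ident_at]) auto
  then have ev: "\<forall>\<^sub>F x in at_right 0. Im (sector_root r s x / of_real (x powr b)) / pi = x powr (real r / (real r + 1)) * mu_density r s x"
    using eventually_at_right_less[of "0::real"]
  proof eventually_elim
    case (elim x)
    have "real r / (real r + 1) = 1 - b" using r1 by (simp add: b_def field_simps)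
    then have "x powr (real r / (real r + 1)) = x / x powr b" using elim by (simp add: powr_diff)
    then show ?case using elim by (simp add: mu_density_eq_sector_root(2)[OF rs])
  qed
  have "((\<lambda>x. Im (sector_root r s x / of_real (x powr b)) / pi) \<longlongrightarrow> Im (cis (pi / (real r + 1))) / pi) (at_right 0)"
    unfolding b_def by (intro tendsto_intros sector_root_asymp_0[OF rs]) simp
  from Lim_transform_eventually[OF this ev]
  show "((\<lambda>x. x powr (real r / (real r + 1)) * mu_density r s x) \<longlongrightarrow> c) (at_right 0)" by (simp add: c_def)
qed

lemma mu_density_at_x_star:
  assumes rs: "r \<ge> s + 2"
  shows "\<exists>c>0. ((\<lambda>x. 1 / sqrt (x_star r s - x) * mu_density r s x) \<longlongrightarrow> c) (at_left (x_star r s))"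
proof -
  define xs where "xs = x_star r s"
  have xs: "xs > 0" using x_star_eq(2)[of s r] rs by (simp add: xs_def)
  obtain c where c: "c > 0" "((\<lambda>x. Im (sector_root r s x) / sqrt (xs - x)) \<longlongrightarrow> c) (at_left xs)"
    using sector_root_asymp_x_star[OF rs] unfolding xs_def by metis
  have "((\<lambda>x. Im (sector_root r s x) / sqrt (xs - x) / (pi * x)) \<longlongrightarrow> c / (pi * xs)) (at_left xs)"
    using xs by (intro tendsto_intros c(2)) auto
  moreover have "\<forall>\<^sub>F x in at_left xs. Im (sector_root r s x) / sqrt (xs - x) / (pi * x) = 1 / sqrt (xs - x) * mu_density r s x"
  proof -
    have "\<forall>\<^sub>F x in at_left xs. x > 0" using xs by (intro order_tendstoD(1)[OF tendsto_ident_at]) auto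
    moreover have "\<forall>\<^sub>F x in at_left xs. x < xs" by (simp add: eventually_at_filter)
    ultimately show ?thesis
    proof eventually_elim
      case (elim x)
      then show ?case by (simp add: mu_density_eq_sector_root(2)[OF rs] xs_def)
    qed
  qed
  ultimately have "((\<lambda>x. 1 / sqrt (xs - x) * mu_density r s x) \<longlongrightarrow> c / (pi * xs)) (at_left xs)"
    by (rule Lim_transform_eventually)
  then show ?thesis using c(1) xs unfolding xs_def by (intro exI[of _ "c / (pi * x_star r s)"]) simp
qed

theorem theorem2p2:
  fixes r s :: nat and R A P \<mu> :: "real measure"
  assumes "r \<ge> s + 2"
    and "is_raney (real r - real s + 1) 1 R"
    and "is_raney 1 (1 / 2) A"
    and "is_free_mult_power A s P"
    and "is_free_mult_conv R P \<mu>"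
  shows "w_star r s > 1 \<and> x_star r s > 0 \<and>
    (AE x in \<mu>. x \<in> {0..x_star r s}) \<and>
    (\<forall>x\<in>{0<..<x_star r s}.
       gamma_integrable (path_angle r) (log_integrand r s x) \<and> mu_density r s x > 0) \<and>
    \<mu> = density lborel
          (\<lambda>x. ennreal (indicator {0<..<x_star r s} x * mu_density r s x)) \<and>
    (\<exists>c>0. ((\<lambda>x. x powr (real r / (real r + 1)) * mu_density r s x) \<longlongrightarrow> c) (at_right 0)) \<and>
    (\<exists>c>0. ((\<lambda>x. 1 / sqrt (x_star r s - x) * mu_density r s x) \<longlongrightarrow> c) (at_left (x_star r s)))"
proof -
  have sr: "s < r" using assms(1) by simp
  define xs where "xs = x_star r s"
  have xs: "xs > 0" using x_star_eq(2)[OF sr] by (simp add: xs_def)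
  define f where "f x = indicator {0<..<xs} x * mu_density r s x" for x
  define \<nu> where "\<nu> = density lborel (\<lambda>x. ennreal (f x))"
  \<comment> \<open>From here on the density is handled through the root, whose continuity and
    moments are known.\<close>
  have f_eq: "f x = indicator {0<..<xs} x *\<^sub>R (Im (sector_root r s x) / (pi * x))" for x
    using mu_density_eq_sector_root(2)[OF assms(1), of x] by (auto simp: f_def indicator_def xs_def)
  have fpos: "f x \<ge> 0" for x
    using mu_density_pos[OF assms(1), of x] by (auto simp: f_def indicator_def xs_def)
  have "continuous_on {0<..<xs} (\<lambda>x. Im (sector_root r s x) / (pi * x))"
  proof (intro continuous_at_imp_continuous_on ballI)
    fix x assume "x \<in> {0<..<xs}"
    then have x: "0 < x" "x < x_star r s" by (auto simp: xs_def)
    have "isCont (\<lambda>x. Im (sector_root r s x)) x"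
      using sector_root_isCont[OF assms(1) x] unfolding isCont_def by (rule tendsto_Im)
    then show "isCont (\<lambda>x. Im (sector_root r s x) / (pi * x)) x" using x by (intro continuous_intros) auto
  qed
  then have fm [measurable]: "f \<in> borel_measurable borel"
    unfolding f_eq[abs_def] by (intro borel_measurable_continuous_on_indicator) auto
  have mom: "integrable lborel (\<lambda>x. f x * x ^ k)"
      "(\<integral>x. x ^ k \<partial>\<nu>) = (LINT x:{0<..<xs}|lborel. x ^ k * (Im (sector_root r s x) / (pi * x)))" for k
  proof -
    have e: "indicator {0<..<xs} x *\<^sub>R (x ^ k * (Im (sector_root r s x) / (pi * x))) = f x * x ^ k" for x
      by (simp add: f_eq)
    have "set_integrable lborel {0<..<xs} (\<lambda>x. x ^ k * (Im (sector_root r s x) / (pi * x)))"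
      using sector_root_mass(1)[OF assms(1)] sector_root_moment(1)[OF assms(1), of k] unfolding xs_def by (cases "k = 0") auto
    then show "integrable lborel (\<lambda>x. f x * x ^ k)" unfolding set_integrable_def e .
    have "(\<integral>x. x ^ k \<partial>\<nu>) = (\<integral>x. f x *\<^sub>R x ^ k \<partial>lborel)"
      unfolding \<nu>_def by (rule integral_density) (use fpos in auto)
    also have "\<dots> = (LINT x:{0<..<xs}|lborel. x ^ k * (Im (sector_root r s x) / (pi * x)))"
      unfolding set_lebesgue_integral_def e by simp
    finally show "(\<integral>x. x ^ k \<partial>\<nu>) = (LINT x:{0<..<xs}|lborel. x ^ k * (Im (sector_root r s x) / (pi * x)))" .
  qed
  have mass: "(\<integral>x. f x \<partial>lborel) = 1"
  proof -
    have "(LINT x:{0<..<xs}|lborel. x ^ 0 * (Im (sector_root r s x) / (pi * x))) = 1"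
      unfolding xs_def by (rule sector_root_mass(2)[OF assms(1)])
    then show ?thesis by (simp add: set_lebesgue_integral_def f_eq)
  qed
  have \<nu>: "prob_space \<nu>"
  proof
    have "emeasure \<nu> (space \<nu>) = (\<integral>\<^sup>+x. ennreal (f x) \<partial>lborel)"
      by (simp add: \<nu>_def emeasure_density)
    also have "\<dots> = ennreal (\<integral>x. f x \<partial>lborel)"
      using mom(1)[of 0] fpos by (intro nn_integral_eq_integral) auto
    finally show "emeasure \<nu> (space \<nu>) = 1" by (simp add: mass)
  qed
  have \<nu>AE: "AE x in \<nu>. x \<in> {0..xs}"
    unfolding \<nu>_def by (subst AE_density) (simp, auto simp: f_def indicator_def intro!: AE_I2)
  have \<mu>: "prob_space \<mu>" "sets \<mu> = sets borel" "\<exists>M. AE x in \<mu>. 0 \<le> x \<and> x \<le> M"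
    using assms(5) by (auto simp: is_free_mult_conv_def compact_prob_on_halfline_def)
  obtain M where M: "AE x in \<mu>. 0 \<le> x \<and> x \<le> M" using \<mu>(3) by blast
  \<comment> \<open>\<open>M\<close> is an a priori bound supplied by the definition of the
    convolution. The exact support is read off from \<open>\<nu>\<close> after the
    identification.\<close>
  have "\<mu> = \<nu>"
  proof (rule measure_eq_of_moments[OF \<mu>(1) \<nu> \<mu>(2)])
    show "sets \<nu> = sets borel" by (simp add: \<nu>_def)
    show "AE x in \<mu>. \<bar>x\<bar> \<le> max M xs" using M by eventually_elim auto
    show "AE x in \<nu>. \<bar>x\<bar> \<le> max M xs" using \<nu>AE by eventually_elim auto
    fix k :: nat
    show "(\<integral>x. x ^ k \<partial>\<mu>) = (\<integral>x. x ^ k \<partial>\<nu>)"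
    proof (cases "k = 0")
      case True
      then show ?thesis using prob_space.prob_space[OF \<mu>(1)] prob_space.prob_space[OF \<nu>] by simp
    next
      case False
      then have k: "k > 0" by simp
      \<comment> \<open>Both sides are the same coefficient, the residue of z^k at 1.\<close>
      have "of_nat k * complex_of_real (\<integral>x. x ^ k \<partial>\<mu>) = of_nat k * complex_of_real (\<integral>x. x ^ k \<partial>\<nu>)"
        unfolding moments_raney_arcsine_power[OF less_imp_le[OF sr] assms(2-5) k] mom(2)
        unfolding xs_def by (rule sector_root_moment(2)[OF assms(1) k, symmetric])
      then show ?thesis using k by simp
    qed
  qed
  then have \<mu>_eq: "\<mu> = density lborel (\<lambda>x. ennreal (indicator {0<..<xs} x * mu_density r s x))"
    by (simp add: \<nu>_def f_def)
  have "AE x in \<mu>. x \<in> {0..xs}" unfolding \<open>\<mu> = \<nu>\<close> by (rule \<nu>AE)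
  moreover have "\<forall>x\<in>{0<..<xs}. gamma_integrable (path_angle r) (log_integrand r s x) \<and> mu_density r s x > 0"
    using mu_density_eq_sector_root(1)[OF assms(1)] mu_density_pos[OF assms(1)] by (auto simp: xs_def)
  ultimately show ?thesis
    using w_star_gt_1[OF sr] xs \<mu>_eq mu_density_at_0[OF assms(1)] mu_density_at_x_star[OF assms(1)]
    unfolding xs_def by blast
qed

end
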